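(* Let $b:\mathbb{D}\to\mathbb{D}$ be an analytic function with zero sequence $(a_n)_n$ (listed with multiplicity) and singular inner factor $S_\nu$ (with singular measure $\nu\ge 0$ on $\mathbb{T}$), and let $\Omega$ be an approach region at $1$. For any integer $m\ge 0$ the following are equivalent: (i) $\sup_{z\in\Omega}\|\overline{\partial_z}^m k^b_z\|_b<\infty$; (ii) for every $f\in\mathcal{H}(b)$, $f^{(m)}(z)$ has a limit as $z\to 1$ with $z\in\Omega$; (iii) \[\sup_{z\in\Omega}\ \sum_n\frac{1-|a_n|^2}{|1-\overline{a_n}z|^{2m+2}}+\int_{\mathbb{T}}\frac{d\nu(\zeta)}{|1-\overline{\zeta}z|^{2m+2}}+\int_{\mathbb{T}}\frac{-\log|b(\zeta)|}{|1-\overline{\zeta}z|^{2m+2}}\,dm(\zeta)<\infty.\]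
   Context: $\mathbb{D}$ is the open unit disk, $\mathbb{T}$ the unit circle, $m$ (as a measure) is normalized Lebesgue measure on $\mathbb{T}$, and $|b(\zeta)|$ denotes the nontangential boundary values of $b$. The factorization $b=BS_\nu b_o$ is the usual inner–outer factorization, with $B$ the Blaschke product of the zeros $(a_n)$, $S_\nu(z)=\exp(-\int_{\mathbb{T}}\frac{\zeta+z}{\zeta-z}d\nu(\zeta))$. The de Branges–Rovnyak space $\mathcal{H}(b)$ is the reproducing kernel Hilbert space of analytic functions on $\mathbb{D}$ with reproducing kernel $k^b_z(w)=\frac{1-\overline{b(z)}b(w)}{1-\overline{z}w}$, i.e. $f(z)=\langle f,k^b_z\rangle_b$; its norm is $\|\cdot\|_b$. For $z\in\mathbb{D}$, $\overline{\partial_z}^m k^b_z\in\mathcal{H}(b)$ denotes the $m$-th derivative of $z\mapsto k^b_z$ with respect to $\bar z$ (a norm limit of difference quotients), and it satisfies $\langle f,\overline{\partial_z}^m k^b_z\rangle_b=f^{(m)}(z)$ and $\|\overline{\partial_z}^m k^b_z\|_b^2=\partial_z^m\overline{\partial_z}^m\frac{1-|b(z)|^2}{1-|z|^2}$. An approach region at $1$ is an open simply connected domain $\Omega\subset\mathbb{D}$ with $\partial\Omega\cap\mathbb{T}=\{1\}$ which is star-shaped with respect to $1$ near $1$: for all $z\in\Omega$ sufficiently close to $1$ the segment from $1$ to $z$ lies in $\Omega$. *)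

theory Defs
  imports "HOL-Complex_Analysis.Complex_Analysis" "HOL-Probability.Probability"
begin

definition mT :: "complex measure" where
  "mT = distr (density (restrict_space lborel {0..<2*pi}) (\<lambda>_. ennreal (1/(2*pi)))) borel cis"

text \<open>Boundary modulus |b(zeta)| (radial limit; equals the nontangential limit m-a.e.).\<close>
definition bdry_abs :: "(complex \<Rightarrow> complex) \<Rightarrow> complex \<Rightarrow> real" where
  "bdry_abs b \<zeta> = Lim (at_left 1) (\<lambda>r::real. cmod (b (of_real r * \<zeta>)))"

definition poisson :: "complex \<Rightarrow> complex \<Rightarrow> real" where
  "poisson z \<zeta> = (1 - (cmod z)^2) / (cmod (\<zeta> - z))^2"

text \<open>Zeros of b in the disk; multiplicities are given by zorder.\<close>
definition zeros_D :: "(complex \<Rightarrow> complex) \<Rightarrow> complex set" where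
  "zeros_D b = {w \<in> ball 0 1. b w = 0}"

text \<open>The singular inner factor of b is S_nu: nu is a finite positive Borel measure on T,
  singular w.r.t. m, and b = B S_nu b_o, written in modulus form (which determines nu and
  is equivalent to the factorization up to a unimodular constant):
  -log|b(z)| = sum_n -log|(z-a_n)/(1-conj(a_n) z)| + int P(z,.) dnu + int P(z,.) (-log|b|) dm.\<close>
definition singular_factor_measure :: "(complex \<Rightarrow> complex) \<Rightarrow> complex measure \<Rightarrow> bool" where
  "singular_factor_measure b \<nu> \<longleftrightarrow>
     sets \<nu> = sets borel \<and> finite_measure \<nu> \<and>
     emeasure \<nu> (UNIV - sphere 0 1) = 0 \<and>
     (\<exists>A \<in> sets borel. emeasure \<nu> (UNIV - A) = 0 \<and> emeasure mT A = 0) \<and>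
     (\<forall>z \<in> ball 0 1. b z \<noteq> 0 \<longrightarrow>
        ennreal (- ln (cmod (b z))) =
          (\<integral>\<^sup>+ a. ennreal (of_nat (nat (zorder b a)) *
                 (- ln (cmod ((z - a) / (1 - cnj a * z))))) \<partial>count_space (zeros_D b))
          + (\<integral>\<^sup>+ \<zeta>. ennreal (poisson z \<zeta>) \<partial>\<nu>)
          + (\<integral>\<^sup>+ \<zeta>. ennreal (poisson z \<zeta> * (- ln (bdry_abs b \<zeta>))) \<partial>mT))"

definition kb :: "(complex \<Rightarrow> complex) \<Rightarrow> complex \<Rightarrow> complex \<Rightarrow> complex" where
  "kb b z w = (1 - cnj (b z) * b w) / (1 - cnj z * w)"

text \<open>The function w |-> (d/d conj z)^m k^b_z (w) = conj( (d/dz)^m [(1 - b(z) conj(b w))/(1 - z conj w)] ).\<close>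
definition kd :: "(complex \<Rightarrow> complex) \<Rightarrow> nat \<Rightarrow> complex \<Rightarrow> complex \<Rightarrow> complex" where
  "kd b m z = (\<lambda>w. cnj ((deriv ^^ m) (\<lambda>\<xi>. (1 - b \<xi> * cnj (b w)) / (1 - \<xi> * cnj w)) z))"

text \<open>Aronszajn's characterization of the RKHS H(b): f belongs to H(b) with ||f||^2 <= C iff
  |sum_i c_i f(z_i)|^2 <= C * sum_{i,j} c_i conj(c_j) k_{z_j}(z_i) for all finite families.\<close>
definition hb_dom :: "(complex \<Rightarrow> complex) \<Rightarrow> real \<Rightarrow> (complex \<Rightarrow> complex) \<Rightarrow> bool" where
  "hb_dom b C f \<longleftrightarrow>
     (\<forall>(n::nat) (zs::nat \<Rightarrow> complex) (cs::nat \<Rightarrow> complex). (\<forall>i<n. zs i \<in> ball 0 1) \<longrightarrow>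
        (cmod (\<Sum>i<n. cs i * f (zs i)))^2
          \<le> C * Re (\<Sum>i<n. \<Sum>j<n. cs i * cnj (cs j) * kb b (zs j) (zs i)))"

definition in_Hb :: "(complex \<Rightarrow> complex) \<Rightarrow> (complex \<Rightarrow> complex) \<Rightarrow> bool" where
  "in_Hb b f \<longleftrightarrow> f holomorphic_on ball 0 1 \<and> (\<exists>C. hb_dom b C f)"

definition hb_norm :: "(complex \<Rightarrow> complex) \<Rightarrow> (complex \<Rightarrow> complex) \<Rightarrow> real" where
  "hb_norm b f = sqrt (Inf {C. hb_dom b C f})"

definition approach_region :: "complex set \<Rightarrow> bool" where
  "approach_region \<Omega> \<longleftrightarrow> open \<Omega> \<and> simply_connected \<Omega> \<and> \<Omega> \<noteq> {} \<and> \<Omega> \<subseteq> ball 0 1 \<and>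
     frontier \<Omega> \<inter> sphere 0 1 = {1} \<and>
     (\<exists>\<delta>>0. \<forall>z\<in>\<Omega>. cmod (z - 1) < \<delta> \<longrightarrow> closed_segment 1 z - {1} \<subseteq> \<Omega>)"

end

theory Submission
  imports Defs "HOL-Real_Asymp.Real_Asymp"
begin

text \<open>
  The function \<open>b\<close> is a locally uniform limit of unimodular multiples of finite Blaschke products
  \<open>B\<close>: a point mass \<open>s\<close> on the circle is imitated by many zeros close to it whose quantities
  \<open>1 - |a|\<^sup>2\<close> add up to \<open>2 * s\<close>, and Montel's theorem together with the modulus formula does the rest.
  For \<open>B = \<Prod>\<phi>\<^sub>k\<close> with partial products \<open>B\<^sub>k\<close> and
  \<open>e\<^sub>k(z) = B\<^sub>k(z) / (1 - cnj a\<^sub>k * z)\<close> the kernel telescopes to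
  \<open>\<Sum> (1 - |a\<^sub>k|\<^sup>2) * e\<^sub>k(z) * cnj (e\<^sub>k(w))\<close>, so the squared norm of the \<open>m\<close>-th derivative of the
  kernel is \<open>\<Sum> (1 - |a\<^sub>k|\<^sup>2) * |e\<^sub>k^(m)(z)|\<^sup>2\<close>, to be compared with
  \<open>S(p) = \<Sum> (1 - |a\<^sub>k|\<^sup>2) / |1 - cnj a\<^sub>k * z|^p\<close> for \<open>p = 2 * m + 2\<close>. The logarithmic derivative of
  \<open>B\<^sub>k\<close> shows that \<open>S(q)\<close> bounds the derivatives of \<open>B\<^sub>k\<close> of order less than \<open>q\<close>. This gives the upper
  bound for the norm, and by induction on \<open>m\<close> also the lower one, because
  \<open>B\<^sub>k(z) * m! * (cnj a\<^sub>k)^m / (1 - cnj a\<^sub>k * z)^(m+1)\<close> dominates \<open>e\<^sub>k^(m)\<close>. The induction needs the norms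
  of lower order to be bounded; they are, since functions with bounded derivatives are Lipschitz
  along the segments towards \<open>1\<close> and any two such segments lie in a common Stolz angle. The same
  Lipschitz argument makes \<open>b^(j)\<close> converge for \<open>j \<le> m\<close>, hence \<open>f^(m)\<close> for \<open>f\<close> in the span of
  the kernels, and by density for all \<open>f\<close>. The converse is the uniform boundedness principle.
\<close>

text \<open>No Hilbert space is constructed. Membership and norm in H(b) are handled through the
  quadratic inequality in \<open>hb_dom\<close>, and inner products of derivative functionals
  through mixed derivatives of the kernel. Positivity and Cauchy-Schwarz are evident for finite
  Blaschke products, whose kernel is an explicit finite sum, and they persist in the limit. For this
  all estimates have to be uniform in the number of zeros. The obstacle is that the logarithmic
  derivative has poles at the zeros. It is harmless while every factor has modulus at least 1/2, and
  a bound on the sum of order 2 ensures this once \<open>1 - |z|\<close> is small; conversely a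
  bound on the norm of order 0 forces \<open>|b|\<close> towards 1. So norms and sums are compared
  near 1 only, and the rest of the region, which stays in a compact subset of the disk, is treated
  by crude bounds. The short segments that join two rays near 1 may leave the region. The bounds
  there depend on the two endpoints, and the argument is arranged so that they drop out as the
  segment shrinks to 1.\<close>

definition blaschke_factor :: "complex \<Rightarrow> complex \<Rightarrow> complex" where
  "blaschke_factor a z = (z - a) / (1 - cnj a * z)"

section \<open>Moebius factors of the disk and elementary higher derivatives\<close>

lemma norm_one_minus_cnj_mult_ge:
  assumes "cmod a \<le> 1"
  shows "1 - cmod z \<le> cmod (1 - cnj a * z)"
proof -
  have "cmod (cnj a * z) \<le> cmod z"
    using assms by (simp add: norm_mult mult_left_le_one_le)
  then show ?thesis
    using norm_triangle_ineq2[of 1 "cnj a * z"] by simp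
qed

lemma norm_one_minus_cnj_mult_le:
  assumes "cmod a \<le> 1" "cmod z \<le> 1"
  shows "cmod (1 - cnj a * z) \<le> 2"
proof -
  have "cmod (cnj a * z) \<le> 1"
    using assms by (simp add: norm_mult mult_le_one)
  then show ?thesis
    using norm_triangle_ineq4[of 1 "cnj a * z"] by simp
qed

lemma one_minus_cnj_mult_nonzero:
  assumes "cmod a \<le> 1" "cmod z < 1"
  shows "1 - cnj a * z \<noteq> 0"
  using norm_one_minus_cnj_mult_ge[OF assms(1), of z] assms(2) by auto

lemma norm_one_minus_cnj_mult_pos:
  assumes "cmod a \<le> 1" "cmod z < 1"
  shows "0 < cmod (1 - cnj a * z)"
  using one_minus_cnj_mult_nonzero[OF assms] by simp

text \<open>For \<open>|a| = 1\<close> the factor is the constant \<open>-a\<close>, in accordance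
  with the weight \<open>1 - |a|^2 = 0\<close>; this is why points of the circle can be allowed as
  zeros throughout.\<close>

lemma one_minus_norm_blaschke_factor:
  assumes "cmod a \<le> 1" "cmod z < 1"
  shows "1 - (cmod (blaschke_factor a z))\<^sup>2
    = (1 - (cmod a)\<^sup>2) * (1 - (cmod z)\<^sup>2) / (cmod (1 - cnj a * z))\<^sup>2"
proof -
  have nz: "cmod (1 - cnj a * z) \<noteq> 0"
    using one_minus_cnj_mult_nonzero[OF assms] by simp
  have "(cmod (1 - cnj a * z))\<^sup>2 - (cmod (z - a))\<^sup>2 = (1 - (cmod a)\<^sup>2) * (1 - (cmod z)\<^sup>2)"
    by (simp only: cmod_power2) (simp add: power2_eq_square algebra_simps)
  then show ?thesis
    using nz by (simp add: blaschke_factor_def norm_divide power_divide field_simps)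
qed

lemma norm_blaschke_factor_le_1:
  assumes "cmod a \<le> 1" "cmod z < 1"
  shows "cmod (blaschke_factor a z) \<le> 1"
proof -
  have "0 \<le> 1 - (cmod (blaschke_factor a z))\<^sup>2"
    unfolding one_minus_norm_blaschke_factor[OF assms]
    using assms by (intro divide_nonneg_nonneg mult_nonneg_nonneg) (auto simp: power_le_one)
  then show ?thesis
    by (simp add: abs_square_le_1)
qed

text \<open>Polarized form of the preceding identity. Divided by \<open>1 - z * cnj w\<close> it is
  the rank-one kernel of a single factor, the summand of the telescoping sum below.\<close>

lemma one_minus_blaschke_factor_kernel:
  assumes "cmod a \<le> 1" "cmod z < 1" "cmod w < 1"
  shows "1 - blaschke_factor a z * cnj (blaschke_factor a w)
    = of_real (1 - (cmod a)\<^sup>2) * (1 - z * cnj w) / ((1 - cnj a * z) * cnj (1 - cnj a * w))"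
proof -
  have nz: "1 - cnj a * z \<noteq> 0" "1 - a * cnj w \<noteq> 0"
    using one_minus_cnj_mult_nonzero[OF assms(1,2)]
      one_minus_cnj_mult_nonzero[of "cnj a" "cnj w"] assms by auto
  have sq: "of_real (1 - (cmod a)\<^sup>2) = 1 - a * cnj a"
    by (simp only: of_real_diff of_real_1 complex_norm_square)
  show ?thesis
    unfolding blaschke_factor_def sq
    using nz by (simp add: divide_simps) (simp add: algebra_simps)
qed

lemma higher_deriv_inverse_affine:
  fixes \<alpha> \<beta> z :: complex
  assumes "\<alpha> + \<beta> * z \<noteq> 0"
  shows "(deriv ^^ j) (\<lambda>z. 1 / (\<alpha> + \<beta> * z)) z = fact j * (- \<beta>) ^ j / (\<alpha> + \<beta> * z) ^ Suc j"
  using assms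
proof (induction j arbitrary: z)
  case 0
  then show ?case by simp
next
  case (Suc j)
  have op: "open {z. \<alpha> + \<beta> * z \<noteq> 0}"
    by (intro open_Collect_neq continuous_intros)
  have "eventually (\<lambda>z. z \<in> {z. \<alpha> + \<beta> * z \<noteq> 0}) (nhds z)"
    using op Suc.prems by (intro eventually_nhds_in_open) auto
  then have ev: "eventually (\<lambda>z. (deriv ^^ j) (\<lambda>z. 1 / (\<alpha> + \<beta> * z)) z
      = fact j * (- \<beta>) ^ j * inverse ((\<alpha> + \<beta> * z) ^ Suc j)) (nhds z)"
    by eventually_elim (subst Suc.IH, simp_all add: divide_inverse)
  have quot: "c * - (inverse (u ^ Suc j) * (of_nat (Suc j) * u ^ j * \<beta>) * inverse (u ^ Suc j))
      = of_nat (Suc j) * c * (- \<beta>) / u ^ Suc (Suc j)" if "u \<noteq> 0" for c u :: complex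
    using that by (simp add: field_simps)
  have "((\<lambda>z. fact j * (- \<beta>) ^ j * inverse ((\<alpha> + \<beta> * z) ^ Suc j)) has_field_derivative
      fact j * (- \<beta>) ^ j * - (inverse ((\<alpha> + \<beta> * z) ^ Suc j)
        * (of_nat (Suc j) * (\<alpha> + \<beta> * z) ^ j * \<beta>) * inverse ((\<alpha> + \<beta> * z) ^ Suc j))) (at z)"
    using Suc.prems by (auto intro!: derivative_eq_intros simp del: power_Suc)
  then have "((\<lambda>z. fact j * (- \<beta>) ^ j * inverse ((\<alpha> + \<beta> * z) ^ Suc j)) has_field_derivative
      fact (Suc j) * (- \<beta>) ^ Suc j / (\<alpha> + \<beta> * z) ^ Suc (Suc j)) (at z)"
    unfolding quot[OF Suc.prems] by (simp add: mult.assoc mult.commute mult.left_commute)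
  then have "deriv (\<lambda>z. fact j * (- \<beta>) ^ j * inverse ((\<alpha> + \<beta> * z) ^ Suc j)) z
      = fact (Suc j) * (- \<beta>) ^ Suc j / (\<alpha> + \<beta> * z) ^ Suc (Suc j)"
    by (rule DERIV_imp_deriv)
  then show ?case
    using deriv_cong_ev[OF ev refl] by (simp del: power_Suc fact_Suc)
qed

lemma higher_deriv_sum:
  fixes f :: "'a \<Rightarrow> complex \<Rightarrow> complex"
  assumes "\<And>i. i \<in> I \<Longrightarrow> f i holomorphic_on S" "open S" "z \<in> S"
  shows "(deriv ^^ j) (\<lambda>w. \<Sum>i\<in>I. f i w) z = (\<Sum>i\<in>I. (deriv ^^ j) (f i) z)"
  using assms(1)
proof (induction I rule: infinite_finite_induct)
  case (insert x F)
  have "(deriv ^^ j) (\<lambda>w. f x w + (\<Sum>i\<in>F. f i w)) z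
      = (deriv ^^ j) (f x) z + (deriv ^^ j) (\<lambda>w. \<Sum>i\<in>F. f i w) z"
    using insert.prems assms by (intro higher_deriv_add[of _ S] holomorphic_intros) auto
  then show ?case
    using insert by simp
qed simp_all

section \<open>Finite Blaschke products\<close>

definition blaschke_prod :: "(nat \<Rightarrow> complex) \<Rightarrow> nat \<Rightarrow> complex \<Rightarrow> complex" where
  "blaschke_prod a k z = (\<Prod>i<k. blaschke_factor (a i) z)"

definition blaschke_sum :: "(nat \<Rightarrow> complex) \<Rightarrow> nat \<Rightarrow> nat \<Rightarrow> complex \<Rightarrow> real" where
  "blaschke_sum a n p z = (\<Sum>i<n. (1 - (cmod (a i))\<^sup>2) / cmod (1 - cnj (a i) * z) ^ p)"

text \<open>The Takenaka--Malmquist functions, up to normalization.\<close>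
definition blaschke_basis :: "(nat \<Rightarrow> complex) \<Rightarrow> nat \<Rightarrow> complex \<Rightarrow> complex" where
  "blaschke_basis a k z = blaschke_prod a k z * (1 / (1 - cnj (a k) * z))"

lemma blaschke_factor_holomorphic:
  assumes "cmod a \<le> 1"
  shows "blaschke_factor a holomorphic_on ball 0 1"
proof -
  have "(\<lambda>z. (z - a) / (1 - cnj a * z)) holomorphic_on ball 0 1"
    using one_minus_cnj_mult_nonzero[OF assms] by (intro holomorphic_intros) auto
  then show ?thesis
    by (simp add: blaschke_factor_def[abs_def])
qed

lemma blaschke_prod_holomorphic:
  assumes "\<And>i. i < k \<Longrightarrow> cmod (a i) \<le> 1"
  shows "blaschke_prod a k holomorphic_on ball 0 1"
  unfolding blaschke_prod_def[abs_def]
  using assms by (intro holomorphic_on_prod blaschke_factor_holomorphic) auto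

lemma inverse_one_minus_holomorphic:
  assumes "cmod a \<le> 1"
  shows "(\<lambda>z. 1 / (1 - cnj a * z)) holomorphic_on ball 0 1"
  using one_minus_cnj_mult_nonzero[OF assms] by (intro holomorphic_intros) auto

lemma blaschke_basis_holomorphic:
  assumes "\<And>i. i \<le> k \<Longrightarrow> cmod (a i) \<le> 1"
  shows "blaschke_basis a k holomorphic_on ball 0 1"
  unfolding blaschke_basis_def[abs_def]
  using assms
  by (intro holomorphic_on_mult blaschke_prod_holomorphic inverse_one_minus_holomorphic) auto

lemma norm_blaschke_prod_antimono:
  assumes "\<And>i. i < n \<Longrightarrow> cmod (a i) \<le> 1" "cmod z < 1" "k \<le> n"
  shows "cmod (blaschke_prod a n z) \<le> cmod (blaschke_prod a k z)"
  using assms(3,1)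
proof (induction n rule: dec_induct)
  case (step n)
  have "cmod (blaschke_prod a (Suc n) z) = cmod (blaschke_prod a n z) * cmod (blaschke_factor (a n) z)"
    by (simp add: blaschke_prod_def norm_mult)
  also have "\<dots> \<le> cmod (blaschke_prod a n z)"
    using norm_blaschke_factor_le_1[of "a n" z] step.prems assms(2)
    by (intro mult_right_le_one_le) auto
  finally show ?case
    using step by auto
qed simp

lemma norm_blaschke_prod_le_1:
  assumes "\<And>i. i < k \<Longrightarrow> cmod (a i) \<le> 1" "cmod z < 1"
  shows "cmod (blaschke_prod a k z) \<le> 1"
  using norm_blaschke_prod_antimono[of k a z 0] assms by (simp add: blaschke_prod_def)

lemma norm_blaschke_prod_le_factor:
  assumes "\<And>i. i < n \<Longrightarrow> cmod (a i) \<le> 1" "cmod z < 1" "i < n"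
  shows "cmod (blaschke_prod a n z) \<le> cmod (blaschke_factor (a i) z)"
proof -
  have "cmod (blaschke_prod a n z) \<le> cmod (blaschke_prod a (Suc i) z)"
    using assms by (intro norm_blaschke_prod_antimono) auto
  also have "\<dots> = cmod (blaschke_prod a i z) * cmod (blaschke_factor (a i) z)"
    by (simp add: blaschke_prod_def norm_mult)
  also have "\<dots> \<le> cmod (blaschke_factor (a i) z)"
    using norm_blaschke_prod_le_1[of i a z] assms
    by (intro mult_left_le_one_le) auto
  finally show ?thesis .
qed

text \<open>Appending a factor \<open>f\<close> to \<open>B\<close> splits the numerator into that
  of \<open>B\<close> plus \<open>B(z) * cnj (B(w)) * (1 - f(z) * cnj (f(w)))\<close>, and the
  second part is of rank one.\<close>

lemma blaschke_kernel_telescope: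
  assumes "\<And>i. i < n \<Longrightarrow> cmod (a i) \<le> 1" "cmod z < 1" "cmod w < 1"
  shows "(1 - blaschke_prod a n z * cnj (blaschke_prod a n w)) / (1 - z * cnj w)
    = (\<Sum>k<n. of_real (1 - (cmod (a k))\<^sup>2) * blaschke_basis a k z * cnj (blaschke_basis a k w))"
  using assms(1)
proof (induction n)
  case 0
  then show ?case by (simp add: blaschke_prod_def)
next
  case (Suc n)
  let ?B = "\<lambda>z. blaschke_prod a n z" and ?f = "\<lambda>z. blaschke_factor (a n) z"
  have nz: "1 - z * cnj w \<noteq> 0"
    using one_minus_cnj_mult_nonzero[of w z] assms by (simp add: mult.commute)
  have an: "cmod (a n) \<le> 1" using Suc.prems by simp
  have "1 - blaschke_prod a (Suc n) z * cnj (blaschke_prod a (Suc n) w)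
      = (1 - ?B z * cnj (?B w)) + ?B z * cnj (?B w) * (1 - ?f z * cnj (?f w))"
    by (simp add: blaschke_prod_def algebra_simps)
  also have "\<dots> / (1 - z * cnj w) = (1 - ?B z * cnj (?B w)) / (1 - z * cnj w)
      + of_real (1 - (cmod (a n))\<^sup>2) * blaschke_basis a n z * cnj (blaschke_basis a n w)"
    unfolding one_minus_blaschke_factor_kernel[OF an assms(2,3)] blaschke_basis_def
    using nz by (simp add: add_divide_distrib)
  finally show ?case
    using Suc by simp
qed

lemma blaschke_sum_nonneg:
  assumes "\<And>i. i < n \<Longrightarrow> cmod (a i) \<le> 1"
  shows "0 \<le> blaschke_sum a n p z"
  unfolding blaschke_sum_def
  using assms by (intro sum_nonneg divide_nonneg_nonneg) (auto simp: power_le_one)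

lemma inverse_power_le_two_power:
  fixes x :: real
  assumes "0 < x" "x \<le> 2" "p \<le> q"
  shows "1 / x ^ p \<le> 2 ^ (q - p) / x ^ q"
proof -
  have "x ^ q = x ^ p * x ^ (q - p)"
    using assms by (simp flip: power_add)
  also have "\<dots> \<le> x ^ p * 2 ^ (q - p)"
    using assms by (intro mult_left_mono power_mono) auto
  finally show ?thesis
    using assms by (simp add: field_simps)
qed

text \<open>The denominators are at most 2 in modulus, so raising the exponent costs only a power of
  2. A bound for the highest order therefore bounds all lower ones.\<close>

lemma blaschke_sum_exponent_le:
  assumes "\<And>i. i < n \<Longrightarrow> cmod (a i) \<le> 1" "cmod z < 1" "p \<le> q"
  shows "blaschke_sum a n p z \<le> 2 ^ (q - p) * blaschke_sum a n q z"
  unfolding blaschke_sum_def sum_distrib_left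
proof (rule sum_mono)
  fix i assume "i \<in> {..<n}"
  then have ai: "cmod (a i) \<le> 1" using assms by auto
  have "(1 - (cmod (a i))\<^sup>2) * (1 / cmod (1 - cnj (a i) * z) ^ p)
      \<le> (1 - (cmod (a i))\<^sup>2) * (2 ^ (q - p) / cmod (1 - cnj (a i) * z) ^ q)"
    using ai assms norm_one_minus_cnj_mult_pos[OF ai assms(2)] norm_one_minus_cnj_mult_le[OF ai, of z]
    by (intro mult_left_mono inverse_power_le_two_power) (auto simp: power_le_one)
  then show "(1 - (cmod (a i))\<^sup>2) / cmod (1 - cnj (a i) * z) ^ p
      \<le> 2 ^ (q - p) * ((1 - (cmod (a i))\<^sup>2) / cmod (1 - cnj (a i) * z) ^ q)"
    by (simp add: mult.commute)
qed

lemma blaschke_sum_mono: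
  assumes "\<And>i. i < n \<Longrightarrow> cmod (a i) \<le> 1" "k \<le> n"
  shows "blaschke_sum a k p z \<le> blaschke_sum a n p z"
  unfolding blaschke_sum_def
  using assms by (intro sum_mono2 divide_nonneg_nonneg) (auto simp: power_le_one)

text \<open>The constant is \<open>3/4 = 1 - (1/2)^2\<close>. The hypothesis is met when
  \<open>z\<close> is close to the circle and the term of \<open>a\<close> in the sum of order 2 is
  bounded.\<close>

lemma norm_blaschke_factor_ge_half:
  assumes "cmod a \<le> 1" "cmod z < 1"
    and "(1 - (cmod z)\<^sup>2) * ((1 - (cmod a)\<^sup>2) / (cmod (1 - cnj a * z))\<^sup>2) \<le> 3/4"
  shows "1/2 \<le> cmod (blaschke_factor a z)"
proof -
  have "1 - (cmod (blaschke_factor a z))\<^sup>2 \<le> 3/4"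
    using one_minus_norm_blaschke_factor[OF assms(1,2)] assms(3) by (simp add: mult.commute)
  then have "(1/2)\<^sup>2 \<le> (cmod (blaschke_factor a z))\<^sup>2"
    by (simp add: power2_eq_square)
  then show ?thesis
    using power2_le_imp_le norm_ge_zero by blast
qed

lemma higher_deriv_inverse_one_minus:
  fixes c z :: complex
  assumes "1 - c * z \<noteq> 0"
  shows "(deriv ^^ j) (\<lambda>z. 1 / (1 - c * z)) z = fact j * c ^ j / (1 - c * z) ^ Suc j"
  using higher_deriv_inverse_affine[of 1 "- c" z j] assms by simp

lemma higher_deriv_inverse_diff:
  fixes a z :: complex
  assumes "z \<noteq> a"
  shows "(deriv ^^ j) (\<lambda>z. 1 / (z - a)) z = fact j * (- 1) ^ j / (z - a) ^ Suc j"
  using higher_deriv_inverse_affine[of "- a" 1 z j] assms by (simp add: add.commute)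

lemma norm_higher_deriv_inverse_one_minus_le:
  assumes "cmod a \<le> 1" "cmod z < 1"
  shows "cmod ((deriv ^^ j) (\<lambda>z. 1 / (1 - cnj a * z)) z) \<le> fact j / cmod (1 - cnj a * z) ^ Suc j"
proof -
  have "cmod a ^ j \<le> 1"
    using assms by (simp add: power_le_one)
  then show ?thesis
    unfolding higher_deriv_inverse_one_minus[OF one_minus_cnj_mult_nonzero[OF assms]]
    by (simp add: norm_mult norm_divide norm_power del: power_Suc)
       (intro divide_right_mono mult_left_le, auto)
qed

section \<open>Logarithmic derivative and derivative bounds for partial products\<close>

lemma blaschke_factor_has_field_derivative:
  assumes "cmod a \<le> 1" "cmod z < 1" "z \<noteq> a"
  shows "(blaschke_factor a has_field_derivative
     blaschke_factor a z * (of_real (1 - (cmod a)\<^sup>2) * (1 / (1 - cnj a * z) * (1 / (z - a))))) (at z)"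
proof -
  have nz: "1 - cnj a * z \<noteq> 0" "z - a \<noteq> 0"
    using one_minus_cnj_mult_nonzero[OF assms(1,2)] assms by auto
  have sq: "of_real (1 - (cmod a)\<^sup>2) = 1 - a * cnj a"
    by (simp only: of_real_diff of_real_1 complex_norm_square)
  have "((\<lambda>z. (z - a) / (1 - cnj a * z)) has_field_derivative
     ((1 - cnj a * z) - (z - a) * (- cnj a)) / ((1 - cnj a * z) * (1 - cnj a * z))) (at z)"
    using nz by (auto intro!: derivative_eq_intros)
  moreover have "((1 - cnj a * z) - (z - a) * (- cnj a)) / ((1 - cnj a * z) * (1 - cnj a * z))
     = blaschke_factor a z * (of_real (1 - (cmod a)\<^sup>2) * (1 / (1 - cnj a * z) * (1 / (z - a))))"
  proof -
    have "(1 - cnj a * z) - (z - a) * (- cnj a) = 1 - a * cnj a"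
      by (simp add: algebra_simps)
    moreover have "c / (X * X) = Y / X * (c * (1 / X * (1 / Y)))" if "Y \<noteq> 0" for X Y c :: complex
      using that by simp
    ultimately show ?thesis
      unfolding sq blaschke_factor_def using nz(2) by presburger
  qed
  ultimately show ?thesis
    by (simp add: blaschke_factor_def[abs_def])
qed

text \<open>The two simple fractions of each factor are combined into one product, so that every
  term carries the weight \<open>1 - |a|^2\<close> of \<open>blaschke_sum\<close>.\<close>

definition blaschke_logderiv :: "(nat \<Rightarrow> complex) \<Rightarrow> nat \<Rightarrow> complex \<Rightarrow> complex" where
  "blaschke_logderiv a k z
    = (\<Sum>i<k. of_real (1 - (cmod (a i))\<^sup>2) * (1 / (1 - cnj (a i) * z) * (1 / (z - a i))))"

lemma blaschke_prod_has_field_derivative: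
  assumes "\<And>i. i < k \<Longrightarrow> cmod (a i) \<le> 1" "cmod z < 1" "\<And>i. i < k \<Longrightarrow> z \<noteq> a i"
  shows "(blaschke_prod a k has_field_derivative blaschke_prod a k z * blaschke_logderiv a k z) (at z)"
  using assms
proof (induction k)
  case 0
  then show ?case by (simp add: blaschke_prod_def[abs_def] blaschke_logderiv_def)
next
  case (Suc k)
  have IH: "(blaschke_prod a k has_field_derivative blaschke_prod a k z * blaschke_logderiv a k z) (at z)"
    using Suc by auto
  have eq: "blaschke_prod a (Suc k) = (\<lambda>z. blaschke_prod a k z * blaschke_factor (a k) z)"
    by (auto simp: blaschke_prod_def)
  have "cmod (a k) \<le> 1" "cmod z < 1" "z \<noteq> a k"
    using Suc.prems by auto
  from DERIV_mult[OF IH blaschke_factor_has_field_derivative[OF this]] show ?case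
    by (simp add: eq blaschke_logderiv_def algebra_simps)
qed

text \<open>Pseudohyperbolic distance at least 1/2 from each zero makes \<open>|z - a|\<close> at
  least half of \<open>|1 - cnj a * z|\<close>, so that the poles of the logarithmic derivative are
  measured by the same denominators as in \<open>blaschke_sum\<close>.\<close>

definition away_from_zeros :: "(nat \<Rightarrow> complex) \<Rightarrow> nat \<Rightarrow> complex \<Rightarrow> bool" where
  "away_from_zeros a n z \<longleftrightarrow> cmod z < 1 \<and>
     (\<forall>i<n. cmod (a i) \<le> 1 \<and> 1/2 \<le> cmod (blaschke_factor (a i) z))"

text \<open>In the Leibniz rule the binomial coefficient cancels against the two factorials, leaving
  \<open>fact j\<close> in each of the \<open>j + 1\<close> terms. The power of 2 pays for replacing
  \<open>|z - a|\<close> by half of \<open>|1 - cnj a * z|\<close>.\<close>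

lemma norm_higher_deriv_log_blaschke_factor_le:
  assumes "cmod a \<le> 1" "cmod z < 1" "1/2 \<le> cmod (blaschke_factor a z)"
  shows "cmod ((deriv ^^ j) (\<lambda>z. 1 / (1 - cnj a * z) * (1 / (z - a))) z)
     \<le> fact (Suc j) * 2 ^ Suc j / cmod (1 - cnj a * z) ^ (j + 2)"
proof -
  let ?X = "cmod (1 - cnj a * z)" and ?S = "ball 0 1 - {a}"
  have X: "0 < ?X"
    using norm_one_minus_cnj_mult_pos[OF assms(1,2)] .
  have za: "?X / 2 \<le> cmod (z - a)"
    using assms(3) X by (simp add: blaschke_factor_def norm_divide field_simps)
  then have ne: "z \<noteq> a" using X by auto
  have "(deriv ^^ j) (\<lambda>z. 1 / (1 - cnj a * z) * (1 / (z - a))) z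
     = (\<Sum>i = 0..j. of_nat (j choose i) * (deriv ^^ i) (\<lambda>z. 1 / (1 - cnj a * z)) z
          * (deriv ^^ (j - i)) (\<lambda>z. 1 / (z - a)) z)"
  proof (rule higher_deriv_mult)
    show "(\<lambda>z. 1 / (1 - cnj a * z)) holomorphic_on ?S"
      using inverse_one_minus_holomorphic[OF assms(1)] by (rule holomorphic_on_subset) auto
    show "(\<lambda>z. 1 / (z - a)) holomorphic_on ?S"
      by (intro holomorphic_intros) auto
  qed (use ne assms in auto)
  also have "cmod \<dots> \<le> (\<Sum>i = 0..j. fact j * 2 ^ Suc j / ?X ^ (j + 2))"
  proof (rule sum_norm_le)
    fix i assume "i \<in> {0..j}"
    then have ij: "i \<le> j" by simp
    have "1 / cmod (z - a) ^ Suc (j - i) \<le> 1 / (?X / 2) ^ Suc (j - i)"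
      using X za by (intro divide_left_mono power_mono mult_pos_pos zero_less_power) auto
    also have "\<dots> = 2 ^ Suc (j - i) / ?X ^ Suc (j - i)"
      by (simp add: power_divide del: power_Suc)
    also have "\<dots> \<le> 2 ^ Suc j / ?X ^ Suc (j - i)"
      using X by (intro divide_right_mono power_increasing) auto
    finally have 1: "cmod ((deriv ^^ (j - i)) (\<lambda>z. 1 / (z - a)) z)
        \<le> fact (j - i) * (2 ^ Suc j / ?X ^ Suc (j - i))"
      unfolding higher_deriv_inverse_diff[OF ne]
      by (simp add: norm_mult norm_divide norm_power del: power_Suc)
         (metis fact_ge_zero mult.right_neutral mult_left_mono times_divide_eq_right)
    have "cmod (of_nat (j choose i) * (deriv ^^ i) (\<lambda>z. 1 / (1 - cnj a * z)) z
          * (deriv ^^ (j - i)) (\<lambda>z. 1 / (z - a)) z)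
        \<le> real (j choose i) * (fact i / ?X ^ Suc i) * (fact (j - i) * (2 ^ Suc j / ?X ^ Suc (j - i)))"
      unfolding norm_mult norm_of_nat
      using X norm_higher_deriv_inverse_one_minus_le[OF assms(1,2), of i] 1
      by (intro mult_mono mult_left_mono mult_nonneg_nonneg divide_nonneg_nonneg) auto
    also have "\<dots> = (fact i * fact (j - i) * real (j choose i)) * 2 ^ Suc j / (?X ^ Suc i * ?X ^ Suc (j - i))"
      by (simp add: field_simps)
    also have "fact i * fact (j - i) * real (j choose i) = fact j"
      using binomial_fact_lemma[OF ij] by (metis of_nat_fact of_nat_mult)
    also have "?X ^ Suc i * ?X ^ Suc (j - i) = ?X ^ (j + 2)"
      using ij by (simp flip: power_add)
    finally show "cmod (of_nat (j choose i) * (deriv ^^ i) (\<lambda>z. 1 / (1 - cnj a * z)) z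
          * (deriv ^^ (j - i)) (\<lambda>z. 1 / (z - a)) z) \<le> fact j * 2 ^ Suc j / ?X ^ (j + 2)" .
  qed
  also have "\<dots> = fact (Suc j) * 2 ^ Suc j / ?X ^ (j + 2)"
    by (simp add: algebra_simps)
  finally show ?thesis .
qed

text \<open>The exponent is 2 for the logarithmic derivative itself and grows by one with each
  derivative. The sum on the right runs over all \<open>n\<close> zeros, which makes the bound
  uniform in \<open>k\<close>.\<close>

lemma norm_higher_deriv_blaschke_logderiv_le:
  assumes "away_from_zeros a n z" "k \<le> n"
  shows "cmod ((deriv ^^ j) (blaschke_logderiv a k) z)
    \<le> fact (Suc j) * 2 ^ Suc j * blaschke_sum a n (j + 2) z"
proof -
  have a: "cmod (a i) \<le> 1" "1/2 \<le> cmod (blaschke_factor (a i) z)" if "i < n" for i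
    using assms that by (auto simp: away_from_zeros_def)
  have z: "cmod z < 1" using assms by (simp add: away_from_zeros_def)
  let ?S = "ball 0 1 - a ` {..<k}"
  let ?g = "\<lambda>i z. 1 / (1 - cnj (a i) * z) * (1 / (z - a i))"
  have zS: "z \<in> ?S"
  proof -
    have "z \<noteq> a i" if "i < k" for i
      using a(2)[of i] that assms(2) by (auto simp: blaschke_factor_def)
    then show ?thesis using z by auto
  qed
  have op: "open ?S" by (intro open_Diff finite_imp_closed) auto
  have hol: "?g i holomorphic_on ?S" if "i < k" for i
  proof (intro holomorphic_on_mult)
    show "(\<lambda>z. 1 / (1 - cnj (a i) * z)) holomorphic_on ?S"
      using inverse_one_minus_holomorphic[OF a(1)] that assms(2) by (rule_tac holomorphic_on_subset) auto
    show "(\<lambda>z. 1 / (z - a i)) holomorphic_on ?S"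
      using that by (intro holomorphic_intros) auto
  qed
  have "(deriv ^^ j) (blaschke_logderiv a k) z
     = (\<Sum>i<k. (deriv ^^ j) (\<lambda>z. of_real (1 - (cmod (a i))\<^sup>2) * ?g i z) z)"
    unfolding blaschke_logderiv_def[abs_def]
    by (rule higher_deriv_sum[OF _ op zS]) (intro holomorphic_on_mult[OF holomorphic_on_const hol], simp)
  also have "\<dots> = (\<Sum>i<k. of_real (1 - (cmod (a i))\<^sup>2) * (deriv ^^ j) (?g i) z)"
    using hol op zS by (intro sum.cong refl higher_deriv_cmult) auto
  also have "cmod \<dots> \<le> (\<Sum>i<k. (1 - (cmod (a i))\<^sup>2) *
       (fact (Suc j) * 2 ^ Suc j / cmod (1 - cnj (a i) * z) ^ (j + 2)))"
  proof (rule sum_norm_le)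
    fix i assume "i \<in> {..<k}"
    then have i: "i < n" using assms by auto
    have "0 \<le> 1 - (cmod (a i))\<^sup>2" using a(1)[OF i] by (simp add: power_le_one)
    then show "cmod (of_real (1 - (cmod (a i))\<^sup>2) * (deriv ^^ j) (?g i) z) \<le> (1 - (cmod (a i))\<^sup>2) *
       (fact (Suc j) * 2 ^ Suc j / cmod (1 - cnj (a i) * z) ^ (j + 2))"
      unfolding norm_mult norm_of_real
      using norm_higher_deriv_log_blaschke_factor_le[OF a(1)[OF i] z a(2)[OF i]]
      by (simp only: abs_of_nonneg) (rule mult_left_mono)
  qed
  also have "\<dots> = fact (Suc j) * 2 ^ Suc j * blaschke_sum a k (j + 2) z"
    by (simp add: blaschke_sum_def sum_distrib_left mult_ac del: fact_Suc power_Suc)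
  also have "\<dots> \<le> fact (Suc j) * 2 ^ Suc j * blaschke_sum a n (j + 2) z"
    using a(1) assms(2) by (intro mult_left_mono blaschke_sum_mono) auto
  finally show ?thesis .
qed

text \<open>Leibniz rule for \<open>B' = B * L\<close> on the disk without the zeros. It expresses a
  derivative of \<open>B\<close> by strictly lower ones and thus drives the induction below.\<close>

lemma higher_deriv_blaschke_prod_Suc:
  assumes "away_from_zeros a n z" "k \<le> n"
  shows "(deriv ^^ Suc j) (blaschke_prod a k) z = (\<Sum>i = 0..j. of_nat (j choose i)
     * (deriv ^^ i) (blaschke_prod a k) z * (deriv ^^ (j - i)) (blaschke_logderiv a k) z)"
proof -
  have a: "cmod (a i) \<le> 1" "z \<noteq> a i" if "i < k" for i
    using assms that by (auto simp: away_from_zeros_def blaschke_factor_def dest!: spec[of _ i])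
  have z: "cmod z < 1" using assms by (simp add: away_from_zeros_def)
  let ?S = "ball 0 1 - a ` {..<k}"
  have zS: "z \<in> ?S" using z a(2) by auto
  have op: "open ?S" by (intro open_Diff finite_imp_closed) auto
  have B: "blaschke_prod a k holomorphic_on ?S"
    using blaschke_prod_holomorphic[OF a(1)] by (rule holomorphic_on_subset) auto
  have G: "blaschke_logderiv a k holomorphic_on ?S"
    unfolding blaschke_logderiv_def[abs_def]
  proof (intro holomorphic_on_sum holomorphic_on_mult)
    fix i assume i: "i \<in> {..<k}"
    show "(\<lambda>z. 1 / (1 - cnj (a i) * z)) holomorphic_on ?S"
      using inverse_one_minus_holomorphic[OF a(1)] i by (rule_tac holomorphic_on_subset) auto
    show "(\<lambda>z. 1 / (z - a i)) holomorphic_on ?S"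
      using i by (intro holomorphic_intros) auto
  qed auto
  have "(deriv ^^ Suc j) (blaschke_prod a k) z = (deriv ^^ j) (deriv (blaschke_prod a k)) z"
    by (simp only: funpow_Suc_right o_apply)
  also have "\<dots> = (deriv ^^ j) (\<lambda>z. blaschke_prod a k z * blaschke_logderiv a k z) z"
  proof (rule higher_deriv_transform_within_open[OF _ _ op zS])
    show "deriv (blaschke_prod a k) holomorphic_on ?S"
      using B op by (rule holomorphic_deriv)
    show "(\<lambda>z. blaschke_prod a k z * blaschke_logderiv a k z) holomorphic_on ?S"
      using B G by (rule holomorphic_on_mult)
    show "deriv (blaschke_prod a k) w = blaschke_prod a k w * blaschke_logderiv a k w" if "w \<in> ?S" for w
      using that a(1) by (intro DERIV_imp_deriv blaschke_prod_has_field_derivative) auto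
  qed
  also have "\<dots> = (\<Sum>i = 0..j. of_nat (j choose i) * (deriv ^^ i) (blaschke_prod a k) z
       * (deriv ^^ (j - i)) (blaschke_logderiv a k) z)"
    using B G op zS by (rule higher_deriv_mult)
  finally show ?thesis .
qed

text \<open>A general index set \<open>I\<close> is allowed because the leading term
  \<open>i = 0\<close> is sometimes removed.\<close>

lemma sum_binomial_le:
  fixes f :: "nat \<Rightarrow> complex"
  assumes "\<And>i. i \<in> I \<Longrightarrow> cmod (f i) \<le> real (m choose i) * A" "I \<subseteq> {..m}" "0 \<le> A"
  shows "cmod (\<Sum>i\<in>I. f i) \<le> 2 ^ m * A"
proof -
  have "cmod (\<Sum>i\<in>I. f i) \<le> (\<Sum>i\<in>I. real (m choose i) * A)"
    using assms(1) by (rule sum_norm_le)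
  also have "\<dots> \<le> (\<Sum>i\<le>m. real (m choose i) * A)"
    using assms by (intro sum_mono2) auto
  also have "\<dots> = real (\<Sum>i\<le>m. m choose i) * A"
    by (simp add: sum_distrib_right)
  also have "\<dots> = 2 ^ m * A"
    by (simp only: choose_row_sum of_nat_power of_nat_numeral)
  finally show ?thesis .
qed

text \<open>The derivative of order \<open>j + 1\<close> involves the logarithmic derivative up to
  order \<open>j\<close>, that is, sums of exponent up to \<open>j + 2\<close>; hence the relation
  between \<open>j\<close> and \<open>q\<close>. The constant is chosen before the zeros, their
  number and the point, so that it survives the passage to the limit.\<close>

lemma blaschke_prod_higher_deriv_bound:
  assumes "j + 1 \<le> q"
  shows "\<exists>C\<ge>0. \<forall>i\<le>j. \<forall>a n z k. away_from_zeros a n z \<longrightarrow> blaschke_sum a n q z \<le> M \<longrightarrow> k \<le> n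
     \<longrightarrow> cmod ((deriv ^^ i) (blaschke_prod a k) z) \<le> C"
  using assms
proof (induction j)
  case 0
  show ?case
    by (intro exI[of _ 1]) (auto simp: away_from_zeros_def intro!: norm_blaschke_prod_le_1)
next
  case (Suc j)
  then obtain C where C: "0 \<le> C" and bd: "\<And>i a n z k. i \<le> j \<Longrightarrow> away_from_zeros a n z
      \<Longrightarrow> blaschke_sum a n q z \<le> M \<Longrightarrow> k \<le> n \<Longrightarrow> cmod ((deriv ^^ i) (blaschke_prod a k) z) \<le> C"
    by auto
  define A where "A = C * (fact (Suc j) * 2 ^ Suc j * (2 ^ q * \<bar>M\<bar>))"
  have A: "0 \<le> A" unfolding A_def using C by (intro mult_nonneg_nonneg) auto
  have "cmod ((deriv ^^ Suc j) (blaschke_prod a k) z) \<le> 2 ^ j * A"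
    if aw: "away_from_zeros a n z" and M: "blaschke_sum a n q z \<le> M" and k: "k \<le> n" for a n z k
    unfolding higher_deriv_blaschke_prod_Suc[OF aw k]
  proof (rule sum_binomial_le[OF _ _ A])
    fix i assume "i \<in> {0..j}"
    then have ij: "i \<le> j" by simp
    have a: "\<And>i. i < n \<Longrightarrow> cmod (a i) \<le> 1" and z: "cmod z < 1"
      using aw by (auto simp: away_from_zeros_def)
    have "blaschke_sum a n (j - i + 2) z \<le> 2 ^ (q - (j - i + 2)) * blaschke_sum a n q z"
      using a z Suc.prems ij by (intro blaschke_sum_exponent_le) auto
    also have "\<dots> \<le> 2 ^ q * \<bar>M\<bar>"
      using M blaschke_sum_nonneg[of n a, OF a] by (intro mult_mono power_increasing) auto
    finally have s: "blaschke_sum a n (j - i + 2) z \<le> 2 ^ q * \<bar>M\<bar>" .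
    have "cmod ((deriv ^^ (j - i)) (blaschke_logderiv a k) z)
       \<le> fact (Suc (j - i)) * 2 ^ Suc (j - i) * blaschke_sum a n (j - i + 2) z"
      by (rule norm_higher_deriv_blaschke_logderiv_le[OF aw k])
    also have "\<dots> \<le> fact (Suc j) * 2 ^ Suc j * (2 ^ q * \<bar>M\<bar>)"
      using s ij blaschke_sum_nonneg[of n a, OF a]
      by (intro mult_mono mult_nonneg_nonneg fact_mono power_increasing) auto
    finally show "cmod (of_nat (j choose i) * (deriv ^^ i) (blaschke_prod a k) z
       * (deriv ^^ (j - i)) (blaschke_logderiv a k) z) \<le> real (j choose i) * A"
      unfolding norm_mult norm_of_nat A_def mult.assoc[of "real (j choose i)"]
      using bd[OF ij aw M k] C by (intro mult_left_mono mult_mono) auto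
  qed auto
  then show ?case
    using bd C by (intro exI[of _ "max C (2 ^ j * A)"]) (auto simp: le_Suc_eq le_max_iff_disj simp del: funpow.simps)
qed

section \<open>Comparison of the energies with the sums over the zeros\<close>

definition blaschke_energy :: "(nat \<Rightarrow> complex) \<Rightarrow> nat \<Rightarrow> nat \<Rightarrow> complex \<Rightarrow> real" where
  "blaschke_energy a n m z
    = (\<Sum>k<n. (1 - (cmod (a k))\<^sup>2) * (cmod ((deriv ^^ m) (blaschke_basis a k) z))\<^sup>2)"

lemma higher_deriv_blaschke_basis:
  assumes "\<And>i. i \<le> k \<Longrightarrow> cmod (a i) \<le> 1" "cmod z < 1"
  shows "(deriv ^^ m) (blaschke_basis a k) z = (\<Sum>i = 0..m. of_nat (m choose i)
     * (deriv ^^ i) (blaschke_prod a k) z * (deriv ^^ (m - i)) (\<lambda>z. 1 / (1 - cnj (a k) * z)) z)"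
  unfolding blaschke_basis_def[abs_def]
  using assms
  by (intro higher_deriv_mult[where S = "ball 0 1"] blaschke_prod_holomorphic inverse_one_minus_holomorphic) auto

text \<open>All terms of a Leibniz expansion are raised to one exponent \<open>q\<close>: it is
  \<open>Suc m\<close> for the full expansion and \<open>m\<close> once the leading term has been
  removed.\<close>

lemma norm_binomial_term_le:
  fixes D E :: complex
  assumes "cmod D \<le> C" "cmod E \<le> fact (m - i) / X ^ Suc (m - i)" "0 < X" "X \<le> 2"
    "Suc (m - i) \<le> q" "q \<le> Suc m" "i \<le> m"
  shows "cmod (of_nat (m choose i) * D * E) \<le> real (m choose i) * (C * (fact m * 2 ^ Suc m / X ^ q))"
proof -
  have "1 / X ^ Suc (m - i) \<le> 2 ^ (q - Suc (m - i)) / X ^ q"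
    using assms by (intro inverse_power_le_two_power) auto
  also have "\<dots> \<le> 2 ^ Suc m / X ^ q"
    using assms by (intro divide_right_mono power_increasing) auto
  finally have "fact (m - i) * (1 / X ^ Suc (m - i)) \<le> fact m * (2 ^ Suc m / X ^ q)"
    using assms by (intro mult_mono fact_mono) auto
  then have E: "cmod E \<le> fact m * 2 ^ Suc m / X ^ q"
    using assms(2) by simp
  show ?thesis
    unfolding norm_mult norm_of_nat mult.assoc
    using assms(1) E norm_ge_zero[of D] by (intro mult_left_mono mult_mono) (linarith | simp)+
qed

lemma norm_higher_deriv_blaschke_basis_le:
  assumes aw: "away_from_zeros a n z" and k: "k < n"
    and bd: "\<And>i. i \<le> m \<Longrightarrow> cmod ((deriv ^^ i) (blaschke_prod a k) z) \<le> C"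
  shows "cmod ((deriv ^^ m) (blaschke_basis a k) z)
    \<le> 2 ^ m * (C * (fact m * 2 ^ Suc m / cmod (1 - cnj (a k) * z) ^ Suc m))"
proof -
  have a: "cmod (a i) \<le> 1" if "i \<le> k" for i
    using aw k that by (auto simp: away_from_zeros_def)
  have z: "cmod z < 1" using aw by (simp add: away_from_zeros_def)
  have C: "0 \<le> C" using bd[of 0] norm_ge_zero order_trans by blast
  have eq: "(deriv ^^ m) (blaschke_basis a k) z = (\<Sum>i = 0..m. of_nat (m choose i)
     * (deriv ^^ i) (blaschke_prod a k) z * (deriv ^^ (m - i)) (\<lambda>z. 1 / (1 - cnj (a k) * z)) z)"
    using a z by (rule higher_deriv_blaschke_basis)
  show ?thesis
    unfolding eq
  proof (rule sum_binomial_le)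
    fix i assume "i \<in> {0..m}"
    then show "cmod (of_nat (m choose i) * (deriv ^^ i) (blaschke_prod a k) z
        * (deriv ^^ (m - i)) (\<lambda>z. 1 / (1 - cnj (a k) * z)) z)
      \<le> real (m choose i) * (C * (fact m * 2 ^ Suc m / cmod (1 - cnj (a k) * z) ^ Suc m))"
      using norm_one_minus_cnj_mult_pos[OF a[of k] z] norm_one_minus_cnj_mult_le[OF a[of k], of z] z
      by (intro norm_binomial_term_le bd norm_higher_deriv_inverse_one_minus_le a) auto
  qed (use C in auto)
qed

text \<open>Once the leading term is gone at least one derivative falls on the partial product,
  hence at most \<open>m - 1\<close> on the Cauchy kernel, and the exponent drops from
  \<open>m + 1\<close> to \<open>m\<close>.\<close>

lemma norm_higher_deriv_blaschke_basis_diff_le: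
  assumes aw: "away_from_zeros a n z" and k: "k < n" and m: "0 < m"
    and bd: "\<And>i. i \<le> m \<Longrightarrow> cmod ((deriv ^^ i) (blaschke_prod a k) z) \<le> C"
  shows "cmod ((deriv ^^ m) (blaschke_basis a k) z
      - blaschke_prod a k z * (fact m * cnj (a k) ^ m / (1 - cnj (a k) * z) ^ Suc m))
    \<le> 2 ^ m * (C * (fact m * 2 ^ Suc m / cmod (1 - cnj (a k) * z) ^ m))"
proof -
  have a: "cmod (a i) \<le> 1" if "i \<le> k" for i
    using aw k that by (auto simp: away_from_zeros_def)
  have z: "cmod z < 1" using aw by (simp add: away_from_zeros_def)
  have C: "0 \<le> C" using bd[of 0] norm_ge_zero order_trans by blast
  have nz: "1 - cnj (a k) * z \<noteq> 0"
    using one_minus_cnj_mult_nonzero[OF a z] by simp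
  have eq: "(deriv ^^ m) (blaschke_basis a k) z
      - blaschke_prod a k z * (fact m * cnj (a k) ^ m / (1 - cnj (a k) * z) ^ Suc m)
    = (\<Sum>i = Suc 0..m. of_nat (m choose i) * (deriv ^^ i) (blaschke_prod a k) z
        * (deriv ^^ (m - i)) (\<lambda>z. 1 / (1 - cnj (a k) * z)) z)"
    using higher_deriv_blaschke_basis[of k a z m, OF a z]
    by (simp add: sum.atLeast_Suc_atMost[of 0 m] higher_deriv_inverse_one_minus[OF nz] del: power_Suc)
  show ?thesis
    unfolding eq
  proof (rule sum_binomial_le)
    fix i assume "i \<in> {Suc 0..m}"
    then show "cmod (of_nat (m choose i) * (deriv ^^ i) (blaschke_prod a k) z
        * (deriv ^^ (m - i)) (\<lambda>z. 1 / (1 - cnj (a k) * z)) z)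
      \<le> real (m choose i) * (C * (fact m * 2 ^ Suc m / cmod (1 - cnj (a k) * z) ^ m))"
      using norm_one_minus_cnj_mult_pos[OF a[of k] z] norm_one_minus_cnj_mult_le[OF a[of k], of z] z
      by (intro norm_binomial_term_le bd norm_higher_deriv_inverse_one_minus_le a) auto
  qed (use C in auto)
qed

text \<open>Squaring the pointwise bound of exponent \<open>m + 1\<close> produces the exponent
  \<open>2*m+2\<close>, which is more than enough to control the derivatives of order at most
  \<open>m\<close> of the partial products.\<close>

lemma blaschke_energy_bound:
  "\<exists>C. \<forall>a n z. away_from_zeros a n z \<longrightarrow> blaschke_sum a n (2*m+2) z \<le> M
     \<longrightarrow> blaschke_energy a n m z \<le> C"
proof -
  obtain C where "\<forall>i\<le>m. \<forall>a n z k. away_from_zeros a n z \<longrightarrow> blaschke_sum a n (2*m+2) z \<le> M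
      \<longrightarrow> k \<le> n \<longrightarrow> cmod ((deriv ^^ i) (blaschke_prod a k) z) \<le> C"
    using blaschke_prod_higher_deriv_bound[of m "2*m+2" M] by fastforce
  note bd = this[rule_format]
  define A where "A = 2 ^ m * (C * (fact m * 2 ^ Suc m))"
  have "blaschke_energy a n m z \<le> A\<^sup>2 * M"
    if aw: "away_from_zeros a n z" and M: "blaschke_sum a n (2*m+2) z \<le> M" for a n z
  proof -
    have "blaschke_energy a n m z
        \<le> (\<Sum>k<n. (1 - (cmod (a k))\<^sup>2) * (A / cmod (1 - cnj (a k) * z) ^ Suc m)\<^sup>2)"
      unfolding blaschke_energy_def
    proof (intro sum_mono mult_left_mono power_mono norm_ge_zero)
      fix k assume k: "k \<in> {..<n}"
      then show "cmod ((deriv ^^ m) (blaschke_basis a k) z) \<le> A / cmod (1 - cnj (a k) * z) ^ Suc m"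
        using norm_higher_deriv_blaschke_basis_le[OF aw, of k m C] bd[OF _ aw M, of _ k]
        by (simp add: A_def)
      show "0 \<le> 1 - (cmod (a k))\<^sup>2"
        using aw k by (auto simp: away_from_zeros_def power_le_one)
    qed
    also have "\<dots> = A\<^sup>2 * blaschke_sum a n (2*m+2) z"
      unfolding blaschke_sum_def sum_distrib_left
      by (intro sum.cong refl) (simp add: power_divide power_mult[symmetric] mult.commute del: power_Suc)
    also have "\<dots> \<le> A\<^sup>2 * M"
      using M by (intro mult_left_mono) auto
    finally show ?thesis .
  qed
  then show ?thesis by blast
qed

lemma away_from_zerosI:
  assumes "\<And>i. i < n \<Longrightarrow> cmod (a i) \<le> 1" "cmod z < 1" "1/2 \<le> cmod (blaschke_prod a n z)"
  shows "away_from_zeros a n z"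
  unfolding away_from_zeros_def
  using assms norm_blaschke_prod_le_factor[of n a z] by fastforce

text \<open>To be read with \<open>x = |a|\<close> and \<open>t = |1 - cnj a * z|\<close>. The
  leading term of the energy carries the factor \<open>|a|^m\<close>, which is useless for zeros
  near 0. For \<open>|a| >= 1/2\<close> it costs only \<open>4^m\<close>; otherwise
  \<open>t >= 1/2\<close>, and the exponent can be lowered by 2 at the price of a factor 4.\<close>

lemma power_split_le:
  fixes x t s :: real
  assumes t: "0 < t" "1 - x \<le> t" and x: "0 \<le> x" "x \<le> 1" and s: "0 \<le> s" and m: "0 < m"
  shows "s / t ^ (2*m+2) \<le> 4 ^ m * (s * x ^ (2*m) / t ^ (2*m+2)) + 4 * (s / t ^ (2*m))"
proof (cases "1/2 \<le> x")
  case True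
  have "1 \<le> (2 * x) ^ (2*m)" using True by (intro one_le_power) auto
  also have "\<dots> = 4 ^ m * x ^ (2*m)" by (simp add: power_mult power_mult_distrib)
  finally have "1 * (s / t ^ (2*m+2)) \<le> (4 ^ m * x ^ (2*m)) * (s / t ^ (2*m+2))"
    using t s by (intro mult_right_mono) auto
  moreover have "0 \<le> 4 * (s / t ^ (2*m))"
    using t s by auto
  ultimately show ?thesis
    by (simp add: mult_ac)
next
  case False
  then have th: "1/2 \<le> t" using t by linarith
  have "1 / t\<^sup>2 \<le> 1 / (1/2)\<^sup>2"
    using th by (intro divide_left_mono power_mono) auto
  then have "1 / t\<^sup>2 \<le> 4"
    by (simp add: power_divide)
  then have "(s / t ^ (2*m)) * (1 / t\<^sup>2) \<le> (s / t ^ (2*m)) * 4"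
    using t s by (intro mult_left_mono) auto
  moreover have "s / t ^ (2*m+2) = (s / t ^ (2*m)) * (1 / t\<^sup>2)"
    by (simp add: power_add power2_eq_square)
  moreover have "0 \<le> 4 ^ m * (s * x ^ (2*m) / t ^ (2*m+2))"
    using t s x by simp
  moreover have "u \<le> r + 4 * p" if "p * q \<le> p * 4" "u = p * q" "0 \<le> r" for u p q r :: real
    using that by simp
  ultimately show ?thesis
    by blast
qed

text \<open>The leading term of \<open>e_k^(m)\<close> has size \<open>|1 - cnj (a k) z|^-(m+1)\<close>; the remaining ones are
  controlled by the sum of order \<open>2 * m\<close>, hence by induction.\<close>
lemma blaschke_sum_bound:
  "\<exists>C. \<forall>a n z. (\<forall>i<n. cmod (a i) \<le> 1) \<longrightarrow> cmod z < 1 \<longrightarrow> 1/2 \<le> cmod (blaschke_prod a n z)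
     \<longrightarrow> (\<forall>j\<le>m. blaschke_energy a n j z \<le> M) \<longrightarrow> blaschke_sum a n (2*m+2) z \<le> C"
proof (induction m)
  case 0
  have "blaschke_sum a n 2 z \<le> 4 * M"
    if a: "\<forall>i<n. cmod (a i) \<le> 1" and z: "cmod z < 1" and B: "1/2 \<le> cmod (blaschke_prod a n z)"
      and K: "blaschke_energy a n 0 z \<le> M" for a n z
  proof -
    have "blaschke_sum a n 2 z \<le> 4 * blaschke_energy a n 0 z"
      unfolding blaschke_sum_def blaschke_energy_def sum_distrib_left
    proof (rule sum_mono)
      fix k assume k: "k \<in> {..<n}"
      have "1/2 \<le> cmod (blaschke_prod a k z)"
        \<comment> \<open>The moduli of the partial products decrease, so the lower bound for the
          full product is inherited by each of them; squaring 1/2 gives the factor 4.\<close>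
        using B norm_blaschke_prod_antimono[of n a z k] a z k by fastforce
      then have "(1/2)\<^sup>2 \<le> (cmod (blaschke_prod a k z))\<^sup>2" by (intro power_mono) auto
      then have "1 \<le> 4 * (cmod (blaschke_prod a k z))\<^sup>2" by (simp add: power2_eq_square)
      then have "((1 - (cmod (a k))\<^sup>2) / (cmod (1 - cnj (a k) * z))\<^sup>2) * 1
        \<le> ((1 - (cmod (a k))\<^sup>2) / (cmod (1 - cnj (a k) * z))\<^sup>2) * (4 * (cmod (blaschke_prod a k z))\<^sup>2)"
        using a k by (intro mult_left_mono) (auto simp: power_le_one)
      then show "(1 - (cmod (a k))\<^sup>2) / (cmod (1 - cnj (a k) * z))\<^sup>2
        \<le> 4 * ((1 - (cmod (a k))\<^sup>2) * (cmod ((deriv ^^ 0) (blaschke_basis a k) z))\<^sup>2)"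
        by (simp add: blaschke_basis_def norm_mult norm_divide power_mult_distrib power_divide mult_ac)
    qed
    then show ?thesis using K by linarith
  qed
  then show ?case
    by (intro exI[of _ "4 * M"]) (simp add: numeral_2_eq_2)
next
  case (Suc m)
  then obtain S where S: "\<And>a n z. \<forall>i<n. cmod (a i) \<le> 1 \<Longrightarrow> cmod z < 1
      \<Longrightarrow> 1/2 \<le> cmod (blaschke_prod a n z) \<Longrightarrow> \<forall>j\<le>m. blaschke_energy a n j z \<le> M
      \<Longrightarrow> blaschke_sum a n (2*m+2) z \<le> S"
    by blast
  let ?m = "Suc m"
  \<comment> \<open>Derivatives up to order \<open>m + 1\<close> are needed now, and
    \<open>m + 2 <= 2*m+2\<close>: the sum bounded at the previous stage of the induction controls
    them.\<close>
  obtain C where "\<forall>i\<le>?m. \<forall>a n z k. away_from_zeros a n z \<longrightarrow> blaschke_sum a n (2*m+2) z \<le> S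
      \<longrightarrow> k \<le> n \<longrightarrow> cmod ((deriv ^^ i) (blaschke_prod a k) z) \<le> C"
    using blaschke_prod_higher_deriv_bound[of ?m "2*m+2" S] by fastforce
  note bd = this[rule_format]
  define A where "A = 2 ^ ?m * (C * (fact ?m * 2 ^ Suc ?m))"
  \<comment> \<open>The inner 2 is the inverse of the lower bound 1/2 for the partial
    product.\<close>
  have sq_le: "(2 * (x + y))\<^sup>2 \<le> 8 * (x\<^sup>2 + y\<^sup>2)" for x y :: real
    using sum_squares_bound[of x y] by (simp add: power2_eq_square algebra_simps)
  have "blaschke_sum a n (2*?m+2) z \<le> 4 ^ ?m * (8 * (M + A\<^sup>2 * S)) + 4 * S"
    if a: "\<forall>i<n. cmod (a i) \<le> 1" and z: "cmod z < 1" and B: "1/2 \<le> cmod (blaschke_prod a n z)"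
      and K: "\<forall>j\<le>?m. blaschke_energy a n j z \<le> M" for a n z
  proof -
    have aw: "away_from_zeros a n z"
      using a z B by (intro away_from_zerosI) auto
    have S': "blaschke_sum a n (2*m+2) z \<le> S"
      using S a z B K by auto
    have term_le: "(1 - (cmod (a k))\<^sup>2) / cmod (1 - cnj (a k) * z) ^ (2*?m+2)
       \<le> 4 ^ ?m * (8 * ((1 - (cmod (a k))\<^sup>2) * (cmod ((deriv ^^ ?m) (blaschke_basis a k) z))\<^sup>2
            + A\<^sup>2 * ((1 - (cmod (a k))\<^sup>2) / cmod (1 - cnj (a k) * z) ^ (2*m+2))))
         + 4 * ((1 - (cmod (a k))\<^sup>2) / cmod (1 - cnj (a k) * z) ^ (2*m+2))"
      if k: "k < n" for k
    proof -
      let ?X = "cmod (1 - cnj (a k) * z)" and ?s = "1 - (cmod (a k))\<^sup>2"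
        and ?e = "cmod ((deriv ^^ ?m) (blaschke_basis a k) z)"
      have X: "0 < ?X" using norm_one_minus_cnj_mult_pos a z k by auto
      have s: "0 \<le> ?s" using a k by (auto simp: power_le_one)
      have "1/2 \<le> cmod (blaschke_prod a k z)"
        using B norm_blaschke_prod_antimono[of n a z k] a z k by fastforce
      \<comment> \<open>The leading term is bounded below, with \<open>fact ?m\<close> simply
        replaced by 1, and then above by the full derivative plus the remainder of lower
        exponent.\<close>
      then have "1/2 * (1 * cmod (a k) ^ ?m / ?X ^ Suc ?m)
         \<le> cmod (blaschke_prod a k z) * (fact ?m * cmod (a k) ^ ?m / ?X ^ Suc ?m)"
        by (intro mult_mono divide_right_mono mult_right_mono fact_ge_1) auto
      also have "\<dots> = cmod (blaschke_prod a k z * (fact ?m * cnj (a k) ^ ?m / (1 - cnj (a k) * z) ^ Suc ?m))"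
        by (simp add: norm_mult norm_divide norm_power del: power_Suc fact_Suc)
      also have "\<dots> \<le> ?e + cmod ((deriv ^^ ?m) (blaschke_basis a k) z
          - blaschke_prod a k z * (fact ?m * cnj (a k) ^ ?m / (1 - cnj (a k) * z) ^ Suc ?m))"
        by (metis norm_minus_commute norm_triangle_sub)
      also have "\<dots> \<le> ?e + A / ?X ^ ?m"
        using norm_higher_deriv_blaschke_basis_diff_le[OF aw k, of ?m C] bd[OF _ aw S', of _ k] k
        by (simp add: A_def del: power_Suc fact_Suc funpow.simps)
      finally have "cmod (a k) ^ ?m / ?X ^ Suc ?m \<le> 2 * (?e + A / ?X ^ ?m)"
        by simp
      then have "(cmod (a k) ^ ?m / ?X ^ Suc ?m)\<^sup>2 \<le> (2 * (?e + A / ?X ^ ?m))\<^sup>2"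
        using X by (intro power_mono) (auto simp del: power_Suc)
      also have "\<dots> \<le> 8 * (?e\<^sup>2 + (A / ?X ^ ?m)\<^sup>2)"
        by (rule sq_le)
      finally have "cmod (a k) ^ (2*?m) / ?X ^ (2*?m+2) \<le> 8 * (?e\<^sup>2 + A\<^sup>2 / ?X ^ (2*m+2))"
        by (simp add: power_divide power_mult[symmetric] mult.commute del: power_Suc funpow.simps)
      then have "?s * (cmod (a k) ^ (2*?m) / ?X ^ (2*?m+2)) \<le> ?s * (8 * (?e\<^sup>2 + A\<^sup>2 / ?X ^ (2*m+2)))"
        using s by (rule mult_left_mono)
      then have 1: "4 ^ ?m * (?s * cmod (a k) ^ (2*?m) / ?X ^ (2*?m+2))
          \<le> 4 ^ ?m * (8 * (?s * ?e\<^sup>2 + A\<^sup>2 * (?s / ?X ^ (2*m+2))))"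
        by (intro mult_left_mono) (simp_all add: algebra_simps del: power_Suc funpow.simps)
      have "1 - cmod (a k) \<le> ?X"
        using norm_one_minus_cnj_mult_ge[of "cnj z" "cnj (a k)"] z by (simp add: mult.commute)
      then have "?s / ?X ^ (2*?m+2)
         \<le> 4 ^ ?m * (?s * cmod (a k) ^ (2*?m) / ?X ^ (2*?m+2)) + 4 * (?s / ?X ^ (2*?m))"
        using X s a k by (intro power_split_le) auto
      then show ?thesis using 1 by simp
    qed
    have "blaschke_sum a n (2*?m+2) z \<le> (\<Sum>k<n. 4 ^ ?m * (8 * ((1 - (cmod (a k))\<^sup>2) * (cmod ((deriv ^^ ?m) (blaschke_basis a k) z))\<^sup>2
            + A\<^sup>2 * ((1 - (cmod (a k))\<^sup>2) / cmod (1 - cnj (a k) * z) ^ (2*m+2))))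
         + 4 * ((1 - (cmod (a k))\<^sup>2) / cmod (1 - cnj (a k) * z) ^ (2*m+2)))"
      unfolding blaschke_sum_def using term_le by (intro sum_mono) auto
    also have "\<dots> = 4 ^ ?m * (8 * (blaschke_energy a n ?m z + A\<^sup>2 * blaschke_sum a n (2*m+2) z))
         + 4 * blaschke_sum a n (2*m+2) z"
      unfolding blaschke_energy_def blaschke_sum_def
      by (simp only: sum.distrib sum_distrib_left distrib_left)
    also have "\<dots> \<le> 4 ^ ?m * (8 * (M + A\<^sup>2 * S)) + 4 * S"
      using S' K by (intro add_mono mult_left_mono) auto
    finally show ?thesis .
  qed
  then show ?case by blast
qed

section \<open>Approximation of bounded functions by finite Blaschke products\<close>

lemma sets_mT [simp]: "sets mT = sets borel"
  by (simp add: mT_def)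

lemma AE_mT_norm: "AE \<zeta> in mT. cmod \<zeta> = 1"
proof -
  have cis: "cis \<in> borel_measurable (density (restrict_space lborel {0..<2*pi}) (\<lambda>_. ennreal (1/(2*pi))))"
    by (simp add: measurable_restrict_space1 borel_measurable_continuous_onI continuous_on_cis)
  show ?thesis
    unfolding mT_def by (subst AE_distr_iff[OF cis]) auto
qed

text \<open>For continuous \<open>F\<close> rational radii suffice. The criterion has only countable
  quantifiers, which makes the set of boundary points with a radial limit Borel.\<close>

lemma tendsto_at_left_1_iff_rat:
  fixes F :: "real \<Rightarrow> real"
  assumes "continuous_on {0..<1} F"
  shows "(F \<longlongrightarrow> l) (at_left 1) \<longleftrightarrow>
    (\<forall>k::nat. \<exists>N::nat. \<forall>r::rat. 1 - 1 / real (Suc N) < of_rat r \<and> of_rat r < (1::real)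
       \<longrightarrow> \<bar>F (of_rat r) - l\<bar> \<le> 1 / real (Suc k))"
    (is "_ \<longleftrightarrow> ?R")
proof
  assume lim: "(F \<longlongrightarrow> l) (at_left 1)"
  show ?R
  proof
    fix k :: nat
    have "eventually (\<lambda>r. dist (F r) l < 1 / real (Suc k)) (at_left 1)"
      using lim by (rule tendstoD) simp
    then obtain c where c: "c < 1" "\<And>r. c < r \<Longrightarrow> r < 1 \<Longrightarrow> dist (F r) l < 1 / real (Suc k)"
      by (auto simp: eventually_at_left[of 0 1])
    obtain N where "inverse (real (Suc N)) < 1 - c"
      using reals_Archimedean[of "1 - c"] c by auto
    then have N: "c < 1 - 1 / real (Suc N)" by (simp add: inverse_eq_divide)
    have "\<bar>F (of_rat r) - l\<bar> \<le> 1 / real (Suc k)"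
      if "1 - 1 / real (Suc N) < of_rat r" "of_rat r < (1::real)" for r :: rat
      using c(2)[of "of_rat r"] that N by (simp add: dist_real_def)
    then show "\<exists>N::nat. \<forall>r::rat. 1 - 1 / real (Suc N) < of_rat r \<and> of_rat r < (1::real)
       \<longrightarrow> \<bar>F (of_rat r) - l\<bar> \<le> 1 / real (Suc k)"
      by blast
  qed
next
  assume R: ?R
  show "(F \<longlongrightarrow> l) (at_left 1)"
  proof (rule tendstoI)
    fix e :: real assume e: "0 < e"
    obtain k where k: "1 / real (Suc k) < e"
      using reals_Archimedean[OF e] by (auto simp: inverse_eq_divide)
    obtain N :: nat where N: "\<And>r::rat. 1 - 1 / real (Suc N) < of_rat r \<Longrightarrow> of_rat r < (1::real)
       \<Longrightarrow> \<bar>F (of_rat r) - l\<bar> \<le> 1 / real (Suc k)"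
      using R by blast
    have "dist (F r) l < e" if r: "1 - 1 / real (Suc N) < r" "r < 1" for r
    proof (rule ccontr)
      assume "\<not> dist (F r) l < e"
      then have gt: "1 / real (Suc k) < \<bar>F r - l\<bar>" using k by (simp add: dist_real_def)
      have "0 \<le> 1 - 1 / real (Suc N)" by simp
      then have "0 < r" using r by linarith
      then have "continuous (at r) F"
        using assms r by (intro continuous_on_interior[of "{0..<1}"]) auto
      then have "((\<lambda>x. \<bar>F x - l\<bar>) \<longlongrightarrow> \<bar>F r - l\<bar>) (at r)"
        unfolding continuous_at by (intro tendsto_intros)
      \<comment> \<open>By continuity the violated estimate persists to the right of
        \<open>r\<close>, where a rational radius contradicts the assumption.\<close>
      then have "eventually (\<lambda>x. 1 / real (Suc k) < \<bar>F x - l\<bar>) (at r)"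
        using gt by (rule order_tendstoD)
      then have "eventually (\<lambda>x. 1 / real (Suc k) < \<bar>F x - l\<bar>) (at_right r)"
        by (simp add: eventually_at_split)
      then obtain c where c: "r < c" "\<And>x. r < x \<Longrightarrow> x < c \<Longrightarrow> 1 / real (Suc k) < \<bar>F x - l\<bar>"
        by (auto simp: eventually_at_right[of r 1] r)
      obtain q where q: "r < of_rat q" "of_rat q < min c 1"
        using of_rat_dense[of r "min c 1"] c r by auto
      then show False
        using N[of q] c(2)[of "of_rat q"] r by auto
    qed
    moreover have "1 - 1 / real (Suc N) < 1" by simp
    ultimately show "eventually (\<lambda>r. dist (F r) l < e) (at_left 1)"
      using eventually_at_left by blast
  qed
qed

text \<open>The radial limit, where it exists, is the limit along one fixed sequence of radii, which
  depends measurably on the boundary point; the set where it exists is Borel by the rational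
  criterion.\<close>

lemma bdry_abs_measurable:
  assumes b: "b holomorphic_on ball 0 1"
  obtains g where "g \<in> borel_measurable borel" "\<And>\<zeta>. cmod \<zeta> = 1 \<Longrightarrow> g \<zeta> = bdry_abs b \<zeta>"
proof -
  define u where "u r \<zeta> = (if cmod \<zeta> = 1 then if 0 \<le> r \<and> r < 1 then cmod (b (of_real r * \<zeta>)) else 0 else 0)"
    for r :: real and \<zeta>
  have cb: "continuous_on (ball 0 1) b"
    using b by (rule holomorphic_on_imp_continuous_on)
  have u[measurable]: "u r \<in> borel_measurable borel" for r
  proof (cases "0 \<le> r \<and> r < 1")
    case True
    have "{\<zeta> \<in> space borel. cmod \<zeta> = 1} \<in> sets borel" by measurable
    moreover have "(\<lambda>\<zeta>. cmod (b (of_real r * \<zeta>))) \<in> borel_measurable (restrict_space borel {\<zeta>. cmod \<zeta> = 1})"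
      using True
      by (intro borel_measurable_continuous_on_restrict continuous_on_norm
            continuous_on_compose2[OF cb] continuous_intros) (auto simp: norm_mult)
    ultimately show ?thesis
      using True unfolding u_def by (subst measurable_If_restrict_space_iff) auto
  next
    case False
    then have "u r = (\<lambda>_. 0)" by (auto simp: u_def)
    then show ?thesis by simp
  qed
  define x :: "nat \<Rightarrow> real" where "x n = 1 - 1 / real (Suc n)" for n
  define l where "l \<zeta> = lim (\<lambda>n. u (x n) \<zeta>)" for \<zeta>
  have l[measurable]: "l \<in> borel_measurable borel"
    unfolding l_def by measurable
  define E where "E = {\<zeta>. \<forall>k::nat. \<exists>N::nat. \<forall>r::rat. 1 - 1 / real (Suc N) < of_rat r \<and> of_rat r < (1::real)
       \<longrightarrow> \<bar>u (of_rat r) \<zeta> - l \<zeta>\<bar> \<le> 1 / real (Suc k)}"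
  have [measurable]: "E \<in> sets borel"
    unfolding E_def by measurable
  \<comment> \<open>Where there is no radial limit \<open>Lim\<close> is a description without a
    witness, hence this one fixed real number.\<close>
  define c :: real where "c = (THE L. False)"
  define g where "g \<zeta> = (if \<zeta> \<in> E then l \<zeta> else c)" for \<zeta>
  have "g \<in> borel_measurable borel"
    unfolding g_def by measurable
  moreover have "g \<zeta> = bdry_abs b \<zeta>" if z: "cmod \<zeta> = 1" for \<zeta>
  proof -
    let ?F = "\<lambda>r::real. cmod (b (of_real r * \<zeta>))"
    have uF: "u r \<zeta> = ?F r" if "0 \<le> r" "r < 1" for r
      using that z by (simp add: u_def)
    have cF: "continuous_on {0..<1} ?F"
      using z by (intro continuous_on_norm continuous_on_compose2[OF cb] continuous_intros) (auto simp: norm_mult)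
    have nn: "0 \<le> r" if "1 - 1 / real (Suc N) < r" for r N
    proof -
      have "0 \<le> 1 - 1 / real (Suc N)" by simp
      then show ?thesis using that by linarith
    qed
    have E: "\<zeta> \<in> E \<longleftrightarrow> (?F \<longlongrightarrow> l \<zeta>) (at_left 1)"
      unfolding tendsto_at_left_1_iff_rat[OF cF] E_def mem_Collect_eq
      using uF nn by (metis (no_types, lifting))
    have lim_l: "L = l \<zeta>" if L: "(?F \<longlongrightarrow> L) (at_left 1)" for L
    proof -
      have "filterlim x (at_left 1) sequentially"
        unfolding x_def by real_asymp
      then have "(\<lambda>n. ?F (x n)) \<longlonglongrightarrow> L"
        using filterlim_compose[OF L] by blast
      moreover have "?F (x n) = u (x n) \<zeta>" for n
        by (rule uF[symmetric]) (auto simp: x_def)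
      ultimately show ?thesis
        unfolding l_def by (simp add: limI)
    qed
    show ?thesis
    proof (cases "\<zeta> \<in> E")
      case True
      then have "(?F \<longlongrightarrow> l \<zeta>) (at_left 1)" using E by simp
      then have "Lim (at_left 1) ?F = l \<zeta>"
        by (intro tendsto_Lim) (auto simp: trivial_limit_at_left_real)
      then show ?thesis using True by (simp add: g_def bdry_abs_def)
    next
      case False
      then have "\<not> (?F \<longlongrightarrow> L) (at_left 1)" for L
        using lim_l E by blast
      then show ?thesis using False by (simp add: g_def bdry_abs_def t2_space_class.Lim_def c_def)
    qed
  qed
  ultimately show ?thesis using that by blast
qed

section \<open>Discretization of measures on the circle\<close>

lemma sum_list_concat_replicate:
  fixes F :: "'a \<Rightarrow> real"
  assumes "distinct vs"
  shows "(\<Sum>a\<leftarrow>concat (map (\<lambda>v. replicate (n v) (g v)) vs). F a) = (\<Sum>v\<in>set vs. real (n v) * F (g v))"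
  using assms by (induction vs) (auto simp: sum_list_replicate)

text \<open>Simple functions approximating the identity are pushed radially onto the circle. The
  image of a measure under \<open>u N\<close> is then a finite sum of point masses on the
  circle.\<close>

lemma simple_functions_to_circle:
  obtains u :: "nat \<Rightarrow> complex \<Rightarrow> complex"
  where "\<And>N. finite (range (u N))" "\<And>N. u N \<in> borel_measurable borel"
    "\<And>N \<zeta>. cmod (u N \<zeta>) = 1" "\<And>\<zeta>. cmod \<zeta> = 1 \<Longrightarrow> (\<lambda>N. u N \<zeta>) \<longlonglongrightarrow> \<zeta>"
proof -
  obtain F :: "nat \<Rightarrow> complex \<Rightarrow> complex" where F: "\<And>i. simple_function borel (F i)" "\<And>x. (\<lambda>i. F i x) \<longlonglongrightarrow> x"
    using borel_measurable_implies_sequence_metric[of "\<lambda>x. x" "borel :: complex measure" 0] by auto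
  define u where "u N \<zeta> = (if F N \<zeta> = 0 then 1 else sgn (F N \<zeta>))" for N \<zeta>
  have sf: "simple_function borel (u N)" for N
  proof -
    have "simple_function borel ((\<lambda>w. if w = 0 then 1 else sgn w) \<circ> F N)"
      using F(1) by (rule simple_function_compose)
    then show ?thesis by (simp add: u_def[abs_def] o_def)
  qed
  show ?thesis
  proof
    show "finite (range (u N))" for N
      using simple_functionD(1)[OF sf[of N]] by simp
    show "u N \<in> borel_measurable borel" for N
      using sf by (rule borel_measurable_simple_function)
    show "cmod (u N \<zeta>) = 1" for N \<zeta>
      by (simp add: u_def norm_sgn)
    fix \<zeta> :: complex assume z: "cmod \<zeta> = 1"
    have "(\<lambda>N. sgn (F N \<zeta>)) \<longlonglongrightarrow> sgn \<zeta>"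
      using F(2)[of \<zeta>] z by (intro tendsto_sgn) auto
    moreover have "sgn \<zeta> = \<zeta>" using z by (simp add: sgn_eq)
    moreover have "eventually (\<lambda>N. sgn (F N \<zeta>) = u N \<zeta>) sequentially"
    proof -
      have "\<zeta> \<noteq> 0" using z by auto
      then have "eventually (\<lambda>N. F N \<zeta> \<noteq> 0) sequentially"
        using F(2)[of \<zeta>] by (rule tendsto_imp_eventually_ne[rotated])
      then show ?thesis
        by eventually_elim (simp add: u_def)
    qed
    ultimately show "(\<lambda>N. u N \<zeta>) \<longlonglongrightarrow> \<zeta>"
      using Lim_transform_eventually by fastforce
  qed
qed

lemma tendsto_weighted_sum_integral:
  fixes H :: "nat \<Rightarrow> complex \<Rightarrow> real" and h :: "complex \<Rightarrow> real"
  assumes \<mu>: "finite_measure \<mu>" "sets \<mu> = sets borel" and AE1: "AE \<zeta> in \<mu>. cmod \<zeta> = 1"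
    and u: "\<And>N. finite (range (u N))" "\<And>N. u N \<in> borel_measurable borel"
      "\<And>N \<zeta>. cmod (u N \<zeta>) = 1"
    and h: "h \<in> borel_measurable borel"
    and lim: "\<And>\<zeta>. cmod \<zeta> = 1 \<Longrightarrow> (\<lambda>N. H N (u N \<zeta>)) \<longlonglongrightarrow> h \<zeta>"
    and bd: "\<And>N v. cmod v = 1 \<Longrightarrow> \<bar>H N v\<bar> \<le> C"
    and M: "\<And>N. real (Suc N) * real (Suc (card (range (u N)))) \<le> M N"
  shows "(\<lambda>N. \<Sum>v\<in>range (u N). real (nat \<lfloor>measure \<mu> (u N -` {v}) * M N\<rfloor>) / M N * H N v)
     \<longlonglongrightarrow> (\<integral>\<zeta>. h \<zeta> \<partial>\<mu>)"
proof -
  interpret finite_measure \<mu> by fact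
  have sp: "space \<mu> = UNIV" using sets_eq_imp_space_eq[OF \<mu>(2)] by simp
  have meas: "f \<in> borel_measurable \<mu> \<longleftrightarrow> f \<in> borel_measurable borel" for f :: "complex \<Rightarrow> real"
    by (simp add: measurable_cong_sets[OF \<mu>(2) refl])
  have vim: "u N -` {v} \<in> sets \<mu>" for N v
    using measurable_sets[OF u(2), of "{v}" N] \<mu>(2) by simp
  have C: "0 \<le> C" using bd[of 1 0] by (simp add: abs_le_iff)
  have decomp: "H N (u N \<zeta>) = (\<Sum>v\<in>range (u N). H N v * indicator (u N -` {v}) \<zeta>)" for N \<zeta>
  proof -
    have "(\<Sum>v\<in>range (u N). H N v * indicator (u N -` {v}) \<zeta>) = (\<Sum>v\<in>range (u N). if v = u N \<zeta> then H N v else 0)"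
      by (intro sum.cong) (auto simp: indicator_def)
    then show ?thesis using u(1)[of N] by simp
  qed
  have int: "(\<integral>\<zeta>. H N (u N \<zeta>) \<partial>\<mu>) = (\<Sum>v\<in>range (u N). measure \<mu> (u N -` {v}) * H N v)" for N
  proof -
    have "(\<integral>\<zeta>. H N (u N \<zeta>) \<partial>\<mu>) = (\<Sum>v\<in>range (u N). (\<integral>\<zeta>. H N v * indicator (u N -` {v}) \<zeta> \<partial>\<mu>))"
      unfolding decomp using vim
      by (intro Bochner_Integration.integral_sum integrable_mult_right integrable_real_indicator)
         (auto simp: emeasure_eq_measure)
    then show ?thesis
      using vim by (simp add: sp mult.commute)
  qed
  have meas_u: "(\<lambda>\<zeta>. H N (u N \<zeta>)) \<in> borel_measurable \<mu>" for N
    unfolding decomp using vim by (intro borel_measurable_sum borel_measurable_times) auto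
  have 1: "(\<lambda>N. \<integral>\<zeta>. H N (u N \<zeta>) \<partial>\<mu>) \<longlonglongrightarrow> (\<integral>\<zeta>. h \<zeta> \<partial>\<mu>)"
  proof (rule integral_dominated_convergence[where w = "\<lambda>_. C"])
    show "AE \<zeta> in \<mu>. (\<lambda>N. H N (u N \<zeta>)) \<longlonglongrightarrow> h \<zeta>"
      using AE1 by eventually_elim (rule lim)
    show "AE \<zeta> in \<mu>. norm (H N (u N \<zeta>)) \<le> C" for N
      using bd[OF u(3)] by simp
  qed (use meas_u h meas in auto)
  \<comment> \<open>Rounding changes each mass by at most \<open>1 / M N\<close>, hence the sum by
    at most the number of atoms times \<open>C / M N\<close>.\<close>
  have 2: "(\<lambda>N. (\<Sum>v\<in>range (u N). real (nat \<lfloor>measure \<mu> (u N -` {v}) * M N\<rfloor>) / M N * H N v)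
      - (\<integral>\<zeta>. H N (u N \<zeta>) \<partial>\<mu>)) \<longlonglongrightarrow> 0"
  proof (rule tendsto_rabs_zero_cancel, rule tendsto_sandwich[where f = "\<lambda>_. 0" and h = "\<lambda>N. C / real (Suc N)"])
    have "\<bar>(\<Sum>v\<in>range (u N). real (nat \<lfloor>measure \<mu> (u N -` {v}) * M N\<rfloor>) / M N * H N v)
      - (\<integral>\<zeta>. H N (u N \<zeta>) \<partial>\<mu>)\<bar> \<le> C / real (Suc N)" for N
    proof -
      have pos: "0 < M N"
        using M[of N] by (rule less_le_trans[rotated]) (simp add: add_pos_nonneg)
      have fl: "\<bar>real (nat \<lfloor>s * M N\<rfloor>) / M N - s\<bar> \<le> 1 / M N" if "0 \<le> s" for s
      proof -
        have "real (nat \<lfloor>s * M N\<rfloor>) = of_int \<lfloor>s * M N\<rfloor>"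
          using that pos by simp
        then have "\<bar>real (nat \<lfloor>s * M N\<rfloor>) - s * M N\<bar> \<le> 1"
          by linarith
        then have "\<bar>real (nat \<lfloor>s * M N\<rfloor>) - s * M N\<bar> / M N \<le> 1 / M N"
          using pos by (intro divide_right_mono) auto
        moreover have "\<bar>real (nat \<lfloor>s * M N\<rfloor>) - s * M N\<bar> / M N = \<bar>real (nat \<lfloor>s * M N\<rfloor>) / M N - s\<bar>"
          using pos by (simp add: diff_divide_distrib abs_div_pos)
        ultimately show ?thesis by simp
      qed
      have "(\<Sum>v\<in>range (u N). real (nat \<lfloor>measure \<mu> (u N -` {v}) * M N\<rfloor>) / M N * H N v) - (\<integral>\<zeta>. H N (u N \<zeta>) \<partial>\<mu>)
        = (\<Sum>v\<in>range (u N). (real (nat \<lfloor>measure \<mu> (u N -` {v}) * M N\<rfloor>) / M N - measure \<mu> (u N -` {v})) * H N v)"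
        unfolding int by (simp add: sum_subtractf left_diff_distrib)
      also have "\<bar>\<dots>\<bar> \<le> (\<Sum>v\<in>range (u N). 1 / M N * C)"
      proof (rule order_trans[OF sum_abs], rule sum_mono)
        fix v assume "v \<in> range (u N)"
        then have v: "cmod v = 1" using u(3) by auto
        show "\<bar>(real (nat \<lfloor>measure \<mu> (u N -` {v}) * M N\<rfloor>) / M N - measure \<mu> (u N -` {v})) * H N v\<bar> \<le> 1 / M N * C"
          unfolding abs_mult using bd[OF v] fl[of "measure \<mu> (u N -` {v})"] pos C
          by (intro mult_mono) auto
      qed
      also have "\<dots> = real (card (range (u N))) * C / M N" by simp
      also have "\<dots> \<le> C / real (Suc N)"
      proof -
        have "real (card (range (u N))) * real (Suc N) \<le> M N"
          using M[of N] by (simp add: algebra_simps)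
        then have "C * (real (card (range (u N))) * real (Suc N)) \<le> C * M N"
          using C by (rule mult_left_mono)
        then show ?thesis using pos by (simp add: field_simps)
      qed
      finally show ?thesis .
    qed
    then show "\<forall>\<^sub>F N in sequentially. \<bar>(\<Sum>v\<in>range (u N). real (nat \<lfloor>measure \<mu> (u N -` {v}) * M N\<rfloor>) / M N * H N v)
      - (\<integral>\<zeta>. H N (u N \<zeta>) \<partial>\<mu>)\<bar> \<le> C / real (Suc N)" by simp
    show "(\<lambda>N. C / real (Suc N)) \<longlonglongrightarrow> 0" by real_asymp
  qed auto
  show ?thesis
    using tendsto_add[OF 2 1] by simp
qed

lemma minus_ln_one_minus_le:
  fixes y :: real
  assumes "0 \<le> y" "y \<le> 1/2"
  shows "- ln (1 - y) \<le> 2 * y"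
proof -
  have "ln (1 / (1 - y)) \<le> 1 / (1 - y) - 1"
    using assms by (intro ln_le_minus_one) auto
  also have "\<dots> = y / (1 - y)" using assms by (simp add: field_simps)
  also have "\<dots> \<le> y / (1/2)" using assms by (intro divide_left_mono) auto
  finally show ?thesis using assms by (simp add: ln_div)
qed

text \<open>A point mass \<open>s\<close> at \<open>v \<in> \<T>\<close> is modelled by \<open>s * M\<close> zeros at \<open>(1 - 1/M) * v\<close>.\<close>
lemma finite_measure_blaschke_approx:
  assumes \<mu>: "finite_measure \<mu>" "sets \<mu> = sets borel" and AE1: "AE \<zeta> in \<mu>. cmod \<zeta> = 1"
  shows "\<exists>xs :: nat \<Rightarrow> complex list.
    (\<forall>N. \<forall>a\<in>set (xs N). 1 - 1 / real (Suc N) \<le> cmod a \<and> cmod a \<le> 1) \<and>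
    (\<forall>z p. cmod z < 1 \<longrightarrow> (\<lambda>N. \<Sum>a\<leftarrow>xs N. (1 - (cmod a)\<^sup>2) / cmod (1 - cnj a * z) ^ p)
        \<longlonglongrightarrow> (\<integral>\<zeta>. 2 / cmod (1 - cnj \<zeta> * z) ^ p \<partial>\<mu>)) \<and>
    (\<forall>z. cmod z < 1 \<longrightarrow> (\<lambda>N. \<Sum>a\<leftarrow>xs N. - ln (cmod (blaschke_factor a z)))
        \<longlonglongrightarrow> (\<integral>\<zeta>. poisson z \<zeta> \<partial>\<mu>))"
proof -
  obtain u :: "nat \<Rightarrow> complex \<Rightarrow> complex" where u: "\<And>N. finite (range (u N))" "\<And>N. u N \<in> borel_measurable borel"
    "\<And>N \<zeta>. cmod (u N \<zeta>) = 1" "\<And>\<zeta>. cmod \<zeta> = 1 \<Longrightarrow> (\<lambda>N. u N \<zeta>) \<longlonglongrightarrow> \<zeta>"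
    using simple_functions_to_circle by metis
  \<comment> \<open>The number of atoms absorbs the rounding errors; the factor \<open>Suc N\<close>
    makes what remains of them and \<open>e N = 1 / M N\<close> tend to 0.\<close>
  define M where "M N = real (Suc N) * real (Suc (card (range (u N))))" for N
  define e where "e N = 1 / M N" for N
  define t where "t N v = of_real (1 - e N) * v" for N and v :: complex
  define k where "k N v = nat \<lfloor>measure \<mu> (u N -` {v}) * M N\<rfloor>" for N v
  define xs where "xs N = concat (map (\<lambda>v. replicate (k N v) (t N v)) (SOME vs. distinct vs \<and> set vs = range (u N)))" for N
  have MN: "real (Suc N) \<le> M N" for N
  proof -
    have "real (Suc N) * 1 \<le> M N"
      unfolding M_def by (intro mult_left_mono) auto
    then show ?thesis by simp
  qed
  have M1: "1 \<le> M N" for N using MN[of N] by simp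
  have e: "0 < e N" "e N \<le> 1" "e N \<le> 1 / real (Suc N)" for N
  proof -
    show "0 < e N" "e N \<le> 1" using M1[of N] by (auto simp: e_def)
    show "e N \<le> 1 / real (Suc N)"
      unfolding e_def using MN[of N] by (intro divide_left_mono) auto
  qed
  have e_lim: "e \<longlonglongrightarrow> 0"
  proof (rule tendsto_sandwich[where f = "\<lambda>_. 0" and h = "\<lambda>N. 1 / real (Suc N)"])
    show "(\<lambda>N. 1 / real (Suc N)) \<longlonglongrightarrow> 0" by real_asymp
  qed (use e in \<open>simp_all add: order_less_imp_le\<close>)
  have nt: "cmod (t N v) = 1 - e N" if "cmod v = 1" for N v
    using that e[of N] by (simp add: t_def norm_mult del: of_real_diff)
  have nt1: "cmod (t N v) \<le> 1" if "cmod v = 1" for N v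
    using nt[OF that, of N] e[of N] by simp
  have vs: "distinct (SOME vs. distinct vs \<and> set vs = range (u N))"
    "set (SOME vs. distinct vs \<and> set vs = range (u N)) = range (u N)" for N
  proof -
    have "\<exists>vs. distinct vs \<and> set vs = range (u N)"
      using finite_distinct_list[OF u(1)[of N]] by blast
    from someI_ex[OF this] show "distinct (SOME vs. distinct vs \<and> set vs = range (u N))"
      "set (SOME vs. distinct vs \<and> set vs = range (u N)) = range (u N)" by blast+
  qed
  have sum_xs: "(\<Sum>a\<leftarrow>xs N. F a) = (\<Sum>v\<in>range (u N). real (k N v) / M N * (M N * F (t N v)))" for F N
    unfolding xs_def using M1[of N] by (subst sum_list_concat_replicate[OF vs(1)]) (simp add: vs(2))
  have t_lim: "(\<lambda>N. t N (u N \<zeta>)) \<longlonglongrightarrow> \<zeta>" if "cmod \<zeta> = 1" for \<zeta>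
    using tendsto_mult[OF tendsto_of_real[OF tendsto_diff[OF tendsto_const e_lim, of 1]] u(4)[OF that]]
    by (simp add: t_def)
  have den_lim: "(\<lambda>N. cmod (1 - cnj (t N (u N \<zeta>)) * z)) \<longlonglongrightarrow> cmod (1 - cnj \<zeta> * z)"
    if "cmod \<zeta> = 1" for \<zeta> z
    by (intro tendsto_intros t_lim that)
  \<comment> \<open>From \<open>M * (1 - (1 - 1/M)^2) = 2 - 1/M\<close>: this is the origin of the
    numerator 2 in the limit of the weighted sums.\<close>
  have one_minus: "M N * (1 - (cmod (t N v))\<^sup>2) = 2 - e N" if "cmod v = 1" for N v
    unfolding nt[OF that] using M1[of N] by (simp add: e_def power2_eq_square field_simps)
  show ?thesis
  proof (intro exI[of _ xs] conjI[of "\<forall>N. _ N"] conjI[of "\<forall>z p. _ z p"] allI impI ballI)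
    show "1 - 1 / real (Suc N) \<le> cmod a \<and> cmod a \<le> 1" if a: "a \<in> set (xs N)" for a N
    proof -
      obtain v where "v \<in> range (u N)" "a = t N v"
        using a by (auto simp: xs_def vs(2) split: if_splits)
      then show ?thesis using nt[of v N] u(3) e[of N] by auto
    qed
  next
    fix z :: complex and p :: nat assume z: "cmod z < 1"
    define H where "H N v = M N * ((1 - (cmod (t N v))\<^sup>2) / cmod (1 - cnj (t N v) * z) ^ p)" for N v
    have H: "H N v = (2 - e N) / cmod (1 - cnj (t N v) * z) ^ p" if "cmod v = 1" for N v
      unfolding H_def times_divide_eq_right one_minus[OF that] ..
    have "(\<lambda>N. \<Sum>v\<in>range (u N). real (nat \<lfloor>measure \<mu> (u N -` {v}) * M N\<rfloor>) / M N * H N v)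
       \<longlonglongrightarrow> (\<integral>\<zeta>. 2 / cmod (1 - cnj \<zeta> * z) ^ p \<partial>\<mu>)"
    proof (rule tendsto_weighted_sum_integral[OF \<mu> AE1 u(1-3)])
      show "(\<lambda>\<zeta>. 2 / cmod (1 - cnj \<zeta> * z) ^ p) \<in> borel_measurable borel"
        by (intro borel_measurable_divide borel_measurable_power borel_measurable_const
              borel_measurable_continuous_onI continuous_intros)
      show "\<bar>H N v\<bar> \<le> 2 / (1 - cmod z) ^ p" if v: "cmod v = 1" for N v
      proof -
        have "(2 - e N) / cmod (1 - cnj (t N v) * z) ^ p \<le> 2 / (1 - cmod z) ^ p"
          using z e[of N] norm_one_minus_cnj_mult_ge[OF nt1[OF v]]
          by (intro frac_le power_mono) auto
        moreover have "0 \<le> (2 - e N) / cmod (1 - cnj (t N v) * z) ^ p"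
          using e[of N] by simp
        ultimately show ?thesis
          unfolding H[OF v] by (simp only: abs_of_nonneg)
      qed
      show "(\<lambda>N. H N (u N \<zeta>)) \<longlonglongrightarrow> 2 / cmod (1 - cnj \<zeta> * z) ^ p" if "cmod \<zeta> = 1" for \<zeta>
        unfolding H[OF u(3)]
        using norm_one_minus_cnj_mult_pos[of \<zeta> z] that z
        by (intro tendsto_divide tendsto_power den_lim)
           (auto intro!: tendsto_eq_intros e_lim)
    qed (simp add: M_def)
    then show "(\<lambda>N. \<Sum>a\<leftarrow>xs N. (1 - (cmod a)\<^sup>2) / cmod (1 - cnj a * z) ^ p)
        \<longlonglongrightarrow> (\<integral>\<zeta>. 2 / cmod (1 - cnj \<zeta> * z) ^ p \<partial>\<mu>)"
      unfolding sum_xs H_def k_def .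
  next
    fix z :: complex assume z: "cmod z < 1"
    define y where "y N v = 1 - (cmod (blaschke_factor (t N v) z))\<^sup>2" for N v
    define Q where "Q N v = (2 - e N) * (1 - (cmod z)\<^sup>2) / (cmod (1 - cnj (t N v) * z))\<^sup>2" for N v
    define C where "C = 2 / (1 - cmod z)\<^sup>2"
    have zz: "0 < 1 - (cmod z)\<^sup>2" using z by (simp add: power_less_one_iff abs_square_less_1)
    have Q: "0 < Q N v" "Q N v \<le> C" if v: "cmod v = 1" for N v
    proof -
      show "0 < Q N v" unfolding Q_def
        using zz e[of N] norm_one_minus_cnj_mult_pos[OF nt1[OF v] z, of N]
        by (intro divide_pos_pos mult_pos_pos) auto
      have "(2 - e N) * (1 - (cmod z)\<^sup>2) \<le> 2 * 1"
        using e[of N] zz by (intro mult_mono) auto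
      then show "Q N v \<le> C" unfolding Q_def C_def
        using z e[of N] zz norm_one_minus_cnj_mult_ge[OF nt1[OF v], of z N]
        by (intro frac_le power_mono) auto
    qed
    have y: "y N v = e N * Q N v" if v: "cmod v = 1" for N v
    proof -
      have "M N * y N v = Q N v"
        unfolding y_def one_minus_norm_blaschke_factor[OF nt1[OF v] z] times_divide_eq_right mult.assoc[symmetric]
          one_minus[OF v] Q_def ..
      then show ?thesis using M1[of N] by (simp add: e_def field_simps)
    qed
    define H where "H N v = M N * (- ln (cmod (blaschke_factor (t N v) z)))" for N v
    \<comment> \<open>Since \<open>y = 1 - |phi|^2\<close>, the logarithm of \<open>|phi|\<close> is
      half of \<open>ln (1 - y)\<close>, and \<open>M * y = Q\<close> tends to twice the Poisson
      kernel. The two factors cancel, so the logarithmic sums tend to the Poisson integral itself. A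
      vanishing factor is covered by \<open>ln 0 = 0\<close>.\<close>
    have H: "H N v = M N / 2 * (- ln (1 - y N v))" for N v
      by (cases "cmod (blaschke_factor (t N v) z) = 0") (simp_all add: H_def y_def ln_realpow)
    have C: "0 < C" using z by (simp add: C_def)
    have "(\<lambda>N. e N * C) \<longlonglongrightarrow> 0 * C" by (intro tendsto_intros e_lim)
    then have ev: "eventually (\<lambda>N. e N * C < 1/2) sequentially"
      by (rule order_tendstoD) simp
    \<comment> \<open>For small \<open>N\<close> the model zeros may lie near \<open>z\<close>, and
      \<open>H\<close> has no uniform bound there. Cutting these \<open>N\<close> off provides the
      domination without changing the limit.\<close>
    define H' where "H' N v = (if e N * C < 1/2 then H N v else 0)" for N v
    have H'_bd: "\<bar>H' N v\<bar> \<le> C" if v: "cmod v = 1" for N v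
    proof (cases "e N * C < 1/2")
      case True
      have yle: "y N v \<le> e N * C" unfolding y[OF v] using Q[OF v] e[of N] by (intro mult_left_mono) auto
      have y0: "0 \<le> y N v" unfolding y[OF v] using Q[OF v, of N] e[of N] by simp
      have l: "- ln (1 - y N v) \<le> 2 * y N v"
        using y0 yle True by (intro minus_ln_one_minus_le) auto
      have l0: "0 \<le> - ln (1 - y N v)"
        using y0 yle True by simp
      have "H N v \<le> M N / 2 * (2 * y N v)"
        unfolding H using l M1[of N] by (intro mult_left_mono) auto
      also have "\<dots> = Q N v" unfolding y[OF v] using M1[of N] by (simp add: e_def)
      finally have "H N v \<le> C" using Q[OF v, of N] by simp
      moreover have "0 \<le> H N v" unfolding H using l0 M1[of N] by (intro mult_nonneg_nonneg) auto
      ultimately show ?thesis using True by (simp add: H'_def)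
    qed (use C in \<open>simp add: H'_def\<close>)
    have "(\<lambda>N. \<Sum>v\<in>range (u N). real (nat \<lfloor>measure \<mu> (u N -` {v}) * M N\<rfloor>) / M N * H' N v)
       \<longlonglongrightarrow> (\<integral>\<zeta>. poisson z \<zeta> \<partial>\<mu>)"
    proof (rule tendsto_weighted_sum_integral[OF \<mu> AE1 u(1-3) _ _ H'_bd])
      show "poisson z \<in> borel_measurable borel"
        unfolding poisson_def[abs_def]
        by (intro borel_measurable_divide borel_measurable_power borel_measurable_const
              borel_measurable_continuous_onI continuous_intros)
    next
      fix \<zeta> :: complex assume v: "cmod \<zeta> = 1"
      have Q_lim: "(\<lambda>N. Q N (u N \<zeta>)) \<longlonglongrightarrow> 2 * poisson z \<zeta>"
      proof -
        have "cmod (1 - cnj \<zeta> * z) = cmod (\<zeta> - z)"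
        proof -
          have "cnj \<zeta> * \<zeta> = 1" using v by (simp add: mult.commute complex_norm_square[symmetric])
          then have "1 - cnj \<zeta> * z = cnj \<zeta> * (\<zeta> - z)" by (simp add: algebra_simps)
          then show ?thesis using v by (simp add: norm_mult)
        qed
        then have "2 * poisson z \<zeta> = (2 - 0) * (1 - (cmod z)\<^sup>2) / (cmod (1 - cnj \<zeta> * z))\<^sup>2"
          by (simp add: poisson_def)
        then show ?thesis
          unfolding Q_def using norm_one_minus_cnj_mult_pos[of \<zeta> z] v z
          by (auto simp only: zero_less_norm_iff norm_eq_zero power_eq_0_iff intro!: tendsto_divide tendsto_mult tendsto_diff tendsto_power tendsto_const den_lim e_lim)
      qed
      have y_lim: "(\<lambda>N. y N (u N \<zeta>)) \<longlonglongrightarrow> 0"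
        unfolding y[OF u(3)] using tendsto_mult[OF e_lim Q_lim] by simp
      have "((\<lambda>y::real. - ln (1 - y) / y) \<longlongrightarrow> 1) (at 0)" by real_asymp
      moreover have "filterlim (\<lambda>N. y N (u N \<zeta>)) (at 0) sequentially"
      proof -
        have "y N (u N \<zeta>) \<noteq> 0" for N
          using Q(1)[OF u(3), of N N \<zeta>] e(1)[of N] by (simp add: y[OF u(3)])
        then show ?thesis
          using y_lim by (simp add: filterlim_at)
      qed
      ultimately have "(\<lambda>N. - ln (1 - y N (u N \<zeta>)) / y N (u N \<zeta>)) \<longlonglongrightarrow> 1"
        by (rule filterlim_compose)
      then have "(\<lambda>N. Q N (u N \<zeta>) / 2 * (- ln (1 - y N (u N \<zeta>)) / y N (u N \<zeta>))) \<longlonglongrightarrow> 2 * poisson z \<zeta> / 2 * 1"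
        by (intro tendsto_mult tendsto_divide Q_lim tendsto_const) auto
      moreover have "eventually (\<lambda>N. Q N (u N \<zeta>) / 2 * (- ln (1 - y N (u N \<zeta>)) / y N (u N \<zeta>)) = H' N (u N \<zeta>)) sequentially"
        using ev
      proof eventually_elim
        case (elim N)
        have "Q N (u N \<zeta>) / (e N * Q N (u N \<zeta>)) = M N"
          using Q(1)[OF u(3), of N N \<zeta>] M1[of N] by (simp add: e_def)
        then have "Q N (u N \<zeta>) / 2 * (L / y N (u N \<zeta>)) = M N / 2 * L" for L
        proof -
          assume q: "Q N (u N \<zeta>) / (e N * Q N (u N \<zeta>)) = M N"
          have "Q N (u N \<zeta>) / 2 * (L / (e N * Q N (u N \<zeta>))) = (Q N (u N \<zeta>) / (e N * Q N (u N \<zeta>))) / 2 * L"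
            by simp
          then show ?thesis unfolding q y[OF u(3)] .
        qed
        then show ?case using elim by (simp only: H H'_def if_True)
      qed
      ultimately show "(\<lambda>N. H' N (u N \<zeta>)) \<longlonglongrightarrow> poisson z \<zeta>"
        using Lim_transform_eventually by fastforce
    qed (simp_all add: M_def)
    moreover have "eventually (\<lambda>N. (\<Sum>v\<in>range (u N). real (nat \<lfloor>measure \<mu> (u N -` {v}) * M N\<rfloor>) / M N * H' N v)
        = (\<Sum>a\<leftarrow>xs N. - ln (cmod (blaschke_factor a z)))) sequentially"
      using ev by eventually_elim (simp only: sum_xs H'_def H_def k_def if_True)
    ultimately show "(\<lambda>N. \<Sum>a\<leftarrow>xs N. - ln (cmod (blaschke_factor a z))) \<longlonglongrightarrow> (\<integral>\<zeta>. poisson z \<zeta> \<partial>\<mu>)"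
      by (rule Lim_transform_eventually)
  qed
qed

section \<open>Exhaustion of the zeros by finite lists\<close>

lemma zeros_D_countable:
  assumes "b holomorphic_on ball 0 1" "\<exists>z\<in>ball 0 1. b z \<noteq> 0"
  shows "countable (zeros_D b)"
proof (cases "b constant_on ball 0 1")
  case True
  then have "zeros_D b = {}"
    using assms(2) by (auto simp: zeros_D_def constant_on_def)
  then show ?thesis by simp
next
  case False
  have "ball (0::complex) 1 = (\<Union>n::nat. cball 0 (1 - 1 / real (Suc n)))"
  proof (intro equalityI subsetI)
    fix z :: complex assume "z \<in> ball 0 1"
    then obtain n where "inverse (real (Suc n)) < 1 - cmod z"
      using reals_Archimedean[of "1 - cmod z"] by auto
    then show "z \<in> (\<Union>n::nat. cball 0 (1 - 1 / real (Suc n)))"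
      by (auto simp: inverse_eq_divide intro!: exI[of _ n])
  next
    fix z :: complex assume "z \<in> (\<Union>n::nat. cball 0 (1 - 1 / real (Suc n)))"
    then obtain n :: nat where "cmod z \<le> 1 - 1 / real (Suc n)" by auto
    also have "\<dots> < 1" by simp
    finally show "z \<in> ball 0 1" by simp
  qed
  then have "fsigma (ball (0::complex) 1)"
    using fsigma.intros[of "\<lambda>n. cball (0::complex) (1 - 1 / real (Suc n))"] by simp
  then show ?thesis
    unfolding zeros_D_def using assms(1) False by (intro holomorphic_countable_zeros) auto
qed

text \<open>Monotone convergence along an enumeration of the zeros. One sequence of lists serves
  every weight \<open>F\<close>, since the logarithmic sums and the sums of all exponents have to
  converge simultaneously.\<close>

lemma zero_list_exhaustion:
  assumes "b holomorphic_on ball 0 1" "\<exists>z\<in>ball 0 1. b z \<noteq> 0"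
  shows "\<exists>xs :: nat \<Rightarrow> complex list. (\<forall>N. set (xs N) \<subseteq> zeros_D b) \<and>
    (\<forall>F. (\<forall>a\<in>zeros_D b. 0 \<le> F a) \<longrightarrow>
       (\<integral>\<^sup>+ a. ennreal (of_nat (nat (zorder b a)) * F a) \<partial>count_space (zeros_D b)) < \<infinity> \<longrightarrow>
       (\<lambda>N. \<Sum>a\<leftarrow>xs N. F a) \<longlonglongrightarrow>
         enn2real (\<integral>\<^sup>+ a. ennreal (of_nat (nat (zorder b a)) * F a) \<partial>count_space (zeros_D b)))"
proof -
  let ?Z = "zeros_D b" and ?m = "\<lambda>a. nat (zorder b a)"
  define A where "A N = {a \<in> ?Z. to_nat_on ?Z a < N}" for N
  have finA: "finite (A N)" for N
  proof (rule finite_imageD[of "to_nat_on ?Z"])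
    show "finite (to_nat_on ?Z ` A N)" by (rule finite_subset[of _ "{..<N}"]) (auto simp: A_def)
    show "inj_on (to_nat_on ?Z) (A N)"
      using inj_on_to_nat_on[OF zeros_D_countable[OF assms]] by (rule inj_on_subset) (auto simp: A_def)
  qed
  define vs where "vs N = (SOME vs. distinct vs \<and> set vs = A N)" for N
  have vs: "distinct (vs N)" "set (vs N) = A N" for N
  proof -
    have "\<exists>vs. distinct vs \<and> set vs = A N"
      using finite_distinct_list[OF finA[of N]] by blast
    from someI_ex[OF this] show "distinct (vs N)" "set (vs N) = A N"
      unfolding vs_def by blast+
  qed
  define xs where "xs N = concat (map (\<lambda>v. replicate (?m v) v) (vs N))" for N
  have sub: "set (xs N) \<subseteq> ?Z" for N
    by (auto simp: xs_def vs(2) A_def split: if_splits)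
  show ?thesis
  proof (intro exI[of _ xs] conjI allI impI)
    show "set (xs N) \<subseteq> ?Z" for N by (rule sub)
    fix F :: "complex \<Rightarrow> real"
    assume "\<forall>a\<in>?Z. 0 \<le> F a"
      and fin: "(\<integral>\<^sup>+ a. ennreal (of_nat (?m a) * F a) \<partial>count_space ?Z) < \<infinity>"
    then have F: "0 \<le> F a" if "a \<in> ?Z" for a using that by blast
    let ?I = "\<integral>\<^sup>+ a. ennreal (of_nat (?m a) * F a) \<partial>count_space ?Z"
    let ?f = "\<lambda>N a. ennreal (of_nat (?m a) * F a) * indicator (A N) a"
    have part: "(\<integral>\<^sup>+ a. ?f N a \<partial>count_space ?Z) = ennreal (\<Sum>a\<leftarrow>xs N. F a)" for N
    proof -
      have "(\<integral>\<^sup>+ a. ?f N a \<partial>count_space ?Z) = (\<Sum>a\<in>A N. ?f N a)"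
        by (rule nn_integral_count_space'[OF finA]) (auto simp: A_def)
      also have "\<dots> = (\<Sum>a\<in>A N. ennreal (of_nat (?m a) * F a))"
        by (intro sum.cong) auto
      also have "\<dots> = ennreal (\<Sum>a\<in>A N. of_nat (?m a) * F a)"
        using F by (intro sum_ennreal) (auto simp: A_def)
      finally show ?thesis
        unfolding xs_def by (subst sum_list_concat_replicate[OF vs(1)]) (simp add: vs(2))
    qed
    have inc: "incseq ?f"
      by (intro incseq_SucI le_funI mult_left_mono) (auto simp: A_def indicator_def)
    have "?I = (\<integral>\<^sup>+ a. (SUP N. ?f N a) \<partial>count_space ?Z)"
    proof (rule nn_integral_cong)
      fix a assume "a \<in> space (count_space ?Z)"
      then have a: "a \<in> A (Suc (to_nat_on ?Z a))" by (simp add: A_def)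
      show "ennreal (of_nat (?m a) * F a) = (SUP N. ?f N a)"
      proof (rule antisym)
        show "ennreal (of_nat (?m a) * F a) \<le> (SUP N. ?f N a)"
          by (rule SUP_upper2[of "Suc (to_nat_on ?Z a)"]) (use a in auto)
        show "(SUP N. ?f N a) \<le> ennreal (of_nat (?m a) * F a)"
          by (rule SUP_least) (auto simp: indicator_def)
      qed
    qed
    also have "\<dots> = (SUP N. \<integral>\<^sup>+ a. ?f N a \<partial>count_space ?Z)"
      using inc by (rule nn_integral_monotone_convergence_SUP) simp
    finally have I: "?I = (SUP N. \<integral>\<^sup>+ a. ?f N a \<partial>count_space ?Z)" .
    have "incseq (\<lambda>N. \<integral>\<^sup>+ a. ?f N a \<partial>count_space ?Z)"
      using inc by (auto simp: incseq_def le_fun_def intro!: nn_integral_mono)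
    then have "(\<lambda>N. \<integral>\<^sup>+ a. ?f N a \<partial>count_space ?Z) \<longlonglongrightarrow> ?I"
      unfolding I by (rule LIMSEQ_SUP)
    then have "(\<lambda>N. ennreal (\<Sum>a\<leftarrow>xs N. F a)) \<longlonglongrightarrow> ennreal (enn2real ?I)"
      using fin by (simp add: part)
    moreover have "0 \<le> (\<Sum>a\<leftarrow>xs N. F a)" for N
      using F sub[of N] by (intro sum_list_nonneg) auto
    ultimately show "(\<lambda>N. \<Sum>a\<leftarrow>xs N. F a) \<longlonglongrightarrow> enn2real ?I"
      by (subst (asm) tendsto_ennreal_iff) auto
  qed
qed

section \<open>Poisson integrals and the Blaschke condition\<close>

lemma poisson_lower_bound:
  assumes "cmod z < 1" "cmod \<zeta> = 1"
  shows "(1 - (cmod z)\<^sup>2) / 4 \<le> poisson z \<zeta>"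
proof -
  have "0 < cmod (\<zeta> - z)" using assms by auto
  moreover have "cmod (\<zeta> - z) \<le> 2" using norm_triangle_ineq4[of \<zeta> z] assms by simp
  then have "(cmod (\<zeta> - z))\<^sup>2 \<le> 2\<^sup>2" by (intro power_mono) auto
  ultimately show ?thesis
    unfolding poisson_def using assms by (intro divide_left_mono) (auto simp: power_le_one)
qed

lemma poisson_nonneg: "cmod z \<le> 1 \<Longrightarrow> 0 \<le> poisson z \<zeta>"
  by (auto simp: poisson_def power_le_one)

lemma poisson_measurable: "poisson z \<in> borel_measurable borel"
  unfolding poisson_def[abs_def]
  by (intro borel_measurable_divide borel_measurable_power borel_measurable_const
      borel_measurable_continuous_onI continuous_intros)

lemma kernel_power_measurable: "(\<lambda>\<zeta>. c / cmod (1 - cnj \<zeta> * z) ^ p) \<in> borel_measurable borel"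
  by (intro borel_measurable_divide borel_measurable_power borel_measurable_const
      borel_measurable_continuous_onI continuous_intros)

text \<open>The Poisson kernel of a fixed point is bounded below on the circle, so one finite
  Poisson integral bounds the total mass. This makes \<open>-log |b|\<close> integrable.\<close>

lemma finite_measure_from_poisson:
  assumes "cmod z < 1" "sets \<mu> = sets borel" "AE \<zeta> in \<mu>. cmod \<zeta> = 1"
    "(\<integral>\<^sup>+ \<zeta>. ennreal (poisson z \<zeta>) \<partial>\<mu>) < \<infinity>"
  shows "finite_measure \<mu>"
proof -
  let ?c = "(1 - (cmod z)\<^sup>2) / 4"
  have c: "0 < ?c" using assms(1) by (simp add: abs_square_less_1)
  have "ennreal ?c * emeasure \<mu> (space \<mu>) = (\<integral>\<^sup>+ \<zeta>. ennreal ?c \<partial>\<mu>)" by simp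
  also have "\<dots> \<le> (\<integral>\<^sup>+ \<zeta>. ennreal (poisson z \<zeta>) \<partial>\<mu>)"
    using assms(3) by (intro nn_integral_mono_AE) (auto elim!: eventually_mono intro!: ennreal_leI poisson_lower_bound assms(1))
  finally have "ennreal ?c * emeasure \<mu> (space \<mu>) < \<infinity>" using assms(4) by (rule le_less_trans)
  then have "emeasure \<mu> (space \<mu>) \<noteq> \<infinity>"
    using c by (auto simp: ennreal_mult_eq_top_iff ennreal_mult_less_top)
  then show ?thesis by (rule finite_measureI)
qed

lemma kernel_power_integrable:
  assumes "finite_measure \<mu>" "sets \<mu> = sets borel" "AE \<zeta> in \<mu>. cmod \<zeta> = 1" "cmod z < 1"
  shows "integrable \<mu> (\<lambda>\<zeta>. 1 / cmod (1 - cnj \<zeta> * z) ^ p)"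
proof -
  interpret finite_measure \<mu> by fact
  show ?thesis
  proof (rule integrable_const_bound[where B = "1 / (1 - cmod z) ^ p"])
    show "AE \<zeta> in \<mu>. norm (1 / cmod (1 - cnj \<zeta> * z) ^ p) \<le> 1 / (1 - cmod z) ^ p"
      using assms(3)
    proof eventually_elim
      case (elim \<zeta>)
      then have "1 / cmod (1 - cnj \<zeta> * z) ^ p \<le> 1 / (1 - cmod z) ^ p"
        using norm_one_minus_cnj_mult_ge[of \<zeta> z] assms(4) by (intro frac_le power_mono) auto
      then show ?case by (simp add: norm_power)
    qed
    show "(\<lambda>\<zeta>. 1 / cmod (1 - cnj \<zeta> * z) ^ p) \<in> borel_measurable \<mu>"
      using kernel_power_measurable by (simp add: measurable_cong_sets[OF assms(2) refl])
  qed
qed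

lemma norm_blaschke_prod_eq_exp:
  assumes "\<And>i. i < n \<Longrightarrow> blaschke_factor (a i) z \<noteq> 0"
  shows "cmod (blaschke_prod a n z) = exp (- (\<Sum>i<n. - ln (cmod (blaschke_factor (a i) z))))"
  using assms by (simp add: blaschke_prod_def prod_norm[symmetric] sum_negf exp_sum)

text \<open>Quantitative form of the Blaschke condition, from \<open>1 - x <= -ln x\<close> with
  \<open>x = |phi|^2\<close>. The constant is \<open>8 = 2 * 4\<close>: 2 from the square under the
  logarithm, 4 from \<open>|1 - cnj a * z|^2 <= 4\<close>.\<close>

lemma one_minus_norm_square_le_ln:
  assumes "cmod a \<le> 1" "cmod z < 1" "z \<noteq> a"
  shows "1 - (cmod a)\<^sup>2 \<le> 8 / (1 - (cmod z)\<^sup>2) * (- ln (cmod (blaschke_factor a z)))"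
proof -
  have zz: "0 < 1 - (cmod z)\<^sup>2" using assms by (simp add: abs_square_less_1)
  let ?X = "cmod (1 - cnj a * z)"
  have X: "0 < ?X" "?X \<le> 2"
    using norm_one_minus_cnj_mult_pos norm_one_minus_cnj_mult_le assms by auto
  have "0 < cmod (blaschke_factor a z)"
    using assms one_minus_cnj_mult_nonzero[OF assms(1,2)] by (simp add: blaschke_factor_def)
  then have "1 - (cmod (blaschke_factor a z))\<^sup>2 \<le> - ln ((cmod (blaschke_factor a z))\<^sup>2)"
    using ln_le_minus_one[of "(cmod (blaschke_factor a z))\<^sup>2"] by simp
  also have "\<dots> = 2 * (- ln (cmod (blaschke_factor a z)))"
    using \<open>0 < cmod (blaschke_factor a z)\<close> by (simp add: ln_realpow)
  finally have "(1 - (cmod a)\<^sup>2) * (1 - (cmod z)\<^sup>2) / ?X\<^sup>2 \<le> 2 * (- ln (cmod (blaschke_factor a z)))"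
    unfolding one_minus_norm_blaschke_factor[OF assms(1,2)] .
  moreover have "(1 - (cmod a)\<^sup>2) * (1 - (cmod z)\<^sup>2) / 2\<^sup>2 \<le> (1 - (cmod a)\<^sup>2) * (1 - (cmod z)\<^sup>2) / ?X\<^sup>2"
    using X zz assms by (intro divide_left_mono power_mono mult_nonneg_nonneg) (auto simp: power_le_one)
  ultimately have "(1 - (cmod a)\<^sup>2) * (1 - (cmod z)\<^sup>2) / 2\<^sup>2 \<le> 2 * (- ln (cmod (blaschke_factor a z)))"
    by (rule order_trans[rotated])
  then have "(1 - (cmod a)\<^sup>2) * (1 - (cmod z)\<^sup>2) \<le> 8 * (- ln (cmod (blaschke_factor a z)))"
    by simp
  then show ?thesis using zz by (simp add: field_simps)
qed

text \<open>Near a point where \<open>b\<close> does not vanish the quotient \<open>b / g\<close>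
  has constant modulus 1, so it is constant by the maximum principle; the identity theorem extends
  this to the disk.\<close>

lemma norm_eq_imp_unimodular_multiple:
  assumes g: "g holomorphic_on ball 0 1" and b: "b holomorphic_on ball 0 1"
    and ne: "\<exists>z\<in>ball 0 1. b z \<noteq> 0"
    and eq: "\<And>z. z \<in> ball 0 1 \<Longrightarrow> b z \<noteq> 0 \<Longrightarrow> cmod (g z) = cmod (b z)"
  obtains c :: complex where "cmod c = 1" "\<And>z. z \<in> ball 0 1 \<Longrightarrow> b z = c * g z"
proof -
  obtain z0 where z0: "z0 \<in> ball 0 1" "b z0 \<noteq> 0" using ne by blast
  have "continuous_on (ball 0 1) b" using b by (rule holomorphic_on_imp_continuous_on)
  then have "open (ball 0 1 \<inter> b -` (- {0}))"
    by (rule continuous_open_preimage) auto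
  moreover have "z0 \<in> ball 0 1 \<inter> b -` (- {0})" using z0 by auto
  ultimately obtain e where e: "0 < e" "ball z0 e \<subseteq> ball 0 1 \<inter> b -` (- {0})"
    using openE by blast
  then have nz: "b w \<noteq> 0" "w \<in> ball 0 1" if "w \<in> ball z0 e" for w using that by auto
  have "(\<lambda>w. b w / g w) constant_on ball z0 e"
  proof (rule maximum_modulus_principle[of _ _ "ball z0 e" z0])
    have gnz: "g w \<noteq> 0" if "w \<in> ball z0 e" for w
      using eq[OF nz(2)[OF that] nz(1)[OF that]] nz(1)[OF that] by auto
    show "(\<lambda>w. b w / g w) holomorphic_on ball z0 e"
      using g b nz gnz by (intro holomorphic_on_divide) (auto intro: holomorphic_on_subset)
    show "cmod (b w / g w) \<le> cmod (b z0 / g z0)" if "w \<in> ball z0 e" for w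
      using eq[OF nz(2)[OF that] nz(1)[OF that]] eq[OF z0] nz(1)[OF that] z0 by (simp add: norm_divide)
  qed (use e in auto)
  then obtain c where c: "\<And>w. w \<in> ball z0 e \<Longrightarrow> b w / g w = c" by (auto simp: constant_on_def)
  have c1: "cmod c = 1"
    using c[of z0] e eq[OF z0] z0 by (auto simp: norm_divide)
  have bg: "b w = c * g w" if "w \<in> ball z0 e" for w
    using c[OF that] eq[OF nz(2)[OF that] nz(1)[OF that]] nz(1)[OF that] by auto
  have "b z = c * g z" if "z \<in> ball 0 1" for z
    by (rule analytic_continuation_open[of "ball z0 e" "ball 0 1" b "\<lambda>z. c * g z"])
       (use e nz bg b g that in \<open>auto intro!: holomorphic_intros\<close>)
  then show ?thesis using c1 that by blast
qed

text \<open>For \<open>p = 2*m+2\<close> it unfolds literally to the sum in the theorem. Extended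
  nonnegative values are kept because finiteness is part of the claim there.\<close>

definition zero_boundary_sum :: "(complex \<Rightarrow> complex) \<Rightarrow> complex measure \<Rightarrow> nat \<Rightarrow> complex \<Rightarrow> ennreal" where
  "zero_boundary_sum b \<nu> p z =
     (\<integral>\<^sup>+ a. ennreal (of_nat (nat (zorder b a)) * (1 - (cmod a)\<^sup>2)
        / (cmod (1 - cnj a * z)) ^ p) \<partial>count_space (zeros_D b))
   + (\<integral>\<^sup>+ \<zeta>. ennreal (1 / (cmod (1 - cnj \<zeta> * z)) ^ p) \<partial>\<nu>)
   + (\<integral>\<^sup>+ \<zeta>. ennreal (- ln (bdry_abs b \<zeta>) / (cmod (1 - cnj \<zeta> * z)) ^ p) \<partial>mT)"

section \<open>Simultaneous approximation of zeros, singular measure and outer part\<close>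

lemma sum_list_append_tendsto:
  fixes F :: "'a \<Rightarrow> real"
  assumes "(\<lambda>N. \<Sum>a\<leftarrow>xs N. F a) \<longlonglongrightarrow> x" "(\<lambda>N. \<Sum>a\<leftarrow>ys N. F a) \<longlonglongrightarrow> y"
  shows "(\<lambda>N. \<Sum>a\<leftarrow>xs N @ ys N. F a) \<longlonglongrightarrow> x + y"
  using tendsto_add[OF assms] by simp

lemma sum_list_nth_default:
  fixes F :: "'a \<Rightarrow> real"
  shows "(\<Sum>i<length xs. F (if i < length xs then xs ! i else d)) = (\<Sum>a\<leftarrow>xs. F a)"
  by (simp add: sum_list_sum_nth atLeast0LessThan)

text \<open>Three lists are concatenated: finite parts of the true zeros, and models of
  \<open>\<nu>\<close> and of \<open>-log |b|\<close> times Lebesgue measure. In the limit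
  \<open>J\<close> the zeros count once and the two measures twice, so \<open>J\<close> agrees with
  \<open>zero_boundary_sum\<close> only up to a factor between 1 and 2, which is all that
  boundedness requires.\<close>

lemma blaschke_list_approximation:
  assumes hol: "b holomorphic_on ball 0 1" and img: "b ` ball 0 1 \<subseteq> ball 0 1"
    and ne: "\<exists>z\<in>ball 0 1. b z \<noteq> 0" and sfm: "singular_factor_measure b \<nu>"
  obtains xs J
  where "\<And>N a. a \<in> set (xs N) \<Longrightarrow> cmod a \<le> 1"
    "\<And>z. z \<in> ball 0 1 \<Longrightarrow> b z \<noteq> 0 \<Longrightarrow> eventually (\<lambda>N. z \<notin> set (xs N)) sequentially"
    "\<And>z p. z \<in> ball 0 1 \<Longrightarrow> (\<lambda>N. \<Sum>a\<leftarrow>xs N. (1 - (cmod a)\<^sup>2) / cmod (1 - cnj a * z) ^ p) \<longlonglongrightarrow> J p z"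
    "\<And>z. z \<in> ball 0 1 \<Longrightarrow> b z \<noteq> 0 \<Longrightarrow>
       (\<lambda>N. \<Sum>a\<leftarrow>xs N. - ln (cmod (blaschke_factor a z))) \<longlonglongrightarrow> - ln (cmod (b z))"
    "\<And>z p. z \<in> ball 0 1 \<Longrightarrow> zero_boundary_sum b \<nu> p z \<le> ennreal (J p z)"
    "\<And>z p. z \<in> ball 0 1 \<Longrightarrow> ennreal (J p z) \<le> 2 * zero_boundary_sum b \<nu> p z"
proof -
  let ?Z = "zeros_D b" and ?m = "\<lambda>a. nat (zorder b a)"
  obtain g where g: "g \<in> borel_measurable borel" "\<And>\<zeta>. cmod \<zeta> = 1 \<Longrightarrow> g \<zeta> = bdry_abs b \<zeta>"
    using bdry_abs_measurable[OF hol] by metis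
  define w where "w \<zeta> = ennreal (- ln (g \<zeta>))" for \<zeta>
  have w[measurable]: "w \<in> borel_measurable borel"
    unfolding w_def using g(1) by measurable
  have w': "w \<in> borel_measurable mT"
    by (simp add: measurable_cong_sets[OF sets_mT refl] w)
  \<comment> \<open>The kernels are nonnegative, so \<open>ennreal\<close> truncates
    \<open>kernel * (-ln ...)\<close> exactly as it truncates \<open>-ln ...\<close> in this
    density; the integrals against \<open>W\<close> are therefore the third integrals of both
    formulas.\<close>
  define W where "W = density mT w"
  have sets_W: "sets W = sets borel" by (simp add: W_def)
  have AE_W: "AE \<zeta> in W. cmod \<zeta> = 1"
    unfolding W_def AE_density[OF w'] using AE_mT_norm by eventually_elim simp
  have int_W: "(\<integral>\<^sup>+ \<zeta>. ennreal (k \<zeta> * (- ln (bdry_abs b \<zeta>))) \<partial>mT) = (\<integral>\<^sup>+ \<zeta>. ennreal (k \<zeta>) \<partial>W)"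
    if k: "k \<in> borel_measurable borel" and k0: "\<And>\<zeta>. 0 \<le> k \<zeta>" for k
  proof -
    have "(\<integral>\<^sup>+ \<zeta>. ennreal (k \<zeta> * (- ln (bdry_abs b \<zeta>))) \<partial>mT) = (\<integral>\<^sup>+ \<zeta>. w \<zeta> * ennreal (k \<zeta>) \<partial>mT)"
    proof (rule nn_integral_cong_AE)
      show "AE \<zeta> in mT. ennreal (k \<zeta> * (- ln (bdry_abs b \<zeta>))) = w \<zeta> * ennreal (k \<zeta>)"
        using AE_mT_norm
      proof eventually_elim
        case (elim \<zeta>)
        then show ?case
          unfolding w_def g(2)[OF elim] by (subst ennreal_mult'[OF k0]) (simp add: mult.commute)
      qed
    qed
    also have "\<dots> = (\<integral>\<^sup>+ \<zeta>. ennreal (k \<zeta>) \<partial>W)"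
      unfolding W_def using k w'
      by (intro nn_integral_density[symmetric]) (simp_all add: measurable_cong_sets[OF sets_mT refl])
    finally show ?thesis .
  qed
  have sets_\<nu>: "sets \<nu> = sets borel" and fin_\<nu>: "finite_measure \<nu>"
    and em_\<nu>: "emeasure \<nu> (UNIV - sphere 0 1) = 0"
    and formula: "\<And>z. z \<in> ball 0 1 \<Longrightarrow> b z \<noteq> 0 \<Longrightarrow> ennreal (- ln (cmod (b z))) =
          (\<integral>\<^sup>+ a. ennreal (of_nat (?m a) * (- ln (cmod (blaschke_factor a z)))) \<partial>count_space ?Z)
          + (\<integral>\<^sup>+ \<zeta>. ennreal (poisson z \<zeta>) \<partial>\<nu>) + (\<integral>\<^sup>+ \<zeta>. ennreal (poisson z \<zeta>) \<partial>W)"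
    using sfm int_W[OF poisson_measurable poisson_nonneg]
    unfolding singular_factor_measure_def blaschke_factor_def by simp_all
  have AE_\<nu>: "AE \<zeta> in \<nu>. cmod \<zeta> = 1"
  proof (rule AE_I[OF _ em_\<nu>])
    show "UNIV - sphere 0 1 \<in> sets \<nu>"
      unfolding sets_\<nu> by (simp add: Compl_eq_Diff_UNIV[symmetric])
  qed auto
  obtain z0 where z0: "z0 \<in> ball 0 1" "b z0 \<noteq> 0" using ne by blast
  have zero0: "a \<noteq> z" if "a \<in> ?Z" "b z \<noteq> 0" for a z using that by (auto simp: zeros_D_def)
  have Z1: "cmod a < 1" if "a \<in> ?Z" for a using that by (auto simp: zeros_D_def)
  have parts_fin: "(\<integral>\<^sup>+ a. ennreal (of_nat (?m a) * (- ln (cmod (blaschke_factor a z)))) \<partial>count_space ?Z) < \<infinity>"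
      "(\<integral>\<^sup>+ \<zeta>. ennreal (poisson z \<zeta>) \<partial>\<nu>) < \<infinity>" "(\<integral>\<^sup>+ \<zeta>. ennreal (poisson z \<zeta>) \<partial>W) < \<infinity>"
    if "z \<in> ball 0 1" "b z \<noteq> 0" for z
  proof -
    have "(\<integral>\<^sup>+ a. ennreal (of_nat (?m a) * (- ln (cmod (blaschke_factor a z)))) \<partial>count_space ?Z)
          + (\<integral>\<^sup>+ \<zeta>. ennreal (poisson z \<zeta>) \<partial>\<nu>) + (\<integral>\<^sup>+ \<zeta>. ennreal (poisson z \<zeta>) \<partial>W) < \<infinity>"
      unfolding formula[OF that, symmetric] by simp
    then show "(\<integral>\<^sup>+ a. ennreal (of_nat (?m a) * (- ln (cmod (blaschke_factor a z)))) \<partial>count_space ?Z) < \<infinity>"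
      "(\<integral>\<^sup>+ \<zeta>. ennreal (poisson z \<zeta>) \<partial>\<nu>) < \<infinity>" "(\<integral>\<^sup>+ \<zeta>. ennreal (poisson z \<zeta>) \<partial>W) < \<infinity>"
      by (auto simp: less_top)
  qed
  have fin_W: "finite_measure W"
    using z0 parts_fin(3)[OF z0] by (intro finite_measure_from_poisson[OF _ sets_W AE_W, of z0]) auto
  have ln_nonneg: "0 \<le> - ln (cmod (blaschke_factor a z))" if "cmod a \<le> 1" "cmod z < 1" for a z
    using norm_blaschke_factor_le_1[OF that] by (cases "blaschke_factor a z = 0") auto
  have sum_fin: "(\<integral>\<^sup>+ a. ennreal (of_nat (?m a) * ((1 - (cmod a)\<^sup>2) / cmod (1 - cnj a * z) ^ p)) \<partial>count_space ?Z) < \<infinity>"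
    if z: "z \<in> ball 0 1" for z p
  proof -
    \<comment> \<open>At \<open>z0\<close> the logarithmic sum is finite and dominates the weights
      \<open>1 - |a|^2\<close>; the remaining factor bounds the denominators at
      \<open>z\<close>.\<close>
    define K where "K = 8 / (1 - (cmod z0)\<^sup>2) / (1 - cmod z) ^ p"
    have K: "0 \<le> K" using z z0 by (auto simp: K_def power_le_one)
    have "(\<integral>\<^sup>+ a. ennreal (of_nat (?m a) * ((1 - (cmod a)\<^sup>2) / cmod (1 - cnj a * z) ^ p)) \<partial>count_space ?Z)
      \<le> (\<integral>\<^sup>+ a. ennreal K * ennreal (of_nat (?m a) * (- ln (cmod (blaschke_factor a z0)))) \<partial>count_space ?Z)"
    proof (rule nn_integral_mono)
      fix a assume "a \<in> space (count_space ?Z)"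
      then have a: "a \<in> ?Z" by simp
      have "(1 - (cmod a)\<^sup>2) / cmod (1 - cnj a * z) ^ p \<le> (1 - (cmod a)\<^sup>2) / (1 - cmod z) ^ p"
        using norm_one_minus_cnj_mult_ge[of a z] Z1[OF a] z
        by (intro divide_left_mono power_mono mult_pos_pos zero_less_power) (auto simp: power_le_one intro: less_le_trans)
      also have "\<dots> \<le> 8 / (1 - (cmod z0)\<^sup>2) * (- ln (cmod (blaschke_factor a z0))) / (1 - cmod z) ^ p"
        using one_minus_norm_square_le_ln[of a z0] Z1[OF a] z0 z zero0[OF a z0(2)]
        by (intro divide_right_mono) auto
      finally have "(1 - (cmod a)\<^sup>2) / cmod (1 - cnj a * z) ^ p \<le> K * (- ln (cmod (blaschke_factor a z0)))"
        by (simp add: K_def)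
      then have "of_nat (?m a) * ((1 - (cmod a)\<^sup>2) / cmod (1 - cnj a * z) ^ p)
          \<le> of_nat (?m a) * (K * (- ln (cmod (blaschke_factor a z0))))"
        by (rule mult_left_mono) simp
      also have "\<dots> = K * (of_nat (?m a) * (- ln (cmod (blaschke_factor a z0))))" by (simp add: mult_ac)
      finally have "ennreal (of_nat (?m a) * ((1 - (cmod a)\<^sup>2) / cmod (1 - cnj a * z) ^ p))
          \<le> ennreal (K * (of_nat (?m a) * (- ln (cmod (blaschke_factor a z0)))))"
        by (rule ennreal_leI)
      then show "ennreal (of_nat (?m a) * ((1 - (cmod a)\<^sup>2) / cmod (1 - cnj a * z) ^ p))
          \<le> ennreal K * ennreal (of_nat (?m a) * (- ln (cmod (blaschke_factor a z0))))"
        unfolding ennreal_mult'[OF K] .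
    qed
    also have "\<dots> = ennreal K * (\<integral>\<^sup>+ a. ennreal (of_nat (?m a) * (- ln (cmod (blaschke_factor a z0)))) \<partial>count_space ?Z)"
      by (rule nn_integral_cmult) simp
    also have "\<dots> < \<infinity>"
      using parts_fin(1)[OF z0] by (simp add: ennreal_mult_less_top)
    finally show ?thesis .
  qed
  obtain xs where xs1: "\<forall>N. set (xs N) \<subseteq> ?Z"
    and xs2: "\<forall>F. (\<forall>a\<in>?Z. 0 \<le> F a) \<longrightarrow>
       (\<integral>\<^sup>+ a. ennreal (of_nat (?m a) * F a) \<partial>count_space ?Z) < \<infinity> \<longrightarrow>
       (\<lambda>N. \<Sum>a\<leftarrow>xs N. F a) \<longlonglongrightarrow> enn2real (\<integral>\<^sup>+ a. ennreal (of_nat (?m a) * F a) \<partial>count_space ?Z)"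
    using zero_list_exhaustion[OF hol ne] by (elim exE conjE)
  obtain ys where ys1: "\<forall>N. \<forall>a\<in>set (ys N). 1 - 1 / real (Suc N) \<le> cmod a \<and> cmod a \<le> 1"
    and ys2: "\<forall>z p. cmod z < 1 \<longrightarrow> (\<lambda>N. \<Sum>a\<leftarrow>ys N. (1 - (cmod a)\<^sup>2) / cmod (1 - cnj a * z) ^ p)
        \<longlonglongrightarrow> (\<integral>\<zeta>. 2 / cmod (1 - cnj \<zeta> * z) ^ p \<partial>\<nu>)"
    and ys3: "\<forall>z. cmod z < 1 \<longrightarrow> (\<lambda>N. \<Sum>a\<leftarrow>ys N. - ln (cmod (blaschke_factor a z))) \<longlonglongrightarrow> (\<integral>\<zeta>. poisson z \<zeta> \<partial>\<nu>)"
    using finite_measure_blaschke_approx[OF fin_\<nu> sets_\<nu> AE_\<nu>] by (elim exE conjE)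
  obtain us where us1: "\<forall>N. \<forall>a\<in>set (us N). 1 - 1 / real (Suc N) \<le> cmod a \<and> cmod a \<le> 1"
    and us2: "\<forall>z p. cmod z < 1 \<longrightarrow> (\<lambda>N. \<Sum>a\<leftarrow>us N. (1 - (cmod a)\<^sup>2) / cmod (1 - cnj a * z) ^ p)
        \<longlonglongrightarrow> (\<integral>\<zeta>. 2 / cmod (1 - cnj \<zeta> * z) ^ p \<partial>W)"
    and us3: "\<forall>z. cmod z < 1 \<longrightarrow> (\<lambda>N. \<Sum>a\<leftarrow>us N. - ln (cmod (blaschke_factor a z))) \<longlonglongrightarrow> (\<integral>\<zeta>. poisson z \<zeta> \<partial>W)"
    using finite_measure_blaschke_approx[OF fin_W sets_W AE_W] by (elim exE conjE)
  define J where "J p z = enn2real (\<integral>\<^sup>+ a. ennreal (of_nat (?m a) * ((1 - (cmod a)\<^sup>2) / cmod (1 - cnj a * z) ^ p)) \<partial>count_space ?Z)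
     + ((\<integral>\<zeta>. 2 / cmod (1 - cnj \<zeta> * z) ^ p \<partial>\<nu>) + (\<integral>\<zeta>. 2 / cmod (1 - cnj \<zeta> * z) ^ p \<partial>W))" for p z
  have J_eq: "zero_boundary_sum b \<nu> p z = ennreal (enn2real (\<integral>\<^sup>+ a. ennreal (of_nat (?m a) * ((1 - (cmod a)\<^sup>2) / cmod (1 - cnj a * z) ^ p)) \<partial>count_space ?Z)
      + ((\<integral>\<zeta>. 1 / cmod (1 - cnj \<zeta> * z) ^ p \<partial>\<nu>) + (\<integral>\<zeta>. 1 / cmod (1 - cnj \<zeta> * z) ^ p \<partial>W)))"
    if z: "z \<in> ball 0 1" for p z
  proof -
    have z1: "cmod z < 1" using z by simp
    have 1: "(\<integral>\<^sup>+ a. ennreal (of_nat (?m a) * (1 - (cmod a)\<^sup>2) / (cmod (1 - cnj a * z)) ^ p) \<partial>count_space ?Z)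
       = ennreal (enn2real (\<integral>\<^sup>+ a. ennreal (of_nat (?m a) * ((1 - (cmod a)\<^sup>2) / cmod (1 - cnj a * z) ^ p)) \<partial>count_space ?Z))"
      using sum_fin[OF z, of p] by simp
    have 2: "(\<integral>\<^sup>+ \<zeta>. ennreal (1 / (cmod (1 - cnj \<zeta> * z)) ^ p) \<partial>\<nu>) = ennreal (\<integral>\<zeta>. 1 / cmod (1 - cnj \<zeta> * z) ^ p \<partial>\<nu>)"
      by (rule nn_integral_eq_integral[OF kernel_power_integrable[OF fin_\<nu> sets_\<nu> AE_\<nu> z1]]) simp
    have "(\<integral>\<^sup>+ \<zeta>. ennreal (- ln (bdry_abs b \<zeta>) / (cmod (1 - cnj \<zeta> * z)) ^ p) \<partial>mT)
      = (\<integral>\<^sup>+ \<zeta>. ennreal (1 / (cmod (1 - cnj \<zeta> * z)) ^ p * (- ln (bdry_abs b \<zeta>))) \<partial>mT)"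
      by simp
    also have "\<dots> = (\<integral>\<^sup>+ \<zeta>. ennreal (1 / (cmod (1 - cnj \<zeta> * z)) ^ p) \<partial>W)"
      by (rule int_W[OF kernel_power_measurable]) simp
    also have "\<dots> = ennreal (\<integral>\<zeta>. 1 / cmod (1 - cnj \<zeta> * z) ^ p \<partial>W)"
      by (rule nn_integral_eq_integral[OF kernel_power_integrable[OF fin_W sets_W AE_W z1]]) simp
    finally have 3: "(\<integral>\<^sup>+ \<zeta>. ennreal (- ln (bdry_abs b \<zeta>) / (cmod (1 - cnj \<zeta> * z)) ^ p) \<partial>mT)
      = ennreal (\<integral>\<zeta>. 1 / cmod (1 - cnj \<zeta> * z) ^ p \<partial>W)" .
    show ?thesis
      unfolding zero_boundary_sum_def 1 2 3
      by (simp add: ennreal_plus[symmetric] integral_nonneg add.assoc del: ennreal_plus)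
  qed
  have two: "(\<integral>\<zeta>. 2 / cmod (1 - cnj \<zeta> * z) ^ p \<partial>\<mu>) = 2 * (\<integral>\<zeta>. 1 / cmod (1 - cnj \<zeta> * z) ^ p \<partial>\<mu>)" for p z and \<mu> :: "complex measure"
    by (subst integral_mult_right_zero[symmetric]) simp
  show ?thesis
  proof (rule that[of "\<lambda>N. xs N @ ys N @ us N" J])
    show "cmod a \<le> 1" if "a \<in> set (xs N @ ys N @ us N)" for N a
      using that xs1[rule_format, of N] ys1[rule_format, of a N] us1[rule_format, of a N] Z1[of a] by auto
    show "eventually (\<lambda>N. z \<notin> set (xs N @ ys N @ us N)) sequentially" if z: "z \<in> ball 0 1" "b z \<noteq> 0" for z
    proof -
      \<comment> \<open>The zeros that model the measures tend to the circle and leave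
        \<open>z\<close> behind; the true zeros avoid \<open>z\<close> since \<open>b z\<close> is
        nonzero.\<close>
      have "(\<lambda>N. 1 - 1 / real (Suc N)) \<longlonglongrightarrow> 1" by real_asymp
      then have "eventually (\<lambda>N. cmod z < 1 - 1 / real (Suc N)) sequentially"
        using z by (intro order_tendstoD) auto
      then show ?thesis
      proof eventually_elim
        case (elim N)
        then show ?case
          using xs1[rule_format, of N] ys1[rule_format, of z N] us1[rule_format, of z N] z(2) by (auto simp: zeros_D_def)
      qed
    qed
    show "(\<lambda>N. \<Sum>a\<leftarrow>xs N @ ys N @ us N. (1 - (cmod a)\<^sup>2) / cmod (1 - cnj a * z) ^ p) \<longlonglongrightarrow> J p z"
      if z: "z \<in> ball 0 1" for z p
      unfolding J_def using z Z1
      by (intro sum_list_append_tendsto xs2[rule_format] sum_fin ys2[rule_format] us2[rule_format]) (auto simp: power_le_one less_imp_le)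
    show "(\<lambda>N. \<Sum>a\<leftarrow>xs N @ ys N @ us N. - ln (cmod (blaschke_factor a z))) \<longlonglongrightarrow> - ln (cmod (b z))"
      if z: "z \<in> ball 0 1" "b z \<noteq> 0" for z
    proof -
      have z1: "cmod z < 1" using z by simp
      let ?A = "enn2real (\<integral>\<^sup>+ a. ennreal (of_nat (?m a) * (- ln (cmod (blaschke_factor a z)))) \<partial>count_space ?Z)"
      have lim: "(\<lambda>N. \<Sum>a\<leftarrow>xs N @ ys N @ us N. - ln (cmod (blaschke_factor a z)))
         \<longlonglongrightarrow> ?A + ((\<integral>\<zeta>. poisson z \<zeta> \<partial>\<nu>) + (\<integral>\<zeta>. poisson z \<zeta> \<partial>W))"
      proof (intro sum_list_append_tendsto xs2[rule_format] ys3[rule_format] us3[rule_format] z1)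
        show "0 \<le> - ln (cmod (blaschke_factor a z))" if "a \<in> ?Z" for a
          using Z1[OF that] z1 by (intro ln_nonneg) auto
      qed (rule parts_fin(1)[OF z])
      have en: "(\<integral>\<zeta>. poisson z \<zeta> \<partial>\<mu>) = enn2real (\<integral>\<^sup>+ \<zeta>. ennreal (poisson z \<zeta>) \<partial>\<mu>)" if "sets \<mu> = sets borel" for \<mu>
        using poisson_measurable poisson_nonneg z1
        by (intro integral_eq_nn_integral) (auto simp: measurable_cong_sets[OF that refl])
      have "ennreal (- ln (cmod (b z))) = ennreal (?A + ((\<integral>\<zeta>. poisson z \<zeta> \<partial>\<nu>) + (\<integral>\<zeta>. poisson z \<zeta> \<partial>W)))"
        unfolding formula[OF z] en[OF sets_\<nu>] en[OF sets_W]
        using parts_fin[OF z] by (simp add: add.assoc)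
      moreover have "0 \<le> ?A + ((\<integral>\<zeta>. poisson z \<zeta> \<partial>\<nu>) + (\<integral>\<zeta>. poisson z \<zeta> \<partial>W))"
        unfolding en[OF sets_\<nu>] en[OF sets_W] by simp
      moreover have "0 \<le> - ln (cmod (b z))"
      proof -
        have "b z \<in> ball 0 1" using img z(1) by blast
        then have "cmod (b z) < 1" by simp
        then show ?thesis using z by simp
      qed
      ultimately have "- ln (cmod (b z)) = ?A + ((\<integral>\<zeta>. poisson z \<zeta> \<partial>\<nu>) + (\<integral>\<zeta>. poisson z \<zeta> \<partial>W))"
        using ennreal_inj by blast
      then show ?thesis using lim by simp
    qed
    show "zero_boundary_sum b \<nu> p z \<le> ennreal (J p z)" if z: "z \<in> ball 0 1" for p z
      unfolding J_eq[OF z] J_def two by (intro ennreal_leI add_mono) (auto intro!: integral_nonneg)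
    show "ennreal (J p z) \<le> 2 * zero_boundary_sum b \<nu> p z" if z: "z \<in> ball 0 1" for p z
    proof -
      have "ennreal (J p z) \<le> ennreal (2 * (enn2real (\<integral>\<^sup>+ a. ennreal (of_nat (?m a) * ((1 - (cmod a)\<^sup>2) / cmod (1 - cnj a * z) ^ p)) \<partial>count_space ?Z)
      + ((\<integral>\<zeta>. 1 / cmod (1 - cnj \<zeta> * z) ^ p \<partial>\<nu>) + (\<integral>\<zeta>. 1 / cmod (1 - cnj \<zeta> * z) ^ p \<partial>W))))"
        unfolding J_def two by (intro ennreal_leI) simp
      then show ?thesis
        unfolding J_eq[OF z] by (simp add: ennreal_mult')
    qed
  qed
qed


text \<open>The logarithmic sums give convergence of the moduli only, and the phases may oscillate.
  A normal family argument fixes them along a subsequence up to one constant \<open>c\<close>, and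
  the locally uniform convergence carries all derivatives along.\<close>

theorem blaschke_approximation:
  assumes hol: "b holomorphic_on ball 0 1" and img: "b ` ball 0 1 \<subseteq> ball 0 1"
    and ne: "\<exists>z\<in>ball 0 1. b z \<noteq> 0" and sfm: "singular_factor_measure b \<nu>"
  obtains a n c J
  where "\<And>N i. cmod (a N i) \<le> 1" "cmod c = 1"
    "\<And>z j. z \<in> ball 0 1 \<Longrightarrow>
       (\<lambda>N::nat. c * (deriv ^^ j) (blaschke_prod (a N) (n N)) z) \<longlonglongrightarrow> (deriv ^^ j) b z"
    "\<And>z p. z \<in> ball 0 1 \<Longrightarrow> (\<lambda>N. blaschke_sum (a N) (n N) p z) \<longlonglongrightarrow> J p z"
    "\<And>z p. z \<in> ball 0 1 \<Longrightarrow> zero_boundary_sum b \<nu> p z \<le> ennreal (J p z)"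
    "\<And>z p. z \<in> ball 0 1 \<Longrightarrow> ennreal (J p z) \<le> 2 * zero_boundary_sum b \<nu> p z"
proof (rule blaschke_list_approximation[OF assms])
  fix xs :: "nat \<Rightarrow> complex list" and J
  assume xs1: "\<And>N a. a \<in> set (xs N) \<Longrightarrow> cmod a \<le> 1"
    and xs2: "\<And>z. z \<in> ball 0 1 \<Longrightarrow> b z \<noteq> 0 \<Longrightarrow> eventually (\<lambda>N. z \<notin> set (xs N)) sequentially"
    and xs3: "\<And>z p. z \<in> ball 0 1 \<Longrightarrow> (\<lambda>N. \<Sum>a\<leftarrow>xs N. (1 - (cmod a)\<^sup>2) / cmod (1 - cnj a * z) ^ p) \<longlonglongrightarrow> J p z"
    and xs4: "\<And>z. z \<in> ball 0 1 \<Longrightarrow> b z \<noteq> 0 \<Longrightarrow>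
       (\<lambda>N. \<Sum>a\<leftarrow>xs N. - ln (cmod (blaschke_factor a z))) \<longlonglongrightarrow> - ln (cmod (b z))"
    and J: "\<And>z p. z \<in> ball 0 1 \<Longrightarrow> zero_boundary_sum b \<nu> p z \<le> ennreal (J p z)"
      "\<And>z p. z \<in> ball 0 1 \<Longrightarrow> ennreal (J p z) \<le> 2 * zero_boundary_sum b \<nu> p z"
  \<comment> \<open>The default 0 keeps \<open>|a N i| <= 1\<close> valid for all indices; only the
    first \<open>n N\<close> of them enter the product.\<close>
  define a where "a N i = (if i < length (xs N) then xs N ! i else 0)" for N i
  define n where "n N = length (xs N)" for N
  have a1: "cmod (a N i) \<le> 1" for N i
    using xs1[OF nth_mem[of i "xs N"]] by (auto simp: a_def)
  have S: "blaschke_sum (a N) (n N) p z = (\<Sum>a\<leftarrow>xs N. (1 - (cmod a)\<^sup>2) / cmod (1 - cnj a * z) ^ p)" for N p z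
    unfolding blaschke_sum_def a_def n_def
    by (rule sum_list_nth_default[of "\<lambda>a. (1 - (cmod a)\<^sup>2) / cmod (1 - cnj a * z) ^ p"])
  have norm_lim: "(\<lambda>N. cmod (blaschke_prod (a N) (n N) z)) \<longlonglongrightarrow> cmod (b z)"
    if z: "z \<in> ball 0 1" "b z \<noteq> 0" for z
  proof -
    have "(\<lambda>N. exp (- (\<Sum>a\<leftarrow>xs N. - ln (cmod (blaschke_factor a z))))) \<longlonglongrightarrow> exp (- (- ln (cmod (b z))))"
      by (intro tendsto_intros xs4 z)
    moreover have "eventually (\<lambda>N. exp (- (\<Sum>a\<leftarrow>xs N. - ln (cmod (blaschke_factor a z))))
        = cmod (blaschke_prod (a N) (n N) z)) sequentially"
      using xs2[OF z]
    proof eventually_elim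
      case (elim N)
      have "blaschke_factor (a N i) z \<noteq> 0" if "i < n N" for i
      proof -
        have "z \<noteq> a N i" using elim that by (auto simp: a_def n_def)
        then show ?thesis
          using one_minus_cnj_mult_nonzero[OF a1, of z N i] z by (simp add: blaschke_factor_def)
      qed
      then have "cmod (blaschke_prod (a N) (n N) z) = exp (- (\<Sum>i<n N. - ln (cmod (blaschke_factor (a N i) z))))"
        by (rule norm_blaschke_prod_eq_exp)
      also have "(\<Sum>i<n N. - ln (cmod (blaschke_factor (a N i) z))) = (\<Sum>a\<leftarrow>xs N. - ln (cmod (blaschke_factor a z)))"
        unfolding a_def n_def by (rule sum_list_nth_default[of "\<lambda>a. - ln (cmod (blaschke_factor a z))"])
      finally show ?case ..
    qed
    ultimately have "(\<lambda>N. cmod (blaschke_prod (a N) (n N) z)) \<longlonglongrightarrow> exp (- (- ln (cmod (b z))))"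
      by (rule Lim_transform_eventually)
    then show ?thesis using z by simp
  qed
  let ?B = "\<lambda>N. blaschke_prod (a N) (n N)"
  have B_hol: "?B N holomorphic_on ball 0 1" for N
    using a1 by (intro blaschke_prod_holomorphic)
  obtain g r where g: "g holomorphic_on ball 0 1" and r: "strict_mono (r :: nat \<Rightarrow> nat)"
    and lim: "\<And>x. x \<in> ball 0 1 \<Longrightarrow> ((\<lambda>k. ?B (r k) x) \<longlongrightarrow> g x) sequentially"
    and unif: "\<And>K. \<lbrakk>compact K; K \<subseteq> ball 0 1\<rbrakk> \<Longrightarrow> uniform_limit K (?B \<circ> r) g sequentially"
  proof (rule Montel[of "ball 0 1" "range ?B" ?B])
    show "h holomorphic_on ball 0 1" if "h \<in> range ?B" for h
      using that B_hol by auto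
    show "\<exists>C. \<forall>h\<in>range ?B. \<forall>z\<in>K. cmod (h z) \<le> C" if "compact K" "K \<subseteq> ball 0 1" for K
      using that norm_blaschke_prod_le_1[OF a1] by (intro exI[of _ 1]) auto
  qed (auto intro: that)
  have "cmod (g z) = cmod (b z)" if z: "z \<in> ball 0 1" "b z \<noteq> 0" for z
  proof (rule LIMSEQ_unique)
    show "(\<lambda>k. cmod (?B (r k) z)) \<longlonglongrightarrow> cmod (g z)"
      by (intro tendsto_norm lim z)
    show "(\<lambda>k. cmod (?B (r k) z)) \<longlonglongrightarrow> cmod (b z)"
      using LIMSEQ_subseq_LIMSEQ[OF norm_lim[OF z] r] by (simp add: o_def)
  qed
  then obtain c where c: "cmod c = 1" "\<And>z. z \<in> ball 0 1 \<Longrightarrow> b z = c * g z"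
    using norm_eq_imp_unimodular_multiple[OF g hol ne] by metis
  show ?thesis
  proof (rule that[of "\<lambda>N. a (r N)" c "\<lambda>N. n (r N)" J])
    show "(\<lambda>N. c * (deriv ^^ j) (?B (r N)) z) \<longlonglongrightarrow> (deriv ^^ j) b z" if z: "z \<in> ball 0 1" for z j
    proof -
      have "(deriv ^^ j) b z = (deriv ^^ j) (\<lambda>z. c * g z) z"
        using hol g c z by (intro higher_deriv_transform_within_open[of _ "ball 0 1"] holomorphic_intros) auto
      also have "\<dots> = c * (deriv ^^ j) g z"
        using g z by (intro higher_deriv_cmult) auto
      finally have eq: "(deriv ^^ j) b z = c * (deriv ^^ j) g z" .
      obtain e where e: "0 < e" "cball z e \<subseteq> ball 0 1"
        using z open_contains_cball[of "ball 0 1"] by blast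
      have "uniform_limit (ball z e) (\<lambda>k. ?B (r k)) g sequentially"
        using unif[OF compact_cball e(2)] by (auto simp: o_def intro: uniform_limit_on_subset ball_subset_cball)
      moreover have "?B (r k) holomorphic_on ball z e" for k
        using B_hol by (rule holomorphic_on_subset) (use e ball_subset_cball in blast)
      ultimately have "(\<lambda>k. (deriv ^^ j) (?B (r k)) z) \<longlonglongrightarrow> (deriv ^^ j) g z"
        using e by (intro higher_deriv_complex_uniform_limit[where A = "ball z e"]) auto
      then show ?thesis unfolding eq by (intro tendsto_mult tendsto_const)
    qed
    show "(\<lambda>N. blaschke_sum (a (r N)) (n (r N)) p z) \<longlonglongrightarrow> J p z" if z: "z \<in> ball 0 1" for z p
      using LIMSEQ_subseq_LIMSEQ[OF xs3[OF z] r] by (simp add: S o_def)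
  qed (use a1 c J in auto)
qed

section \<open>Derivatives of the reproducing kernel\<close>

text \<open>The derivative of order \<open>q\<close> with respect to \<open>cnj w\<close> of the
  Szego kernel \<open>1 / (1 - cnj w * \<xi>)\<close>.\<close>

definition szego_deriv :: "nat \<Rightarrow> complex \<Rightarrow> complex \<Rightarrow> complex" where
  "szego_deriv q w \<xi> = fact q * \<xi> ^ q / (1 - cnj w * \<xi>) ^ Suc q"

text \<open>The derivative of orders \<open>j\<close> in \<open>z\<close> and \<open>l\<close> in
  \<open>cnj w\<close> of \<open>kb b w z\<close>; in H(b) it is the inner product of
  \<open>kd b l w\<close> with \<open>kd b j z\<close>.\<close>

definition kernel_deriv :: "(complex \<Rightarrow> complex) \<Rightarrow> nat \<Rightarrow> nat \<Rightarrow> complex \<Rightarrow> complex \<Rightarrow> complex" where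
  "kernel_deriv b j l z w = (deriv ^^ j) (kd b l w) z"

lemma szego_deriv_holomorphic:
  assumes "w \<in> ball 0 1"
  shows "szego_deriv q w holomorphic_on ball 0 1"
proof -
  have "1 - cnj w * z \<noteq> 0" if "z \<in> ball 0 1" for z
    using one_minus_cnj_mult_nonzero[of w z] assms that by auto
  then show ?thesis
    unfolding szego_deriv_def[abs_def] by (intro holomorphic_intros) auto
qed

text \<open>In the definition of \<open>kd\<close> the conjugate hides the dependence on
  \<open>\<xi>\<close>. Carrying out the derivative by the Leibniz rule and conjugating shows that
  it is holomorphic.\<close>

lemma kd_eq:
  assumes b: "b holomorphic_on ball 0 1" and w: "w \<in> ball 0 1" and x: "\<xi> \<in> ball 0 1"
  shows "kd b l w \<xi> = szego_deriv l w \<xi>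
     - (\<Sum>i = 0..l. of_nat (l choose i) * cnj ((deriv ^^ i) b w) * (b \<xi> * szego_deriv (l - i) w \<xi>))"
proof -
  let ?s = "\<lambda>\<eta>. 1 / (1 - cnj \<xi> * \<eta>)"
  have s: "?s holomorphic_on ball 0 1"
    using x by (intro inverse_one_minus_holomorphic) auto
  have ds: "(deriv ^^ q) ?s w = fact q * cnj \<xi> ^ q / (1 - cnj \<xi> * w) ^ Suc q" for q
    using one_minus_cnj_mult_nonzero[of \<xi> w] x w by (intro higher_deriv_inverse_one_minus) auto
  have cds: "cnj ((deriv ^^ q) ?s w) = szego_deriv q w \<xi>" for q
    unfolding ds szego_deriv_def by (simp add: mult.commute)
  have eq: "(\<lambda>\<eta>. (1 - b \<eta> * cnj (b \<xi>)) / (1 - \<eta> * cnj \<xi>)) = (\<lambda>\<eta>. ?s \<eta> - cnj (b \<xi>) * (b \<eta> * ?s \<eta>))"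
    by (simp add: fun_eq_iff diff_divide_distrib mult_ac)
  have "(deriv ^^ l) (\<lambda>\<eta>. ?s \<eta> - cnj (b \<xi>) * (b \<eta> * ?s \<eta>)) w
      = (deriv ^^ l) ?s w - (deriv ^^ l) (\<lambda>\<eta>. cnj (b \<xi>) * (b \<eta> * ?s \<eta>)) w"
    using s b w by (intro higher_deriv_diff[where S = "ball 0 1"] holomorphic_on_mult holomorphic_on_const) auto
  also have "(deriv ^^ l) (\<lambda>\<eta>. cnj (b \<xi>) * (b \<eta> * ?s \<eta>)) w = cnj (b \<xi>) * (deriv ^^ l) (\<lambda>\<eta>. b \<eta> * ?s \<eta>) w"
    using s b w by (intro higher_deriv_cmult[where A = "ball 0 1"] holomorphic_on_mult) auto
  also have "(deriv ^^ l) (\<lambda>\<eta>. b \<eta> * ?s \<eta>) w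
     = (\<Sum>i = 0..l. of_nat (l choose i) * (deriv ^^ i) b w * (deriv ^^ (l - i)) ?s w)"
    using s b w by (intro higher_deriv_mult[where S = "ball 0 1"]) auto
  finally show ?thesis
    unfolding kd_def eq
    by (simp only: complex_cnj_diff complex_cnj_mult cnj_sum complex_cnj_cnj complex_cnj_of_nat cds)
       (simp add: sum_distrib_left mult_ac)
qed

lemma kd_holomorphic:
  assumes b: "b holomorphic_on ball 0 1" and w: "w \<in> ball 0 1"
  shows "kd b l w holomorphic_on ball 0 1"
proof (rule holomorphic_transform)
  show "(\<lambda>\<xi>. szego_deriv l w \<xi>
     - (\<Sum>i = 0..l. of_nat (l choose i) * cnj ((deriv ^^ i) b w) * (b \<xi> * szego_deriv (l - i) w \<xi>)))
     holomorphic_on ball 0 1"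
    using b w by (intro holomorphic_intros szego_deriv_holomorphic)
qed (use kd_eq[OF b w] in auto)

text \<open>Only finitely many derivatives of \<open>b\<close> at \<open>z\<close> and
  \<open>w\<close> enter, polynomially and with their conjugates. Convergence of these derivatives
  thus suffices both for the limit of the approximating products and for the approach to the
  boundary.\<close>

lemma kernel_deriv_eq:
  assumes b: "b holomorphic_on ball 0 1" and w: "w \<in> ball 0 1" and z: "z \<in> ball 0 1"
  shows "kernel_deriv b j l z w = (deriv ^^ j) (szego_deriv l w) z
     - (\<Sum>i = 0..l. of_nat (l choose i) * cnj ((deriv ^^ i) b w)
        * (\<Sum>p = 0..j. of_nat (j choose p) * (deriv ^^ p) b z * (deriv ^^ (j - p)) (szego_deriv (l - i) w) z))"
proof -
  note hol = szego_deriv_holomorphic[OF w]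
  have "kernel_deriv b j l z w = (deriv ^^ j) (\<lambda>\<xi>. szego_deriv l w \<xi>
     - (\<Sum>i = 0..l. of_nat (l choose i) * cnj ((deriv ^^ i) b w) * (b \<xi> * szego_deriv (l - i) w \<xi>))) z"
    unfolding kernel_deriv_def using b z
    by (intro higher_deriv_transform_within_open[of _ "ball 0 1"] kd_holomorphic[OF b w]
         holomorphic_intros hol kd_eq[OF b w]) auto
  also have "\<dots> = (deriv ^^ j) (szego_deriv l w) z
     - (deriv ^^ j) (\<lambda>\<xi>. \<Sum>i = 0..l. of_nat (l choose i) * cnj ((deriv ^^ i) b w) * (b \<xi> * szego_deriv (l - i) w \<xi>)) z"
    using b z by (intro higher_deriv_diff[where S = "ball 0 1"] holomorphic_intros hol) auto
  also have "(deriv ^^ j) (\<lambda>\<xi>. \<Sum>i = 0..l. of_nat (l choose i) * cnj ((deriv ^^ i) b w) * (b \<xi> * szego_deriv (l - i) w \<xi>)) z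
    = (\<Sum>i = 0..l. (deriv ^^ j) (\<lambda>\<xi>. (of_nat (l choose i) * cnj ((deriv ^^ i) b w)) * (b \<xi> * szego_deriv (l - i) w \<xi>)) z)"
    using b z by (intro higher_deriv_sum[where S = "ball 0 1"] holomorphic_intros hol) auto
  also have "\<dots> = (\<Sum>i = 0..l. (of_nat (l choose i) * cnj ((deriv ^^ i) b w)) * (deriv ^^ j) (\<lambda>\<xi>. b \<xi> * szego_deriv (l - i) w \<xi>) z)"
    using b z by (intro sum.cong refl higher_deriv_cmult[where A = "ball 0 1"] holomorphic_on_mult hol) auto
  also have "\<dots> = (\<Sum>i = 0..l. of_nat (l choose i) * cnj ((deriv ^^ i) b w)
        * (\<Sum>p = 0..j. of_nat (j choose p) * (deriv ^^ p) b z * (deriv ^^ (j - p)) (szego_deriv (l - i) w) z))"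
    using b z by (intro sum.cong refl arg_cong2[where f = "(*)"] higher_deriv_mult[where S = "ball 0 1"] hol) auto
  finally show ?thesis .
qed

text \<open>The kernel does not see a unimodular factor, so the constant left over by the
  approximation is harmless.\<close>

lemma kd_unimodular_mult:
  assumes "cmod c = 1"
  shows "kd (\<lambda>z. c * b z) l w = kd b l w"
proof -
  have "c * cnj c = 1" using assms by (simp add: complex_norm_square[symmetric])
  then have "c * b \<eta> * cnj (c * b \<xi>) = b \<eta> * cnj (b \<xi>)" for \<eta> \<xi>
    by (simp add: mult_ac)
  then show ?thesis unfolding kd_def by presburger
qed

lemma kd_0: "kd b 0 w z = kb b w z"
  by (simp add: kd_def kb_def mult.commute)

lemma kb_cnj: "cnj (kb b w z) = kb b z w"
  by (simp add: kb_def mult.commute)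

lemma kb_diag: "kb b z z = of_real ((1 - (cmod (b z))\<^sup>2) / (1 - (cmod z)\<^sup>2))"
  by (simp only: kb_def of_real_divide of_real_diff of_real_1 complex_norm_square mult.commute)

section \<open>Kernel and Gram matrices of a finite Blaschke product\<close>

lemma kd_blaschke_prod:
  assumes a: "\<And>i. i < n \<Longrightarrow> cmod (a i) \<le> 1" and w: "w \<in> ball 0 1" and x: "\<xi> \<in> ball 0 1"
  shows "kd (blaschke_prod a n) l w \<xi>
    = (\<Sum>k<n. of_real (1 - (cmod (a k))\<^sup>2) * cnj ((deriv ^^ l) (blaschke_basis a k) w) * blaschke_basis a k \<xi>)"
proof -
  let ?B = "blaschke_prod a n"
  have B: "?B holomorphic_on ball 0 1" using a by (rule blaschke_prod_holomorphic)
  have e: "blaschke_basis a k holomorphic_on ball 0 1" if "k < n" for k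
    using a that by (intro blaschke_basis_holomorphic) auto
  have "(deriv ^^ l) (\<lambda>\<eta>. (1 - ?B \<eta> * cnj (?B \<xi>)) / (1 - \<eta> * cnj \<xi>)) w
     = (deriv ^^ l) (\<lambda>\<eta>. \<Sum>k<n. of_real (1 - (cmod (a k))\<^sup>2) * cnj (blaschke_basis a k \<xi>) * blaschke_basis a k \<eta>) w"
  proof (rule higher_deriv_transform_within_open[of _ "ball 0 1"])
    show "(\<lambda>\<eta>. (1 - ?B \<eta> * cnj (?B \<xi>)) / (1 - \<eta> * cnj \<xi>)) holomorphic_on ball 0 1"
      using one_minus_cnj_mult_nonzero[of \<xi>] x B by (intro holomorphic_intros) (auto simp: mult.commute)
    show "(\<lambda>\<eta>. \<Sum>k<n. of_real (1 - (cmod (a k))\<^sup>2) * cnj (blaschke_basis a k \<xi>) * blaschke_basis a k \<eta>) holomorphic_on ball 0 1"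
      using e by (intro holomorphic_intros) auto
    show "(1 - ?B \<eta> * cnj (?B \<xi>)) / (1 - \<eta> * cnj \<xi>)
      = (\<Sum>k<n. of_real (1 - (cmod (a k))\<^sup>2) * cnj (blaschke_basis a k \<xi>) * blaschke_basis a k \<eta>)" if "\<eta> \<in> ball 0 1" for \<eta>
      using blaschke_kernel_telescope[of n a \<eta> \<xi>] a x that by (simp add: mult_ac)
  qed (use w in auto)
  also have "\<dots> = (\<Sum>k<n. (deriv ^^ l) (\<lambda>\<eta>. of_real (1 - (cmod (a k))\<^sup>2) * cnj (blaschke_basis a k \<xi>) * blaschke_basis a k \<eta>) w)"
    using e w by (intro higher_deriv_sum[where S = "ball 0 1"] holomorphic_intros) auto
  also have "\<dots> = (\<Sum>k<n. of_real (1 - (cmod (a k))\<^sup>2) * cnj (blaschke_basis a k \<xi>) * (deriv ^^ l) (blaschke_basis a k) w)"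
    using e w by (intro sum.cong refl higher_deriv_cmult[where A = "ball 0 1"]) auto
  finally show ?thesis
    unfolding kd_def by (simp add: mult_ac)
qed

lemma kernel_deriv_blaschke_prod:
  assumes a: "\<And>i. i < n \<Longrightarrow> cmod (a i) \<le> 1" and w: "w \<in> ball 0 1" and z: "z \<in> ball 0 1"
  shows "kernel_deriv (blaschke_prod a n) j l z w = (\<Sum>k<n. of_real (1 - (cmod (a k))\<^sup>2)
     * (deriv ^^ j) (blaschke_basis a k) z * cnj ((deriv ^^ l) (blaschke_basis a k) w))"
proof -
  have B: "blaschke_prod a n holomorphic_on ball 0 1" using a by (rule blaschke_prod_holomorphic)
  have e: "blaschke_basis a k holomorphic_on ball 0 1" if "k < n" for k
    using a that by (intro blaschke_basis_holomorphic) auto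
  have "kernel_deriv (blaschke_prod a n) j l z w
    = (deriv ^^ j) (\<lambda>\<xi>. \<Sum>k<n. of_real (1 - (cmod (a k))\<^sup>2) * cnj ((deriv ^^ l) (blaschke_basis a k) w) * blaschke_basis a k \<xi>) z"
    unfolding kernel_deriv_def using e w z
    by (intro higher_deriv_transform_within_open[of _ "ball 0 1"] kd_holomorphic[OF B]
         holomorphic_intros kd_blaschke_prod a) auto
  also have "\<dots> = (\<Sum>k<n. (deriv ^^ j) (\<lambda>\<xi>. of_real (1 - (cmod (a k))\<^sup>2) * cnj ((deriv ^^ l) (blaschke_basis a k) w) * blaschke_basis a k \<xi>) z)"
    using e z by (intro higher_deriv_sum[where S = "ball 0 1"] holomorphic_intros) auto
  also have "\<dots> = (\<Sum>k<n. of_real (1 - (cmod (a k))\<^sup>2) * cnj ((deriv ^^ l) (blaschke_basis a k) w) * (deriv ^^ j) (blaschke_basis a k) z)"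
    using e z by (intro sum.cong refl higher_deriv_cmult[where A = "ball 0 1"]) auto
  finally show ?thesis by (simp add: mult_ac)
qed

text \<open>The energy of the first part is thus the value of the differentiated kernel on the
  diagonal, i.e. the squared norm of the kernel derivative for a finite product.\<close>

lemma kernel_deriv_blaschke_prod_diag:
  assumes a: "\<And>i. i < n \<Longrightarrow> cmod (a i) \<le> 1" and z: "z \<in> ball 0 1"
  shows "kernel_deriv (blaschke_prod a n) m m z z = of_real (blaschke_energy a n m z)"
proof -
  have "kernel_deriv (blaschke_prod a n) m m z z = (\<Sum>k<n. of_real (1 - (cmod (a k))\<^sup>2)
     * (deriv ^^ m) (blaschke_basis a k) z * cnj ((deriv ^^ m) (blaschke_basis a k) z))"
    using a z z by (rule kernel_deriv_blaschke_prod)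
  then show ?thesis
    by (simp add: complex_norm_square[symmetric] blaschke_energy_def mult.assoc del: of_real_diff)
qed

text \<open>A node \<open>(z, m)\<close> stands for the functional \<open>f \<mapsto> f^(m)(z)\<close>.\<close>
definition gram :: "(complex \<Rightarrow> complex) \<Rightarrow> (complex \<times> nat) set \<Rightarrow> (complex \<times> nat \<Rightarrow> complex)
    \<Rightarrow> (complex \<times> nat) set \<Rightarrow> (complex \<times> nat \<Rightarrow> complex) \<Rightarrow> complex" where
  "gram b S c T d = (\<Sum>x\<in>S. \<Sum>y\<in>T. c x * cnj (d y) * kernel_deriv b (snd x) (snd y) (fst x) (fst y))"

lemma gram_blaschke_prod:
  assumes a: "\<And>i. i < n \<Longrightarrow> cmod (a i) \<le> 1"
    and S: "fst ` S \<subseteq> ball 0 1" and T: "fst ` T \<subseteq> ball 0 1"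
  shows "gram (blaschke_prod a n) S c T d = (\<Sum>k<n. of_real (1 - (cmod (a k))\<^sup>2)
     * (\<Sum>x\<in>S. c x * (deriv ^^ snd x) (blaschke_basis a k) (fst x))
     * cnj (\<Sum>y\<in>T. d y * (deriv ^^ snd y) (blaschke_basis a k) (fst y)))"
proof -
  have "gram (blaschke_prod a n) S c T d = (\<Sum>x\<in>S. \<Sum>y\<in>T. \<Sum>k<n. of_real (1 - (cmod (a k))\<^sup>2)
     * (c x * (deriv ^^ snd x) (blaschke_basis a k) (fst x)) * cnj (d y * (deriv ^^ snd y) (blaschke_basis a k) (fst y)))"
    unfolding gram_def
  proof (intro sum.cong refl)
    fix x y assume "x \<in> S" "y \<in> T"
    then have "fst x \<in> ball 0 1" "fst y \<in> ball 0 1" using S T by auto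
    then show "c x * cnj (d y) * kernel_deriv (blaschke_prod a n) (snd x) (snd y) (fst x) (fst y)
      = (\<Sum>k<n. of_real (1 - (cmod (a k))\<^sup>2)
     * (c x * (deriv ^^ snd x) (blaschke_basis a k) (fst x)) * cnj (d y * (deriv ^^ snd y) (blaschke_basis a k) (fst y)))"
      using a by (subst kernel_deriv_blaschke_prod) (simp_all add: sum_distrib_left mult_ac)
  qed
  also have "\<dots> = (\<Sum>x\<in>S. \<Sum>k<n. \<Sum>y\<in>T. of_real (1 - (cmod (a k))\<^sup>2)
     * (c x * (deriv ^^ snd x) (blaschke_basis a k) (fst x)) * cnj (d y * (deriv ^^ snd y) (blaschke_basis a k) (fst y)))"
    by (intro sum.cong refl sum.swap)
  also have "\<dots> = (\<Sum>k<n. \<Sum>x\<in>S. \<Sum>y\<in>T. of_real (1 - (cmod (a k))\<^sup>2)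
     * (c x * (deriv ^^ snd x) (blaschke_basis a k) (fst x)) * cnj (d y * (deriv ^^ snd y) (blaschke_basis a k) (fst y)))"
    by (rule sum.swap)
  also have "\<dots> = (\<Sum>k<n. of_real (1 - (cmod (a k))\<^sup>2)
     * (\<Sum>x\<in>S. c x * (deriv ^^ snd x) (blaschke_basis a k) (fst x))
     * cnj (\<Sum>y\<in>T. d y * (deriv ^^ snd y) (blaschke_basis a k) (fst y)))"
    by (simp only: cnj_sum sum_product mult.assoc) (simp only: sum_distrib_left)
  finally show ?thesis .
qed

lemma weighted_Cauchy_Schwarz:
  fixes x y :: "nat \<Rightarrow> complex"
  assumes s: "\<And>k. k < n \<Longrightarrow> 0 \<le> s k"
  shows "(cmod (\<Sum>k<n. of_real (s k) * x k * cnj (y k)))\<^sup>2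
    \<le> Re (\<Sum>k<n. of_real (s k) * x k * cnj (x k)) * Re (\<Sum>k<n. of_real (s k) * y k * cnj (y k))"
proof -
  have sq: "Re (\<Sum>k<n. of_real (s k) * x k * cnj (x k)) = (\<Sum>k<n. (sqrt (s k) * cmod (x k))\<^sup>2)" for x
    unfolding Re_sum using s
    by (intro sum.cong refl) (simp add: mult.assoc complex_norm_square[symmetric] power_mult_distrib)
  have "cmod (\<Sum>k<n. of_real (s k) * x k * cnj (y k)) \<le> (\<Sum>k<n. (sqrt (s k) * cmod (x k)) * (sqrt (s k) * cmod (y k)))"
  proof (rule sum_norm_le)
    fix k assume "k \<in> {..<n}"
    then have "sqrt (s k) * sqrt (s k) = s k" "0 \<le> s k" using s by auto
    then have "(sqrt (s k) * cmod (x k)) * (sqrt (s k) * cmod (y k)) = s k * cmod (x k) * cmod (y k)"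
      by (metis mult.assoc mult.commute)
    moreover have "cmod (of_real (s k) * x k * cnj (y k)) = s k * cmod (x k) * cmod (y k)"
      using \<open>0 \<le> s k\<close> by (simp add: norm_mult)
    ultimately show "cmod (of_real (s k) * x k * cnj (y k)) \<le> (sqrt (s k) * cmod (x k)) * (sqrt (s k) * cmod (y k))"
      by (simp only: order_refl)
  qed
  then have "(cmod (\<Sum>k<n. of_real (s k) * x k * cnj (y k)))\<^sup>2
     \<le> (\<Sum>k<n. (sqrt (s k) * cmod (x k)) * (sqrt (s k) * cmod (y k)))\<^sup>2"
    by (intro power_mono) auto
  also have "\<dots> \<le> (\<Sum>k<n. (sqrt (s k) * cmod (x k))\<^sup>2) * (\<Sum>k<n. (sqrt (s k) * cmod (y k))\<^sup>2)"
    by (rule Cauchy_Schwarz_ineq_sum)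
  finally show ?thesis unfolding sq .
qed

text \<open>The expansion represents the Gram form as a weighted Euclidean inner product on vectors
  of length \<open>n\<close>, with nonnegative weights. These two inequalities no longer mention
  \<open>n\<close>, so they can be carried over to \<open>b\<close>.\<close>

lemma gram_blaschke_prod_facts:
  assumes a: "\<And>i. i < n \<Longrightarrow> cmod (a i) \<le> 1"
    and S: "fst ` S \<subseteq> ball 0 1" and T: "fst ` T \<subseteq> ball 0 1"
  defines "B \<equiv> blaschke_prod a n"
  shows "(cmod (gram B S c T d))\<^sup>2 \<le> Re (gram B S c S c) * Re (gram B T d T d)"
    and "0 \<le> Re (gram B S c S c)"
proof -
  have s: "0 \<le> 1 - (cmod (a k))\<^sup>2" if "k < n" for k using a[OF that] by (simp add: power_le_one)
  note expand = gram_blaschke_prod[of n a, OF _ S T] gram_blaschke_prod[of n a, OF _ S S]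
    gram_blaschke_prod[of n a, OF _ T T]
  show "(cmod (gram B S c T d))\<^sup>2 \<le> Re (gram B S c S c) * Re (gram B T d T d)"
    using s weighted_Cauchy_Schwarz[of n "\<lambda>k. 1 - (cmod (a k))\<^sup>2"] a
    by (simp only: B_def expand)
  have "0 \<le> Re (of_real r * x * cnj x)" if "0 \<le> r" for r x
    using that by (simp add: mult.assoc complex_mult_cnj)
  then have "0 \<le> Re (\<Sum>k<n. of_real (1 - (cmod (a k))\<^sup>2)
     * (\<Sum>x\<in>S. c x * (deriv ^^ snd x) (blaschke_basis a k) (fst x))
     * cnj (\<Sum>y\<in>S. c y * (deriv ^^ snd y) (blaschke_basis a k) (fst y)))"
    unfolding Re_sum using s by (intro sum_nonneg) blast
  then show "0 \<le> Re (gram B S c S c)"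
    using a by (simp only: B_def expand)
qed

section \<open>Passage from finite Blaschke products to \<open>b\<close>\<close>

locale blaschke_limit =
  fixes b :: "complex \<Rightarrow> complex" and a :: "nat \<Rightarrow> nat \<Rightarrow> complex" and n :: "nat \<Rightarrow> nat"
    and \<gamma> :: complex and J :: "nat \<Rightarrow> complex \<Rightarrow> real"
  assumes b_holomorphic: "b holomorphic_on ball 0 1" and b_image: "b ` ball 0 1 \<subseteq> ball 0 1"
    and a_le_1: "cmod (a N i) \<le> 1" and \<gamma>_1: "cmod \<gamma> = 1"
    and b_limit: "z \<in> ball 0 1 \<Longrightarrow>
       (\<lambda>N. \<gamma> * (deriv ^^ j) (blaschke_prod (a N) (n N)) z) \<longlonglongrightarrow> (deriv ^^ j) b z"
    and J_limit: "z \<in> ball 0 1 \<Longrightarrow> (\<lambda>N. blaschke_sum (a N) (n N) p z) \<longlonglongrightarrow> J p z"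
begin

abbreviation "B N \<equiv> blaschke_prod (a N) (n N)"

lemma b_lt_1: "z \<in> ball 0 1 \<Longrightarrow> cmod (b z) < 1"
  using b_image by (auto simp: subset_iff)

lemma kernel_deriv_limit:
  assumes w: "w \<in> ball 0 1" and z: "z \<in> ball 0 1"
  shows "(\<lambda>N. kernel_deriv (B N) j l z w) \<longlonglongrightarrow> kernel_deriv b j l z w"
proof -
  have B: "B N holomorphic_on ball 0 1" for N
    using a_le_1 by (intro blaschke_prod_holomorphic)
  have cB: "(\<lambda>z. \<gamma> * B N z) holomorphic_on ball 0 1" for N
    using B by (intro holomorphic_intros)
  have kd_cB: "kernel_deriv (B N) j l z w = kernel_deriv (\<lambda>z. \<gamma> * B N z) j l z w" for N
    by (simp add: kernel_deriv_def kd_unimodular_mult[OF \<gamma>_1])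
  have dcB: "(deriv ^^ i) (\<lambda>z. \<gamma> * B N z) x = \<gamma> * (deriv ^^ i) (B N) x" if "x \<in> ball 0 1" for i x N
    using B that by (intro higher_deriv_cmult[where A = "ball 0 1"]) auto
  show ?thesis
    unfolding kd_cB kernel_deriv_eq[OF cB w z] kernel_deriv_eq[OF b_holomorphic w z] dcB[OF z] dcB[OF w]
    by (intro tendsto_intros b_limit w z)
qed

lemma gram_limit:
  assumes "fst ` S \<subseteq> ball 0 1" "fst ` T \<subseteq> ball 0 1"
  shows "(\<lambda>N. gram (B N) S x T y) \<longlonglongrightarrow> gram b S x T y"
  unfolding gram_def using assms by (intro tendsto_intros kernel_deriv_limit) auto

lemma gram_Cauchy_Schwarz:
  assumes "fst ` S \<subseteq> ball 0 1" "fst ` T \<subseteq> ball 0 1"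
  shows "(cmod (gram b S x T y))\<^sup>2 \<le> Re (gram b S x S x) * Re (gram b T y T y)"
proof (rule LIMSEQ_le)
  show "(\<lambda>N. (cmod (gram (B N) S x T y))\<^sup>2) \<longlonglongrightarrow> (cmod (gram b S x T y))\<^sup>2"
    by (intro tendsto_intros gram_limit assms)
  show "(\<lambda>N. Re (gram (B N) S x S x) * Re (gram (B N) T y T y)) \<longlonglongrightarrow> Re (gram b S x S x) * Re (gram b T y T y)"
    by (intro tendsto_intros gram_limit assms)
qed (use gram_blaschke_prod_facts(1)[OF a_le_1 assms] in auto)

lemma gram_nonneg:
  assumes "fst ` S \<subseteq> ball 0 1"
  shows "0 \<le> Re (gram b S x S x)"
proof (rule LIMSEQ_le_const)
  show "(\<lambda>N. Re (gram (B N) S x S x)) \<longlonglongrightarrow> Re (gram b S x S x)"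
    by (intro tendsto_intros gram_limit assms)
qed (use gram_blaschke_prod_facts(2)[OF a_le_1 assms assms] in auto)

text \<open>The squared norm of \<open>kd b m z\<close>, as \<open>hb_norm_kd\<close> shows later;
  the value under \<open>Re\<close> is already real by \<open>kernel_deriv_diag\<close>.\<close>

definition K :: "nat \<Rightarrow> complex \<Rightarrow> real" where
  "K m z = Re (kernel_deriv b m m z z)"

lemma energy_limit:
  assumes "z \<in> ball 0 1"
  shows "(\<lambda>N. blaschke_energy (a N) (n N) m z) \<longlonglongrightarrow> K m z"
  using tendsto_Re[OF kernel_deriv_limit[OF assms assms, of m m]]
  by (simp add: kernel_deriv_blaschke_prod_diag[OF a_le_1 assms] K_def)

lemma kernel_deriv_diag:
  assumes "z \<in> ball 0 1"
  shows "kernel_deriv b m m z z = of_real (K m z)"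
  by (rule LIMSEQ_unique[OF kernel_deriv_limit[OF assms assms]])
     (simp only: kernel_deriv_blaschke_prod_diag[OF a_le_1 assms] tendsto_of_real[OF energy_limit[OF assms]])

lemma K_nonneg: "z \<in> ball 0 1 \<Longrightarrow> 0 \<le> K m z"
  using gram_nonneg[of "{(z, m)}" "\<lambda>_. 1"] by (simp add: gram_def K_def)

lemma kernel_deriv_Cauchy_Schwarz:
  assumes "z \<in> ball 0 1" "w \<in> ball 0 1"
  shows "(cmod (kernel_deriv b j l z w))\<^sup>2 \<le> K j z * K l w"
  using gram_Cauchy_Schwarz[of "{(z, j)}" "{(w, l)}" "\<lambda>_. 1" "\<lambda>_. 1"] assms
  by (simp add: gram_def K_def)

lemma K_0: "z \<in> ball 0 1 \<Longrightarrow> K 0 z = (1 - (cmod (b z))\<^sup>2) / (1 - (cmod z)\<^sup>2)"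
  by (simp add: K_def kernel_deriv_def kd_0 kb_diag del: of_real_divide of_real_diff of_real_power)

lemma J_nonneg: "z \<in> ball 0 1 \<Longrightarrow> 0 \<le> J p z"
  using blaschke_sum_nonneg[OF a_le_1] by (intro LIMSEQ_le_const[OF J_limit]) auto

lemma J_exponent_le:
  assumes "z \<in> ball 0 1" "p \<le> q"
  shows "J p z \<le> 2 ^ (q - p) * J q z"
proof (rule LIMSEQ_le[OF J_limit])
  show "(\<lambda>N. 2 ^ (q - p) * blaschke_sum (a N) (n N) q z) \<longlonglongrightarrow> 2 ^ (q - p) * J q z"
    by (intro tendsto_intros J_limit assms)
qed (use assms blaschke_sum_exponent_le[OF a_le_1] in auto)

text \<open>Termwise for the approximating sums. The comparison is assumed for all \<open>v\<close>
  in the closed disk because it has to cover the zeros of all approximating products at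
  once.\<close>

lemma J_le:
  assumes z: "z \<in> ball 0 1" and w: "w \<in> ball 0 1" and \<kappa>: "0 \<le> \<kappa>"
    and le: "\<And>v. cmod v \<le> 1 \<Longrightarrow> cmod (1 - cnj v * w) \<le> \<kappa> * cmod (1 - cnj v * z)"
  shows "J p z \<le> \<kappa> ^ p * J p w"
proof (rule LIMSEQ_le[OF J_limit])
  show "(\<lambda>N. \<kappa> ^ p * blaschke_sum (a N) (n N) p w) \<longlonglongrightarrow> \<kappa> ^ p * J p w"
    by (intro tendsto_intros J_limit w)
  have "blaschke_sum (a N) (n N) p z \<le> \<kappa> ^ p * blaschke_sum (a N) (n N) p w" for N
    unfolding blaschke_sum_def sum_distrib_left
  proof (rule sum_mono)
    fix i
    let ?s = "1 - (cmod (a N i))\<^sup>2" and ?Z = "cmod (1 - cnj (a N i) * z)" and ?W = "cmod (1 - cnj (a N i) * w)"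
    have s: "0 \<le> ?s" using a_le_1 by (simp add: power_le_one)
    have Z: "0 < ?Z" "0 < ?W" using norm_one_minus_cnj_mult_pos[OF a_le_1] z w by auto
    have "?W ^ p \<le> (\<kappa> * ?Z) ^ p" using le[OF a_le_1] by (intro power_mono) auto
    then have "?s * ?W ^ p \<le> ?s * (\<kappa> ^ p * ?Z ^ p)"
      using s by (intro mult_left_mono) (auto simp: power_mult_distrib)
    then show "?s / ?Z ^ p \<le> \<kappa> ^ p * (?s / ?W ^ p)"
      using Z by (simp add: field_simps)
  qed
  then show "\<exists>N0. \<forall>N\<ge>N0. blaschke_sum (a N) (n N) p z \<le> \<kappa> ^ p * blaschke_sum (a N) (n N) p w" by auto
qed (use z in auto)

lemma eventually_le_of_limit:
  fixes f :: "nat \<Rightarrow> real"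
  assumes "f \<longlonglongrightarrow> l" "l \<le> M"
  shows "eventually (\<lambda>N. f N \<le> M + 1) sequentially"
  using order_tendstoD(2)[OF assms(1), of "M + 1"] assms(2) by (auto elim: eventually_mono)

text \<open>A single term of the sum of order 2 is at most the whole sum, which the sum of order
  \<open>p\<close> dominates; if \<open>1 - |z|^2\<close> is small enough, every factor has modulus
  at least 1/2. Passing from the limit to the approximants costs the 1 in
  \<open>M + 1\<close>.\<close>

lemma away_from_zeros_eventually:
  assumes z: "z \<in> ball 0 1" and p: "2 \<le> p" and J: "J p z \<le> M"
    and small: "(1 - (cmod z)\<^sup>2) * (2 ^ (p - 2) * (M + 1)) \<le> 3/4"
  shows "eventually (\<lambda>N. away_from_zeros (a N) (n N) z \<and> blaschke_sum (a N) (n N) p z \<le> M + 1) sequentially"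
  using eventually_le_of_limit[OF J_limit[OF z] J]
proof eventually_elim
  case (elim N)
  have z1: "cmod z < 1" using z by simp
  have zz: "0 \<le> 1 - (cmod z)\<^sup>2" using z1 by (simp add: power_le_one)
  have "1/2 \<le> cmod (blaschke_factor (a N i) z)" if i: "i < n N" for i
  proof (rule norm_blaschke_factor_ge_half[OF a_le_1 z1])
    have "(1 - (cmod (a N i))\<^sup>2) / (cmod (1 - cnj (a N i) * z))\<^sup>2 \<le> blaschke_sum (a N) (n N) 2 z"
      unfolding blaschke_sum_def using i a_le_1
      by (intro member_le_sum divide_nonneg_nonneg) (auto simp: power_le_one)
    also have "\<dots> \<le> 2 ^ (p - 2) * blaschke_sum (a N) (n N) p z"
      using a_le_1 z1 p by (rule blaschke_sum_exponent_le)
    also have "\<dots> \<le> 2 ^ (p - 2) * (M + 1)" using elim by simp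
    finally have "(1 - (cmod z)\<^sup>2) * ((1 - (cmod (a N i))\<^sup>2) / (cmod (1 - cnj (a N i) * z))\<^sup>2)
        \<le> (1 - (cmod z)\<^sup>2) * (2 ^ (p - 2) * (M + 1))"
      using zz by (rule mult_left_mono)
    then show "(1 - (cmod z)\<^sup>2) * ((1 - (cmod (a N i))\<^sup>2) / (cmod (1 - cnj (a N i) * z))\<^sup>2) \<le> 3/4"
      using small by (rule order_trans)
  qed
  then show ?case
    using elim a_le_1 z1 by (auto simp: away_from_zeros_def)
qed

lemma K_bound:
  "\<exists>C. \<forall>z\<in>ball 0 1. J (2*m+2) z \<le> M \<longrightarrow> (1 - (cmod z)\<^sup>2) * (2 ^ (2*m) * (M + 1)) \<le> 3/4 \<longrightarrow> K m z \<le> C"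
proof -
  obtain C where C: "\<And>a n z. away_from_zeros a n z \<Longrightarrow> blaschke_sum a n (2*m+2) z \<le> M + 1
     \<Longrightarrow> blaschke_energy a n m z \<le> C"
    using blaschke_energy_bound[of m "M + 1"] by metis
  have "K m z \<le> C" if z: "z \<in> ball 0 1" and J: "J (2*m+2) z \<le> M"
    and small: "(1 - (cmod z)\<^sup>2) * (2 ^ (2*m) * (M + 1)) \<le> 3/4" for z
    using away_from_zeros_eventually[OF z _ J] small
    by (intro tendsto_upperbound[OF energy_limit[OF z]]) (auto elim!: eventually_mono intro!: C)
  then show ?thesis by blast
qed

text \<open>The order \<open>2*m+1\<close> is the largest that the exponent \<open>2*m+2\<close>
  controls. It exceeds \<open>m\<close>, which later gives Lipschitz bounds for all derivatives up
  to order \<open>m\<close>.\<close>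

lemma deriv_b_bound:
  "\<exists>C. \<forall>z\<in>ball 0 1. \<forall>j\<le>2*m+1. J (2*m+2) z \<le> M \<longrightarrow> (1 - (cmod z)\<^sup>2) * (2 ^ (2*m) * (M + 1)) \<le> 3/4
     \<longrightarrow> cmod ((deriv ^^ j) b z) \<le> C"
proof -
  obtain C where "\<forall>i\<le>2*m+1. \<forall>a n z k. away_from_zeros a n z \<longrightarrow> blaschke_sum a n (2*m+2) z \<le> M + 1 \<longrightarrow> k \<le> n
     \<longrightarrow> cmod ((deriv ^^ i) (blaschke_prod a k) z) \<le> C"
    using blaschke_prod_higher_deriv_bound[of "2*m+1" "2*m+2" "M + 1"] by fastforce
  note C = this[rule_format]
  have "cmod ((deriv ^^ j) b z) \<le> C" if z: "z \<in> ball 0 1" and j: "j \<le> 2*m+1" and J: "J (2*m+2) z \<le> M"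
    and small: "(1 - (cmod z)\<^sup>2) * (2 ^ (2*m) * (M + 1)) \<le> 3/4" for z j
  proof (rule tendsto_upperbound[OF tendsto_norm[OF b_limit[OF z, of j]]])
    show "eventually (\<lambda>N. cmod (\<gamma> * (deriv ^^ j) (B N) z) \<le> C) sequentially"
      using away_from_zeros_eventually[OF z _ J] small j
      by (auto simp: norm_mult \<gamma>_1 elim!: eventually_mono intro!: C)
  qed auto
  then show ?thesis by blast
qed

text \<open>The strict inequality \<open>1/2 < |b z|\<close> passes to the approximating products
  from some index on.\<close>

lemma J_bound:
  "\<exists>C. \<forall>z\<in>ball 0 1. 1/2 < cmod (b z) \<longrightarrow> (\<forall>j\<le>m. K j z \<le> M) \<longrightarrow> J (2*m+2) z \<le> C"
proof -
  obtain C where C: "\<And>a n z. \<forall>i<n. cmod (a i) \<le> 1 \<Longrightarrow> cmod z < 1 \<Longrightarrow> 1/2 \<le> cmod (blaschke_prod a n z)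
     \<Longrightarrow> \<forall>j\<le>m. blaschke_energy a n j z \<le> M + 1 \<Longrightarrow> blaschke_sum a n (2*m+2) z \<le> C"
    using blaschke_sum_bound[of m "M + 1"] by metis
  have "J (2*m+2) z \<le> C" if z: "z \<in> ball 0 1" and half: "1/2 < cmod (b z)" and K: "\<forall>j\<le>m. K j z \<le> M" for z
  proof (rule tendsto_upperbound[OF J_limit[OF z]])
    have "eventually (\<lambda>N. 1/2 < cmod (\<gamma> * (deriv ^^ 0) (B N) z)) sequentially"
      using half by (intro order_tendstoD(1)[OF tendsto_norm[OF b_limit[OF z]]]) simp
    moreover have "eventually (\<lambda>N. \<forall>j\<in>{..m}. blaschke_energy (a N) (n N) j z \<le> M + 1) sequentially"
      using K by (intro eventually_ball_finite ballI eventually_le_of_limit[OF energy_limit[OF z]]) auto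
    ultimately show "eventually (\<lambda>N. blaschke_sum (a N) (n N) (2*m+2) z \<le> C) sequentially"
    proof eventually_elim
      case (elim N)
      then show ?case using a_le_1 z by (intro C) (auto simp: norm_mult \<gamma>_1)
    qed
  qed auto
  then show ?thesis by blast
qed

end

section \<open>The space H(b)\<close>

definition hb_form :: "(complex \<Rightarrow> complex) \<Rightarrow> complex set \<Rightarrow> (complex \<Rightarrow> complex) \<Rightarrow> (complex \<Rightarrow> complex) \<Rightarrow> complex" where
  "hb_form b S c d = (\<Sum>z\<in>S. \<Sum>w\<in>S. c z * cnj (d w) * kb b w z)"

text \<open>The conjugates make \<open>\<Sum>z\<in>S. d z * f z\<close> the inner product of
  \<open>f\<close> with this function, whose squared norm is \<open>hb_form b S d d\<close>.\<close>

definition kernel_comb :: "(complex \<Rightarrow> complex) \<Rightarrow> complex set \<Rightarrow> (complex \<Rightarrow> complex) \<Rightarrow> complex \<Rightarrow> complex" where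
  "kernel_comb b S d z = (\<Sum>w\<in>S. cnj (d w) * kb b w z)"

lemma hb_form_alt: "hb_form b S c d = (\<Sum>z\<in>S. c z * kernel_comb b S d z)"
  by (simp add: hb_form_def kernel_comb_def sum_distrib_left mult.assoc)

text \<open>Coefficient functions on a finite set of points replace the finite families in the definition
  of \<open>hb_dom\<close>, where points may repeat.\<close>
lemma hb_dom_iff:
  "hb_dom b C f \<longleftrightarrow> (\<forall>S c. finite S \<longrightarrow> S \<subseteq> ball 0 1 \<longrightarrow>
     (cmod (\<Sum>z\<in>S. c z * f z))\<^sup>2 \<le> C * Re (hb_form b S c c))"
proof (intro iffI allI impI)
  fix S :: "complex set" and c :: "complex \<Rightarrow> complex" assume h: "hb_dom b C f" and S: "finite S" "S \<subseteq> ball 0 1"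
  obtain h where h': "bij_betw h {0..<card S} S" using ex_bij_betw_nat_finite[OF S(1)] by blast
  then have bij: "bij_betw h {..<card S} S" by (simp add: atLeast0LessThan)
  have "(cmod (\<Sum>i<card S. c (h i) * f (h i)))\<^sup>2
      \<le> C * Re (\<Sum>i<card S. \<Sum>j<card S. c (h i) * cnj (c (h j)) * kb b (h j) (h i))"
  proof -
    have "h i \<in> ball 0 1" if "i < card S" for i
    proof -
      have "h i \<in> S" using bij that by (auto simp: bij_betw_def)
      then show ?thesis using S(2) by blast
    qed
    then show ?thesis
      using h[unfolded hb_dom_def, rule_format, of "card S" h "\<lambda>i. c (h i)"] by blast
  qed
  moreover have "(\<Sum>i<card S. c (h i) * f (h i)) = (\<Sum>z\<in>S. c z * f z)"
    using sum.reindex_bij_betw[OF bij, of "\<lambda>z. c z * f z"] by simp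
  moreover have "(\<Sum>i<card S. \<Sum>j<card S. c (h i) * cnj (c (h j)) * kb b (h j) (h i)) = hb_form b S c c"
    unfolding hb_form_def
    using sum.reindex_bij_betw[OF bij, of "\<lambda>z. \<Sum>w\<in>S. c z * cnj (c w) * kb b w z"]
      sum.reindex_bij_betw[OF bij, of "\<lambda>w. c z * cnj (c w) * kb b w z" for z] by simp
  ultimately show "(cmod (\<Sum>z\<in>S. c z * f z))\<^sup>2 \<le> C * Re (hb_form b S c c)" by simp
next
  assume R: "\<forall>S c. finite S \<longrightarrow> S \<subseteq> ball 0 1 \<longrightarrow> (cmod (\<Sum>z\<in>S. c z * f z))\<^sup>2 \<le> C * Re (hb_form b S c c)"
  show "hb_dom b C f"
    unfolding hb_dom_def
  proof (intro allI impI)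
    fix n :: nat and zs cs :: "nat \<Rightarrow> complex" assume zs: "\<forall>i<n. zs i \<in> ball 0 1"
    define S where "S = zs ` {..<n}"
    define c where "c z = (\<Sum>i\<in>{i \<in> {..<n}. zs i = z}. cs i)" for z
    have T: "(\<Sum>i<n. cs i * F (zs i)) = (\<Sum>z\<in>S. c z * F z)" for F
    proof -
      have "(\<Sum>i<n. cs i * F (zs i)) = (\<Sum>z\<in>S. \<Sum>i\<in>{i \<in> {..<n}. zs i = z}. cs i * F (zs i))"
        unfolding S_def by (rule sum.image_gen) simp
      also have "\<dots> = (\<Sum>z\<in>S. c z * F z)"
        unfolding c_def sum_distrib_right by (intro sum.cong refl) auto
      finally show ?thesis .
    qed
    have inner: "(\<Sum>j<n. cnj (cs j) * kb b (zs j) x) = kernel_comb b S c x" for x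
    proof -
      have "(\<Sum>j<n. cnj (cs j) * kb b (zs j) x) = cnj (\<Sum>j<n. cs j * cnj (kb b (zs j) x))" by simp
      also have "\<dots> = cnj (\<Sum>w\<in>S. c w * cnj (kb b w x))"
        unfolding T[of "\<lambda>w. cnj (kb b w x)"] ..
      finally show ?thesis by (simp add: kernel_comb_def)
    qed
    have "(\<Sum>i<n. \<Sum>j<n. cs i * cnj (cs j) * kb b (zs j) (zs i)) = (\<Sum>i<n. cs i * kernel_comb b S c (zs i))"
      by (simp only: inner[symmetric] sum_distrib_left mult.assoc)
    also have "\<dots> = hb_form b S c c" unfolding hb_form_alt by (rule T)
    finally show "(cmod (\<Sum>i<n. cs i * f (zs i)))\<^sup>2
       \<le> C * Re (\<Sum>i<n. \<Sum>j<n. cs i * cnj (cs j) * kb b (zs j) (zs i))"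
      unfolding T[of f]
    proof (simp only:)
      have "finite S" "S \<subseteq> ball 0 1" using zs by (auto simp: S_def)
      then show "(cmod (\<Sum>z\<in>S. c z * f z))\<^sup>2 \<le> C * Re (hb_form b S c c)"
        using R by blast
    qed
  qed
qed

lemma hb_form_cnj: "cnj (hb_form b S c d) = hb_form b S d c"
  unfolding hb_form_def
  by (subst sum.swap) (simp add: kb_cnj mult_ac)

lemma hb_form_add:
  "hb_form b S (\<lambda>z. s * d z + t * e z) (\<lambda>z. s * d z + t * e z)
    = s * cnj s * hb_form b S d d + s * cnj t * hb_form b S d e + t * cnj s * hb_form b S e d
      + t * cnj t * hb_form b S e e"
  unfolding hb_form_def sum_distrib_left sum.distrib[symmetric]
  by (intro sum.cong refl) (simp add: algebra_simps)

lemma hb_form_scale: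
  "hb_form b S (\<lambda>z. s * d z) (\<lambda>z. s * d z) = s * cnj s * hb_form b S d d"
  unfolding hb_form_def sum_distrib_left
  by (intro sum.cong refl) (simp add: algebra_simps)

lemma sum_extend_zero:
  fixes f :: "'a \<Rightarrow> complex"
  assumes "finite U" "S \<subseteq> U"
  shows "(\<Sum>z\<in>U. (if z \<in> S then d z else 0) * f z) = (\<Sum>z\<in>S. d z * f z)"
  using assms by (intro sum.mono_neutral_cong_right) auto

lemma kernel_comb_extend:
  assumes "finite U" "S \<subseteq> U"
  shows "kernel_comb b U (\<lambda>z. if z \<in> S then d z else 0) = kernel_comb b S d"
proof
  fix x
  have "(\<Sum>w\<in>U. cnj (if w \<in> S then d w else 0) * kb b w x)
      = (\<Sum>w\<in>U. (if w \<in> S then cnj (d w) else 0) * kb b w x)"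
    by (intro sum.cong) auto
  then show "kernel_comb b U (\<lambda>z. if z \<in> S then d z else 0) x = kernel_comb b S d x"
    unfolding kernel_comb_def sum_extend_zero[OF assms] .
qed

lemma hb_form_extend:
  assumes "finite U" "S \<subseteq> U"
  shows "hb_form b U (\<lambda>z. if z \<in> S then d z else 0) (\<lambda>z. if z \<in> S then d z else 0) = hb_form b S d d"
  unfolding hb_form_alt kernel_comb_extend[OF assms] by (rule sum_extend_zero[OF assms])

lemma kernel_comb_holomorphic:
  assumes "b holomorphic_on ball 0 1" "S \<subseteq> ball 0 1"
  shows "kernel_comb b S d holomorphic_on ball 0 1"
proof -
  have "(\<lambda>z. kb b w z) holomorphic_on ball 0 1" if "w \<in> S" for w
    unfolding kd_0[symmetric] using assms that by (intro kd_holomorphic) auto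
  then show ?thesis
    unfolding kernel_comb_def[abs_def] by (intro holomorphic_intros)
qed

section \<open>Calculus of admissible constants in H(b)\<close>

context blaschke_limit
begin

lemma kernel_deriv_0: "kernel_deriv b 0 0 z w = kb b w z"
  by (simp add: kernel_deriv_def kd_0)

lemma hb_form_gram:
  "hb_form b S c c = gram b ((\<lambda>z. (z, 0)) ` S) (\<lambda>x. c (fst x)) ((\<lambda>z. (z, 0)) ` S) (\<lambda>x. c (fst x))"
  unfolding gram_def hb_form_def by (simp add: sum.reindex inj_on_def kernel_deriv_0)

lemma hb_form_nonneg: "S \<subseteq> ball 0 1 \<Longrightarrow> 0 \<le> Re (hb_form b S c c)"
  unfolding hb_form_gram by (intro gram_nonneg) auto

lemma hb_form_real: "hb_form b S c c = of_real (Re (hb_form b S c c))"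
  using hb_form_cnj[of b S c c] by (simp add: complex_eq_iff)

lemma kb_diag_pos:
  assumes "z \<in> ball 0 1"
  shows "0 < (1 - (cmod (b z))\<^sup>2) / (1 - (cmod z)\<^sup>2)"
  using assms b_lt_1[OF assms] by (simp add: abs_square_less_1)

lemma kb_diag_le:
  assumes "z \<in> ball 0 1"
  shows "(1 - (cmod (b z))\<^sup>2) / (1 - (cmod z)\<^sup>2) \<le> 1 / (1 - (cmod z)\<^sup>2)"
  using assms by (intro divide_right_mono) (auto simp: power_le_one)

lemma hb_dom_point:
  assumes "hb_dom b C f" "z \<in> ball 0 1"
  shows "(cmod (f z))\<^sup>2 \<le> C * ((1 - (cmod (b z))\<^sup>2) / (1 - (cmod z)\<^sup>2))"
  using assms(1)[unfolded hb_dom_iff, rule_format, of "{z}" "\<lambda>_. 1"] assms(2)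
  by (simp add: hb_form_def kb_diag del: of_real_divide of_real_diff of_real_power)

text \<open>The kernel is strictly positive on the diagonal because \<open>|b| < 1\<close>. The
  infimum in \<open>hb_norm\<close> is therefore taken over a set bounded below.\<close>

lemma hb_dom_nonneg:
  assumes "hb_dom b C f"
  shows "0 \<le> C"
proof (rule ccontr)
  assume "\<not> 0 \<le> C"
  then have "C * ((1 - (cmod (b 0))\<^sup>2) / (1 - (cmod 0)\<^sup>2)) < 0"
    using kb_diag_pos[of 0] by (intro mult_neg_pos) auto
  then show False using hb_dom_point[OF assms, of 0] by (smt (verit) centre_in_ball zero_less_one zero_le_power2)
qed

lemma hb_dom_mono:
  assumes "hb_dom b C f" "C \<le> D"
  shows "hb_dom b D f"
  unfolding hb_dom_iff
proof (intro allI impI)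
  fix S c assume S: "finite S" "S \<subseteq> ball (0::complex) 1"
  have "C * Re (hb_form b S c c) \<le> D * Re (hb_form b S c c)"
    using assms(2) hb_form_nonneg[OF S(2)] by (rule mult_right_mono)
  then show "(cmod (\<Sum>z\<in>S. c z * f z))\<^sup>2 \<le> D * Re (hb_form b S c c)"
    using assms(1) S unfolding hb_dom_iff by (meson order_trans)
qed

text \<open>Linearized form of the inequality, in which constants add up as norms do.\<close>

lemma hb_dom_sqrt:
  assumes "0 \<le> r"
  shows "hb_dom b (r\<^sup>2) f \<longleftrightarrow> (\<forall>S c. finite S \<longrightarrow> S \<subseteq> ball 0 1 \<longrightarrow>
     cmod (\<Sum>z\<in>S. c z * f z) \<le> r * sqrt (Re (hb_form b S c c)))"
proof -
  have "(cmod x)\<^sup>2 \<le> r\<^sup>2 * q \<longleftrightarrow> cmod x \<le> r * sqrt q" if "0 \<le> q" for x :: complex and q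
  proof -
    have "r\<^sup>2 * q = (r * sqrt q)\<^sup>2" using that by (simp add: power_mult_distrib)
    then show ?thesis using assms that by (simp add: power2_le_iff_abs_le)
  qed
  note iff = this[OF hb_form_nonneg]
  show ?thesis
    unfolding hb_dom_iff by (intro iff_allI imp_cong refl iff)
qed

lemma hb_dom_add:
  assumes "hb_dom b (r\<^sup>2) f" "hb_dom b (s\<^sup>2) g" "0 \<le> r" "0 \<le> s"
  shows "hb_dom b ((r + s)\<^sup>2) (\<lambda>z. f z + g z)"
proof -
  have "cmod (\<Sum>z\<in>S. c z * (f z + g z)) \<le> (r + s) * sqrt (Re (hb_form b S c c))"
    if "finite S" "S \<subseteq> ball 0 1" for S c
  proof -
    have "cmod (\<Sum>z\<in>S. c z * (f z + g z)) \<le> cmod (\<Sum>z\<in>S. c z * f z) + cmod (\<Sum>z\<in>S. c z * g z)"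
      by (simp add: distrib_left sum.distrib norm_triangle_ineq)
    also have "\<dots> \<le> r * sqrt (Re (hb_form b S c c)) + s * sqrt (Re (hb_form b S c c))"
      using assms that by (intro add_mono) (auto simp: hb_dom_sqrt)
    finally show ?thesis by (simp add: distrib_right)
  qed
  then show ?thesis using assms by (subst hb_dom_sqrt) auto
qed

lemma hb_dom_scale:
  assumes "hb_dom b C f"
  shows "hb_dom b ((cmod s)\<^sup>2 * C) (\<lambda>z. s * f z)"
  unfolding hb_dom_iff
proof (intro allI impI)
  fix S c assume S: "finite S" "S \<subseteq> ball (0::complex) 1"
  have "(\<Sum>z\<in>S. c z * (s * f z)) = s * (\<Sum>z\<in>S. c z * f z)" by (simp add: sum_distrib_left mult_ac)
  then have "(cmod (\<Sum>z\<in>S. c z * (s * f z)))\<^sup>2 = (cmod s)\<^sup>2 * (cmod (\<Sum>z\<in>S. c z * f z))\<^sup>2"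
    by (simp add: norm_mult power_mult_distrib)
  also have "\<dots> \<le> (cmod s)\<^sup>2 * (C * Re (hb_form b S c c))"
    using assms S by (intro mult_left_mono) (auto simp: hb_dom_iff)
  finally show "(cmod (\<Sum>z\<in>S. c z * (s * f z)))\<^sup>2 \<le> (cmod s)\<^sup>2 * C * Re (hb_form b S c c)" by simp
qed

lemma hb_dom_limit:
  assumes "\<And>k::nat. hb_dom b C (F k)" "\<And>z. z \<in> ball 0 1 \<Longrightarrow> (\<lambda>k. F k z) \<longlonglongrightarrow> f z"
  shows "hb_dom b C f"
  unfolding hb_dom_iff
proof (intro allI impI)
  fix S c assume S: "finite S" "S \<subseteq> ball (0::complex) 1"
  show "(cmod (\<Sum>z\<in>S. c z * f z))\<^sup>2 \<le> C * Re (hb_form b S c c)"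
  proof (rule tendsto_upperbound)
    show "(\<lambda>k. (cmod (\<Sum>z\<in>S. c z * F k z))\<^sup>2) \<longlonglongrightarrow> (cmod (\<Sum>z\<in>S. c z * f z))\<^sup>2"
      using S by (intro tendsto_intros assms(2)) auto
    show "eventually (\<lambda>k. (cmod (\<Sum>z\<in>S. c z * F k z))\<^sup>2 \<le> C * Re (hb_form b S c c)) sequentially"
      using assms(1) S by (auto simp: hb_dom_iff)
  qed auto
qed

text \<open>If \<open>d\<close> satisfies \<open>\<langle>f, g\<rangle> = \<parallel>g\<parallel>\<^sup>2\<close> for \<open>g = kernel_comb b S d\<close>, then \<open>f - g \<bottom> g\<close>.\<close>
lemma hb_dom_minus_kernel_comb:
  assumes f: "hb_dom b N f" and S: "finite S" "S \<subseteq> ball 0 1"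
    and G: "(\<Sum>z\<in>S. d z * f z) = of_real G" "Re (hb_form b S d d) = G" "0 < G" "G < N"
  shows "hb_dom b (N - G) (\<lambda>z. f z - kernel_comb b S d z)"
  unfolding hb_dom_iff
proof (intro allI impI)
  fix T and e :: "complex \<Rightarrow> complex" assume T: "finite T" "T \<subseteq> ball (0::complex) 1"
  define U where "U = S \<union> T"
  have U: "finite U" "U \<subseteq> ball 0 1" "S \<subseteq> U" "T \<subseteq> U" using S T by (auto simp: U_def)
  define d' where "d' z = (if z \<in> S then d z else 0)" for z
  define e' where "e' z = (if z \<in> T then e z else 0)" for z
  have d'f: "(\<Sum>z\<in>U. d' z * f z) = of_real G"
    unfolding d'_def sum_extend_zero[OF U(1,3)] G(1) ..
  have d'q: "hb_form b U d' d' = of_real G"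
    unfolding d'_def[abs_def] hb_form_extend[OF U(1,3)] using hb_form_real[of S d] G(2) by simp
  have comb: "kernel_comb b U d' = kernel_comb b S d"
    unfolding d'_def[abs_def] by (rule kernel_comb_extend[OF U(1,3)])
  have e'q: "hb_form b U e' e' = hb_form b T e e"
    unfolding e'_def[abs_def] by (rule hb_form_extend[OF U(1,4)])
  define q where "q = Re (hb_form b T e e)"
  define p where "p = (\<Sum>z\<in>U. e' z * f z)"
  define r where "r = hb_form b U e' d'"
  define x where "x = p - r"
  have q0: "0 \<le> q" unfolding q_def by (rule hb_form_nonneg[OF T(2)])
  have x: "(\<Sum>z\<in>T. e z * (f z - kernel_comb b S d z)) = x"
  proof -
    have "(\<Sum>z\<in>T. e z * (f z - kernel_comb b S d z)) = (\<Sum>z\<in>U. e' z * (f z - kernel_comb b S d z))"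
      unfolding e'_def sum_extend_zero[OF U(1,4)] ..
    then show ?thesis
      by (simp add: x_def p_def r_def hb_form_alt comb right_diff_distrib sum_subtractf)
  qed
  have key: "(cmod (of_real G + t * x))\<^sup>2 \<le> N * (G + (cmod t)\<^sup>2 * q)" for t
  proof -
    \<comment> \<open>With this \<open>s\<close> the test vector is \<open>d'\<close> plus
      \<open>t\<close> times the part of \<open>e'\<close> orthogonal to \<open>d'\<close>. Its
      value on \<open>f\<close> is \<open>G + t * x\<close>, and the form only loses the nonnegative
      amount \<open>|t * r|^2 / G\<close>.\<close>
    define s where "s = 1 - t * r / of_real G"
    have "(\<Sum>z\<in>U. (s * d' z + t * e' z) * f z) = s * (\<Sum>z\<in>U. d' z * f z) + t * (\<Sum>z\<in>U. e' z * f z)"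
      by (simp add: distrib_right sum.distrib sum_distrib_left mult.assoc)
    also have "\<dots> = of_real G + t * x"
      using G(3) by (simp add: d'f s_def x_def p_def algebra_simps)
    finally have lhs: "(\<Sum>z\<in>U. (s * d' z + t * e' z) * f z) = of_real G + t * x" .
    have rd: "hb_form b U d' e' = cnj r" unfolding r_def by (simp add: hb_form_cnj)
    have "hb_form b U (\<lambda>z. s * d' z + t * e' z) (\<lambda>z. s * d' z + t * e' z)
      = s * cnj s * of_real G + s * cnj t * cnj r + t * cnj s * r + t * cnj t * of_real q"
      unfolding hb_form_add d'q rd r_def[symmetric] e'q using hb_form_real[of T e] by (simp add: q_def)
    also have "s * cnj s * of_real G + s * cnj t * cnj r + t * cnj s * r = of_real G - (t * r) * cnj (t * r) / of_real G"
    proof -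
      have sG: "s * of_real G = of_real G - t * r" using G(3) by (simp add: s_def field_simps)
      have "t * cnj s * r = t * r - (t * r) * cnj (t * r) / of_real G"
        using G(3) by (simp add: s_def field_simps)
      moreover have "s * cnj s * of_real G + s * cnj t * cnj r = s * (cnj (s * of_real G) + cnj (t * r))"
        by (simp add: algebra_simps)
      moreover have "cnj (s * of_real G) + cnj (t * r) = of_real G"
        unfolding sG by simp
      ultimately show ?thesis by (simp only: sG) simp
    qed
    also have "(t * r) * cnj (t * r) = of_real ((cmod (t * r))\<^sup>2)" by (rule complex_norm_square[symmetric])
    also have "t * cnj t = of_real ((cmod t)\<^sup>2)" by (rule complex_norm_square[symmetric])
    finally have "Re (hb_form b U (\<lambda>z. s * d' z + t * e' z) (\<lambda>z. s * d' z + t * e' z))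
       = G - (cmod (t * r))\<^sup>2 / G + (cmod t)\<^sup>2 * q"
      by (simp flip: of_real_divide of_real_diff of_real_add of_real_mult of_real_power)
    also have "\<dots> \<le> G + (cmod t)\<^sup>2 * q" using G(3) by simp
    finally have "N * Re (hb_form b U (\<lambda>z. s * d' z + t * e' z) (\<lambda>z. s * d' z + t * e' z)) \<le> N * (G + (cmod t)\<^sup>2 * q)"
      using G by (intro mult_left_mono) auto
    then show ?thesis
      using f[unfolded hb_dom_iff, rule_format, OF U(1,2), of "\<lambda>z. s * d' z + t * e' z"] unfolding lhs by linarith
  qed
  have "(cmod x)\<^sup>2 \<le> (N - G) * q"
  proof (cases "x = 0")
    case True
    then show ?thesis using q0 G by simp
  next
    case False
    define X where "X = (cmod x)\<^sup>2"
    have X: "0 < X" using False by (simp add: X_def)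
    \<comment> \<open>Chosen so that \<open>G + t * x = N\<close>; the resulting inequality, divided
      by \<open>N\<close> and by \<open>N - G\<close>, is the claim.\<close>
    define t where "t = of_real ((N - G) / X) * cnj x"
    have "x * cnj x = of_real X" unfolding X_def by (rule complex_norm_square[symmetric])
    then have "of_real G + t * x = of_real N"
      using X by (simp add: t_def mult.assoc mult.commute[of "cnj x"] flip: of_real_mult)
    moreover have "(cmod t)\<^sup>2 = (N - G)\<^sup>2 / X"
    proof -
      have "(cmod t)\<^sup>2 = ((N - G) / X)\<^sup>2 * X"
        unfolding t_def X_def by (simp add: norm_mult power_mult_distrib norm_divide norm_power power_divide flip: of_real_diff of_real_power of_real_divide)
      then show ?thesis using X by (simp add: power2_eq_square)
    qed
    ultimately have "N\<^sup>2 \<le> N * (G + (N - G)\<^sup>2 / X * q)"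
      using key[of t] by simp
    then have "N \<le> G + (N - G)\<^sup>2 / X * q"
      using G by (simp add: power2_eq_square)
    then have "(N - G) * X \<le> (N - G) * ((N - G) * q)"
      using X by (simp add: field_simps power2_eq_square)
    then show ?thesis using G by (simp add: X_def)
  qed
  then show "(cmod (\<Sum>z\<in>T. e z * (f z - kernel_comb b S d z)))\<^sup>2 \<le> (N - G) * Re (hb_form b T e e)"
    unfolding x q_def .
qed

text \<open>If \<open>N\<close> is admissible and \<open>N - \<epsilon>/2\<close> is not, some
  finite family tests \<open>f\<close> with a quotient \<open>G\<close> in between, and subtracting
  its combination leaves less than \<open>\<epsilon>\<close>. Taking \<open>N <= C\<close> also
  keeps the form of the combination below \<open>C\<close>.\<close>

lemma kernel_comb_dense:
  assumes f: "hb_dom b C f" and \<epsilon>: "0 < \<epsilon>"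
  shows "\<exists>S d. finite S \<and> S \<subseteq> ball 0 1 \<and> Re (hb_form b S d d) \<le> C \<and>
    hb_dom b \<epsilon> (\<lambda>z. f z - kernel_comb b S d z)"
proof -
  define A where "A = {C. hb_dom b C f}"
  have bdd: "bdd_below A" unfolding A_def by (rule bdd_belowI[of _ 0]) (auto intro: hb_dom_nonneg)
  have C: "C \<in> A" using f by (simp add: A_def)
  then obtain N0 where N0: "N0 \<in> A" "N0 < Inf A + \<epsilon>/2"
    using cInf_lessD[of A "Inf A + \<epsilon>/2"] \<epsilon> by auto
  define N where "N = min N0 C"
  have N: "hb_dom b N f" "N \<le> C" "N - \<epsilon>/2 \<notin> A" "0 \<le> N"
  proof -
    show h: "hb_dom b N f" using N0(1) f by (auto simp: N_def A_def min_def)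
    show "N - \<epsilon>/2 \<notin> A" using cInf_lower[OF _ bdd, of "N - \<epsilon>/2"] N0(2) by (auto simp: N_def)
    show "0 \<le> N" using h by (rule hb_dom_nonneg)
  qed (simp add: N_def)
  show ?thesis
  proof (cases "N \<le> \<epsilon>/2")
    case True
    then have "hb_dom b \<epsilon> f" using N(1) \<epsilon> by (intro hb_dom_mono[OF N(1)]) auto
    then show ?thesis
      using hb_dom_nonneg[OF f] by (intro exI[of _ "{}"] exI[of _ "\<lambda>_. 0"]) (simp add: kernel_comb_def hb_form_def)
  next
    case False
    obtain S e where S: "finite S" "S \<subseteq> ball 0 1"
      and gt: "(N - \<epsilon>/2) * Re (hb_form b S e e) < (cmod (\<Sum>z\<in>S. e z * f z))\<^sup>2"
    proof -
      have "\<not> hb_dom b (N - \<epsilon>/2) f" using N(3) by (simp add: A_def)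
      then have "\<exists>S e. finite S \<and> S \<subseteq> ball 0 1 \<and>
          \<not> (cmod (\<Sum>z\<in>S. e z * f z))\<^sup>2 \<le> (N - \<epsilon>/2) * Re (hb_form b S e e)"
        unfolding hb_dom_iff by blast
      then show ?thesis using that by (elim exE conjE) (simp only: not_le)
    qed
    define q where "q = Re (hb_form b S e e)"
    define \<alpha> where "\<alpha> = (\<Sum>z\<in>S. e z * f z)"
    define G where "G = (cmod \<alpha>)\<^sup>2 / q"
    have le: "(cmod \<alpha>)\<^sup>2 \<le> N * q"
      using N(1)[unfolded hb_dom_iff, rule_format, OF S, of e] by (simp add: \<alpha>_def q_def)
    have gt': "(N - \<epsilon>/2) * q < (cmod \<alpha>)\<^sup>2" using gt by (simp add: \<alpha>_def q_def)
    have q0: "0 \<le> q" unfolding q_def by (rule hb_form_nonneg[OF S(2)])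
    have q: "0 < q" using q0 le gt' by (cases "q = 0") auto
    have GN: "G \<le> N" "N - \<epsilon>/2 < G" using le gt' q by (auto simp: G_def field_simps)
    have G0: "0 < G" using GN False by simp
    \<comment> \<open>The scaling that makes the value on \<open>f\<close> and the quadratic form
      both equal to \<open>G\<close>, as subtracting the combination requires.\<close>
    define \<kappa> where "\<kappa> = cnj \<alpha> / of_real q"
    have G1: "(\<Sum>z\<in>S. \<kappa> * e z * f z) = of_real G"
    proof -
      have "(\<Sum>z\<in>S. \<kappa> * e z * f z) = \<kappa> * \<alpha>" by (simp add: \<alpha>_def sum_distrib_left mult.assoc)
      also have "\<dots> = (\<alpha> * cnj \<alpha>) / of_real q" by (simp add: \<kappa>_def mult.commute)
      finally show ?thesis by (simp add: G_def complex_norm_square[symmetric])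
    qed
    have G2: "Re (hb_form b S (\<lambda>z. \<kappa> * e z) (\<lambda>z. \<kappa> * e z)) = G"
    proof -
      have "\<kappa> * cnj \<kappa> = of_real ((cmod \<alpha>)\<^sup>2 / q\<^sup>2)"
      proof -
        have "(cmod \<kappa>)\<^sup>2 = (cmod \<alpha>)\<^sup>2 / q\<^sup>2" by (simp add: \<kappa>_def norm_divide power_divide)
        then show ?thesis using complex_norm_square[of \<kappa>] by simp
      qed
      then have "hb_form b S (\<lambda>z. \<kappa> * e z) (\<lambda>z. \<kappa> * e z) = of_real ((cmod \<alpha>)\<^sup>2 / q\<^sup>2 * q)"
        unfolding hb_form_scale using hb_form_real[of S e] by (simp add: q_def)
      then show ?thesis using q by (simp add: G_def power2_eq_square)
    qed
    \<comment> \<open>\<open>G\<close> may equal \<open>N\<close>, whereas the subtraction lemma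
      asks for strict inequality; the second half of \<open>\<epsilon>\<close> is spent on
      this.\<close>
    have "hb_dom b (N + \<epsilon>/2) f"
      by (rule hb_dom_mono[OF N(1)]) (use \<epsilon> in simp)
    then have "hb_dom b (N + \<epsilon>/2 - G) (\<lambda>z. f z - kernel_comb b S (\<lambda>z. \<kappa> * e z) z)"
      using S G1 G2 G0
    proof (rule hb_dom_minus_kernel_comb)
      show "G < N + \<epsilon>/2" using GN(1) \<epsilon> by linarith
    qed
    then have dom: "hb_dom b \<epsilon> (\<lambda>z. f z - kernel_comb b S (\<lambda>z. \<kappa> * e z) z)"
    proof (rule hb_dom_mono)
      show "N + \<epsilon>/2 - G \<le> \<epsilon>" using GN(2) by linarith
    qed
    have "G \<le> C" using GN(1) N(2) by linarith
    then show ?thesis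
      using S dom unfolding G2[symmetric] by blast
  qed
qed

section \<open>Derivative functionals and the norm of the kernel derivatives\<close>

lemma higher_deriv_kernel_comb:
  assumes S: "S \<subseteq> ball 0 1" and z: "z \<in> ball 0 1"
  shows "(deriv ^^ m) (kernel_comb b S d) z = (\<Sum>w\<in>S. cnj (d w) * kernel_deriv b m 0 z w)"
proof -
  have k: "(\<lambda>z. kb b w z) holomorphic_on ball 0 1" if "w \<in> S" for w
    unfolding kd_0[symmetric] using S that b_holomorphic by (intro kd_holomorphic) auto
  have "(deriv ^^ m) (kernel_comb b S d) z = (\<Sum>w\<in>S. (deriv ^^ m) (\<lambda>z. cnj (d w) * kb b w z) z)"
    unfolding kernel_comb_def[abs_def]
    using z k by (intro higher_deriv_sum[where S = "ball 0 1"] holomorphic_on_mult holomorphic_on_const) auto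
  also have "\<dots> = (\<Sum>w\<in>S. cnj (d w) * (deriv ^^ m) (kb b w) z)"
    using z k by (intro sum.cong refl higher_deriv_cmult[where A = "ball 0 1"]) auto
  finally show ?thesis
    by (simp add: kernel_deriv_def kd_0[abs_def, symmetric])
qed

lemma higher_deriv_kernel_comb_le:
  assumes S: "S \<subseteq> ball 0 1" and z: "z \<in> ball 0 1"
  shows "(cmod ((deriv ^^ m) (kernel_comb b S d) z))\<^sup>2 \<le> Re (hb_form b S d d) * K m z"
proof -
  let ?S = "(\<lambda>z. (z, 0)) ` S"
  have "gram b {(z, m)} (\<lambda>_. 1) ?S (\<lambda>x. d (fst x)) = (deriv ^^ m) (kernel_comb b S d) z"
    unfolding higher_deriv_kernel_comb[OF assms] by (simp add: gram_def sum.reindex inj_on_def)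
  moreover have "Re (gram b {(z, m)} (\<lambda>_. 1) {(z, m)} (\<lambda>_. 1)) = K m z"
    by (simp add: gram_def K_def)
  moreover have "(cmod (gram b {(z, m)} (\<lambda>_. 1) ?S (\<lambda>x. d (fst x))))\<^sup>2
     \<le> Re (gram b {(z, m)} (\<lambda>_. 1) {(z, m)} (\<lambda>_. 1)) * Re (hb_form b S d d)"
    unfolding hb_form_gram using S z by (intro gram_Cauchy_Schwarz) auto
  ultimately show ?thesis by (simp only: mult.commute)
qed

text \<open>Cauchy-Schwarz gives the bound for combinations of kernels. Those approximating
  \<open>f\<close> have forms at most \<open>C\<close>, and smallness of the admissible constant
  implies uniform convergence near \<open>z\<close>, hence convergence of the derivatives.\<close>

lemma hb_dom_higher_deriv:
  assumes f: "f holomorphic_on ball 0 1" and dom: "hb_dom b C f" and z: "z \<in> ball 0 1"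
  shows "(cmod ((deriv ^^ m) f z))\<^sup>2 \<le> C * K m z"
proof -
  let ?P = "\<lambda>(k::nat) p. fst p \<subseteq> ball 0 1 \<and> Re (hb_form b (fst p) (snd p) (snd p)) \<le> C \<and>
    hb_dom b (1 / real (Suc k)) (\<lambda>z. f z - kernel_comb b (fst p) (snd p) z)"
  have "\<forall>k. \<exists>p. ?P k p"
  proof
    fix k :: nat
    obtain S d where "S \<subseteq> ball 0 1" "Re (hb_form b S d d) \<le> C"
      "hb_dom b (1 / real (Suc k)) (\<lambda>z. f z - kernel_comb b S d z)"
      using kernel_comb_dense[OF dom, of "1 / real (Suc k)"] by auto
    then show "\<exists>p. ?P k p" by (intro exI[of _ "(S, d)"]) simp
  qed
  from choice[OF this] obtain p where p: "\<And>k. ?P k (p k)" by blast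
  define S where "S k = fst (p k)" for k
  define d where "d k = snd (p k)" for k
  have S: "S k \<subseteq> ball 0 1" "Re (hb_form b (S k) (d k) (d k)) \<le> C"
    "hb_dom b (1 / real (Suc k)) (\<lambda>z. f z - kernel_comb b (S k) (d k) z)" for k
    using p[of k] unfolding S_def d_def by blast+
  define g where "g k = kernel_comb b (S k) (d k)" for k
  obtain e where e: "0 < e" "cball z e \<subseteq> ball 0 1"
    using z open_contains_cball[of "ball 0 1"] by blast
  \<comment> \<open>The largest modulus on the closed ball, attained at its point farthest from 0;
    it is below 1 since that point is in the disk.\<close>
  define \<rho> where "\<rho> = cmod z + e"
  have \<rho>: "\<rho> < 1"
  proof (cases "z = 0")
    case True
    have "of_real e \<in> cball z e" using True e by simp
    then have "complex_of_real e \<in> ball 0 1" using e by blast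
    then show ?thesis using True e by (simp add: \<rho>_def)
  next
    case False
    have "z + of_real e * sgn z \<in> cball z e" using e by (simp add: dist_norm norm_mult norm_sgn)
    then have "z + of_real e * sgn z \<in> ball 0 1" using e by blast
    moreover have "z + of_real e * sgn z = of_real (cmod z + e) * sgn z"
      using False by (simp add: algebra_simps sgn_eq)
    ultimately show ?thesis using False e by (simp add: \<rho>_def norm_mult norm_sgn flip: of_real_add)
  qed
  have unif: "uniform_limit (ball z e) g f sequentially"
    unfolding uniform_limit_iff
  proof (intro allI impI)
    fix \<epsilon> :: real assume \<epsilon>: "0 < \<epsilon>"
    have "(\<lambda>k. sqrt (1 / real (Suc k) * (1 / (1 - \<rho>\<^sup>2)))) \<longlonglongrightarrow> sqrt (0 * (1 / (1 - \<rho>\<^sup>2)))"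
      by (intro tendsto_intros) real_asymp
    then have "eventually (\<lambda>k. sqrt (1 / real (Suc k) * (1 / (1 - \<rho>\<^sup>2))) < \<epsilon>) sequentially"
      using \<epsilon> by (intro order_tendstoD) auto
    then show "\<forall>\<^sub>F k in sequentially. \<forall>x\<in>ball z e. dist (g k x) (f x) < \<epsilon>"
    proof eventually_elim
      case (elim k)
      show ?case
      proof
        fix x assume "x \<in> ball z e"
        then have x\<rho>: "cmod x \<le> \<rho>"
          using norm_triangle_sub[of x z] by (simp add: \<rho>_def dist_norm norm_minus_commute)
        then have x: "x \<in> ball 0 1" "cmod x \<le> \<rho>" using \<rho> by auto
        have \<rho>0: "0 \<le> \<rho>" using e by (simp add: \<rho>_def)
        have "(cmod (f x - g k x))\<^sup>2 \<le> 1 / real (Suc k) * ((1 - (cmod (b x))\<^sup>2) / (1 - (cmod x)\<^sup>2))"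
          using hb_dom_point[OF S(3)[of k] x(1)] by (simp add: g_def)
        also have "\<dots> \<le> 1 / real (Suc k) * (1 / (1 - \<rho>\<^sup>2))"
        proof (intro mult_left_mono order_trans[OF kb_diag_le[OF x(1)]] divide_left_mono)
          show "1 - \<rho>\<^sup>2 \<le> 1 - (cmod x)\<^sup>2" using x \<rho>0 by (simp add: power_mono)
          show "0 < (1 - (cmod x)\<^sup>2) * (1 - \<rho>\<^sup>2)"
            using x(1) \<rho> \<rho>0 by (intro mult_pos_pos) (auto simp: abs_square_less_1)
        qed auto
        finally have "cmod (f x - g k x) \<le> sqrt (1 / real (Suc k) * (1 / (1 - \<rho>\<^sup>2)))"
          by (rule real_le_rsqrt)
        then show "dist (g k x) (f x) < \<epsilon>" using elim by (simp add: dist_norm norm_minus_commute)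
      qed
    qed
  qed
  have "(\<lambda>k. (deriv ^^ m) (g k) z) \<longlonglongrightarrow> (deriv ^^ m) f z"
  proof (rule higher_deriv_complex_uniform_limit[OF unif])
    show "\<forall>\<^sub>F k in sequentially. g k holomorphic_on ball z e"
    proof (intro always_eventually allI)
      fix k
      have "g k holomorphic_on ball 0 1"
        unfolding g_def by (rule kernel_comb_holomorphic[OF b_holomorphic S(1)])
      moreover have "ball z e \<subseteq> ball 0 1" using e(2) ball_subset_cball by blast
      ultimately show "g k holomorphic_on ball z e" by (rule holomorphic_on_subset)
    qed
  qed (use e in auto)
  then have lim: "(\<lambda>k. (cmod ((deriv ^^ m) (g k) z))\<^sup>2) \<longlonglongrightarrow> (cmod ((deriv ^^ m) f z))\<^sup>2"
    by (intro tendsto_intros)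
  have "(cmod ((deriv ^^ m) (g k) z))\<^sup>2 \<le> C * K m z" for k
    unfolding g_def using higher_deriv_kernel_comb_le[OF S(1) z] mult_right_mono[OF S(2) K_nonneg[OF z]]
    by (rule order_trans)
  then show ?thesis using lim by (intro tendsto_upperbound[OF lim]) auto
qed

lemma hb_dom_kd:
  assumes z: "z \<in> ball 0 1"
  shows "hb_dom b (K m z) (kd b m z)"
  unfolding hb_dom_iff
proof (intro allI impI)
  fix S c assume S: "finite S" "S \<subseteq> ball (0::complex) 1"
  let ?S = "(\<lambda>z. (z, 0::nat)) ` S"
  have "gram b ?S (\<lambda>x. c (fst x)) {(z, m)} (\<lambda>_. 1) = (\<Sum>w\<in>S. c w * kd b m z w)"
    by (simp add: gram_def sum.reindex inj_on_def kernel_deriv_def)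
  moreover have "Re (gram b {(z, m)} (\<lambda>_. 1) {(z, m)} (\<lambda>_. 1)) = K m z"
    by (simp add: gram_def K_def)
  moreover have "(cmod (gram b ?S (\<lambda>x. c (fst x)) {(z, m)} (\<lambda>_. 1)))\<^sup>2
     \<le> Re (hb_form b S c c) * Re (gram b {(z, m)} (\<lambda>_. 1) {(z, m)} (\<lambda>_. 1))"
    unfolding hb_form_gram using S z by (intro gram_Cauchy_Schwarz) auto
  ultimately show "(cmod (\<Sum>w\<in>S. c w * kd b m z w))\<^sup>2 \<le> K m z * Re (hb_form b S c c)"
    by (simp only: mult.commute)
qed

lemma higher_deriv_kd_diag: "z \<in> ball 0 1 \<Longrightarrow> (deriv ^^ m) (kd b m z) z = of_real (K m z)"
  using kernel_deriv_diag[of z m] by (simp add: kernel_deriv_def)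

text \<open>Cauchy-Schwarz makes \<open>K m z\<close> admissible. It is the least admissible
  constant because the derivative of \<open>kd b m z\<close> at \<open>z\<close> is
  \<open>K m z\<close> itself, so that an admissible \<open>C\<close> satisfies
  \<open>(K m z)^2 <= C * K m z\<close>.\<close>

lemma hb_norm_kd:
  assumes z: "z \<in> ball 0 1"
  shows "hb_norm b (kd b m z) = sqrt (K m z)"
proof -
  have "K m z \<le> C" if C: "hb_dom b C (kd b m z)" for C
  proof -
    have "(K m z)\<^sup>2 \<le> C * K m z"
      using hb_dom_higher_deriv[OF kd_holomorphic[OF b_holomorphic z] C z, of m]
      by (simp add: higher_deriv_kd_diag[OF z])
    then show ?thesis
      using K_nonneg[OF z, of m] hb_dom_nonneg[OF C] by (cases "K m z = 0") (auto simp: power2_eq_square)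
  qed
  then have "Inf {C. hb_dom b C (kd b m z)} = K m z"
    using hb_dom_kd[OF z] by (intro cInf_eq_minimum) auto
  then show ?thesis by (simp add: hb_norm_def)
qed

end

section \<open>Rays and triangles at the boundary point\<close>

definition ray_to_1 :: "complex \<Rightarrow> real \<Rightarrow> complex" where
  "ray_to_1 z t = 1 + of_real t * (z - 1)"

text \<open>The point \<open>(1 - s) * z + s * w\<close> of the segment, contracted towards 1 by the
  factor \<open>t\<close>.\<close>

definition triangle_at_1 :: "complex \<Rightarrow> complex \<Rightarrow> real \<Rightarrow> real \<Rightarrow> complex" where
  "triangle_at_1 z w t s = 1 + of_real t * (of_real (1 - s) * (z - 1) + of_real s * (w - 1))"

lemma norm_ray_to_1_minus_1: "0 \<le> t \<Longrightarrow> cmod (ray_to_1 z t - 1) = t * cmod (z - 1)"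
  by (simp add: ray_to_1_def norm_mult)

text \<open>The distance from the circle is at least a multiple of \<open>t\<close>, while that from
  1 is at most \<open>2 * t\<close>: for fixed \<open>z\<close> and \<open>w\<close> the triangle
  lies in a Stolz angle.\<close>

lemma norm_triangle_at_1:
  assumes z: "cmod z < 1" and w: "cmod w < 1" and t: "0 < t" "t \<le> 1" and s: "0 \<le> s" "s \<le> 1"
  shows "t * (1 - max (cmod z) (cmod w)) \<le> 1 - cmod (triangle_at_1 z w t s)"
proof -
  let ?r = "max (cmod z) (cmod w)" and ?u = "of_real (1 - s) * z + of_real s * w"
  have "cmod ?u \<le> (1 - s) * cmod z + s * cmod w"
    using s by (intro order_trans[OF norm_triangle_ineq]) (simp add: norm_mult del: of_real_diff)
  also have "\<dots> \<le> (1 - s) * ?r + s * ?r"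
    using s by (intro add_mono mult_left_mono) auto
  also have "\<dots> = ?r" by (simp add: algebra_simps)
  finally have u: "cmod ?u \<le> ?r" .
  have "triangle_at_1 z w t s = of_real (1 - t) + of_real t * ?u"
    by (simp add: triangle_at_1_def algebra_simps)
  then have "cmod (triangle_at_1 z w t s) \<le> (1 - t) + t * cmod ?u"
    using t norm_triangle_ineq[of "of_real (1 - t)" "of_real t * ?u"] by (simp add: norm_mult del: of_real_diff)
  also have "\<dots> \<le> (1 - t) + t * ?r" using u t by (intro add_mono mult_left_mono) auto
  finally show ?thesis by (simp add: algebra_simps)
qed

lemma triangle_at_1_in_ball:
  assumes "z \<in> ball 0 1" "w \<in> ball 0 1" "0 < t" "t \<le> 1" "0 \<le> s" "s \<le> 1"
  shows "triangle_at_1 z w t s \<in> ball 0 1"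
proof -
  have "0 < t * (1 - max (cmod z) (cmod w))" using assms by (intro mult_pos_pos) auto
  also have "\<dots> \<le> 1 - cmod (triangle_at_1 z w t s)" using assms by (intro norm_triangle_at_1) auto
  finally show ?thesis by simp
qed

lemma triangle_at_1_0: "triangle_at_1 z w t 0 = ray_to_1 z t"
  by (simp add: triangle_at_1_def ray_to_1_def)

lemma ray_to_1_in_ball: "z \<in> ball 0 1 \<Longrightarrow> 0 < t \<Longrightarrow> t \<le> 1 \<Longrightarrow> ray_to_1 z t \<in> ball 0 1"
  using triangle_at_1_in_ball[of z z t 0] by (simp add: triangle_at_1_0)

lemma norm_triangle_at_1_minus_1:
  assumes "z \<in> ball 0 1" "w \<in> ball 0 1" "0 < t" "0 \<le> s" "s \<le> 1"
  shows "cmod (triangle_at_1 z w t s - 1) \<le> 2 * t"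
proof -
  have z: "cmod (z - 1) \<le> 2" "cmod (w - 1) \<le> 2"
    using assms norm_triangle_ineq4[of z 1] norm_triangle_ineq4[of w 1] by auto
  have "cmod (of_real (1 - s) * (z - 1) + of_real s * (w - 1)) \<le> (1 - s) * cmod (z - 1) + s * cmod (w - 1)"
    using assms by (intro order_trans[OF norm_triangle_ineq]) (simp add: norm_mult del: of_real_diff)
  also have "\<dots> \<le> (1 - s) * 2 + s * 2" using z assms by (intro add_mono mult_left_mono) auto
  finally have "cmod (of_real (1 - s) * (z - 1) + of_real s * (w - 1)) \<le> 2" by simp
  then have "t * cmod (of_real (1 - s) * (z - 1) + of_real s * (w - 1)) \<le> t * 2"
    using assms by (intro mult_left_mono) auto
  then show ?thesis using assms by (simp add: triangle_at_1_def norm_mult mult.commute del: of_real_diff)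
qed

lemma norm_diff_le_along_segment:
  assumes g: "g holomorphic_on ball 0 1" and x: "x \<in> ball 0 1" and y: "y \<in> ball 0 1"
    and M: "\<And>s. 0 \<le> s \<Longrightarrow> s \<le> 1 \<Longrightarrow> cmod (deriv g (of_real (1 - s) * x + of_real s * y)) \<le> M"
  shows "cmod (g x - g y) \<le> M * cmod (x - y)"
proof (rule field_differentiable_bound[of "closed_segment x y" g "deriv g"])
  fix z assume z: "z \<in> closed_segment x y"
  then have "z \<in> ball 0 1" using closed_segment_subset[OF x y convex_ball] by blast
  then show "(g has_field_derivative deriv g z) (at z within closed_segment x y)"
    using holomorphic_derivI[OF g open_ball] has_field_derivative_at_within by blast
  obtain s where "0 \<le> s" "s \<le> 1" "z = (1 - s) *\<^sub>R x + s *\<^sub>R y" using z by (auto simp: in_segment)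
  then show "cmod (deriv g z) \<le> M" using M[of s] by (simp add: scaleR_conv_of_real)
qed auto

lemma norm_diff_le_along_ray:
  assumes g: "g holomorphic_on ball 0 1" and z: "z \<in> ball 0 1" and t: "0 < t" "t \<le> 1"
    and M: "\<And>t. 0 < t \<Longrightarrow> t \<le> 1 \<Longrightarrow> cmod (deriv g (ray_to_1 z t)) \<le> M"
  shows "cmod (g (ray_to_1 z t) - g z) \<le> M * cmod (z - 1)"
proof -
  have M0: "0 \<le> M" using order_trans[OF norm_ge_zero M[of 1]] by simp
  have "cmod (g (ray_to_1 z t) - g z) \<le> M * cmod (ray_to_1 z t - z)"
  proof (rule norm_diff_le_along_segment[OF g ray_to_1_in_ball[OF z t] z])
    fix s :: real assume s: "0 \<le> s" "s \<le> 1"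
    have "of_real (1 - s) * ray_to_1 z t + of_real s * z = ray_to_1 z ((1 - s) * t + s)"
      by (simp add: ray_to_1_def algebra_simps)
    moreover have "0 < (1 - s) * t + s"
    proof (cases "s = 0")
      case False
      have "0 \<le> (1 - s) * t" using s t by simp
      then show ?thesis using False s by linarith
    qed (use t in simp)
    moreover have "(1 - s) * t + s \<le> 1"
      using mult_left_mono[of t 1 "1 - s"] s t by simp
    ultimately show "cmod (deriv g (of_real (1 - s) * ray_to_1 z t + of_real s * z)) \<le> M" using M by simp
  qed
  also have "ray_to_1 z t - z = of_real (1 - t) * (1 - z)" by (simp add: ray_to_1_def algebra_simps)
  also have "M * cmod (of_real (1 - t) * (1 - z)) \<le> M * cmod (z - 1)"
    using t M0 by (intro mult_left_mono) (auto simp: norm_mult norm_minus_commute mult_left_le_one_le simp del: of_real_diff)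
  finally show ?thesis .
qed

text \<open>The two points are joined through a short segment near \<open>1\<close>; only the bound \<open>M\<close> along the
  rays survives as the segment tends to \<open>1\<close>.\<close>
lemma norm_diff_le_through_1:
  assumes g: "g holomorphic_on ball 0 1" and z: "z \<in> ball 0 1" and w: "w \<in> ball 0 1"
    and Mz: "\<And>t. 0 < t \<Longrightarrow> t \<le> 1 \<Longrightarrow> cmod (deriv g (ray_to_1 z t)) \<le> M"
    and Mw: "\<And>t. 0 < t \<Longrightarrow> t \<le> 1 \<Longrightarrow> cmod (deriv g (ray_to_1 w t)) \<le> M"
    and t0: "0 < t0" and M': "\<And>t s. 0 < t \<Longrightarrow> t \<le> t0 \<Longrightarrow> t \<le> 1 \<Longrightarrow> 0 \<le> s \<Longrightarrow> s \<le> 1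
       \<Longrightarrow> cmod (deriv g (triangle_at_1 z w t s)) \<le> M'"
  shows "cmod (g z - g w) \<le> M * (cmod (z - 1) + cmod (w - 1))"
proof -
  have bd: "cmod (g z - g w) \<le> M * (cmod (z - 1) + cmod (w - 1)) + M' * (t * cmod (z - w))"
    if t: "0 < t" "t \<le> t0" "t \<le> 1" for t
  proof -
    have "cmod (g (ray_to_1 z t) - g (ray_to_1 w t)) \<le> M' * cmod (ray_to_1 z t - ray_to_1 w t)"
    proof (rule norm_diff_le_along_segment[OF g])
      fix s :: real assume s: "0 \<le> s" "s \<le> 1"
      have "of_real (1 - s) * ray_to_1 z t + of_real s * ray_to_1 w t = triangle_at_1 z w t s"
        by (simp add: ray_to_1_def triangle_at_1_def algebra_simps)
      then show "cmod (deriv g (of_real (1 - s) * ray_to_1 z t + of_real s * ray_to_1 w t)) \<le> M'"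
        using M' s t by simp
    qed (use ray_to_1_in_ball z w t in auto)
    moreover have "ray_to_1 z t - ray_to_1 w t = of_real t * (z - w)"
      by (simp add: ray_to_1_def algebra_simps)
    ultimately have 1: "cmod (g (ray_to_1 z t) - g (ray_to_1 w t)) \<le> M' * (t * cmod (z - w))"
      using t by (simp add: norm_mult)
    have 2: "cmod (g (ray_to_1 z t) - g z) \<le> M * cmod (z - 1)"
      using g z t Mz by (intro norm_diff_le_along_ray) auto
    have 3: "cmod (g (ray_to_1 w t) - g w) \<le> M * cmod (w - 1)"
      using g w t Mw by (intro norm_diff_le_along_ray) auto
    have "cmod (u - v) \<le> cmod (p - u) + cmod (p - q) + cmod (q - v)" for u v p q :: complex
      using norm_triangle_ineq[of "u - p" "(p - q) + (q - v)"] norm_triangle_ineq[of "p - q" "q - v"]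
      by (simp add: norm_minus_commute)
    from this[of "g z" "g w" "g (ray_to_1 z t)" "g (ray_to_1 w t)"]
    show ?thesis using 1 2 3 by (simp add: distrib_left)
  qed
  have lim: "((\<lambda>t. M * (cmod (z - 1) + cmod (w - 1)) + M' * (t * cmod (z - w))) \<longlongrightarrow>
      M * (cmod (z - 1) + cmod (w - 1)) + M' * (0 * cmod (z - w))) (at_right 0)"
    by (intro tendsto_intros)
  have "eventually (\<lambda>t. cmod (g z - g w) \<le> M * (cmod (z - 1) + cmod (w - 1)) + M' * (t * cmod (z - w))) (at_right 0)"
    unfolding eventually_at_right_field
    using bd t0 by (intro exI[of _ "min t0 1"]) auto
  from tendsto_lowerbound[OF lim this] show ?thesis by simp
qed

lemma one_minus_norm_square_le: "cmod z < 1 \<Longrightarrow> 1 - (cmod z)\<^sup>2 \<le> 2 * cmod (z - 1)"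
proof -
  assume z: "cmod z < 1"
  have "1 - cmod z \<le> cmod (z - 1)" using norm_triangle_ineq2[of 1 z] by (simp add: norm_minus_commute)
  then have "(1 - cmod z) * (1 + cmod z) \<le> cmod (z - 1) * 2" using z by (intro mult_mono) auto
  then show ?thesis by (simp add: power2_eq_square algebra_simps)
qed

lemma small_near_1:
  assumes "0 \<le> A"
  obtains \<eta> where "0 < \<eta>" "\<And>z. z \<in> ball 0 1 \<Longrightarrow> cmod (z - 1) < \<eta> \<Longrightarrow> (1 - (cmod z)\<^sup>2) * A < 3/4"
proof
  \<comment> \<open>From \<open>1 - |z|^2 <= 2 * |z - 1|\<close> the product is below
    \<open>2 * \<eta> * (A + 1) = 3/4\<close>; the added 1 admits \<open>A = 0\<close>.\<close>
  define \<eta> where "\<eta> = 3 / (8 * (A + 1))"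
  show "0 < \<eta>" using assms by (simp add: \<eta>_def)
  fix z :: complex assume z: "z \<in> ball 0 1" "cmod (z - 1) < \<eta>"
  have "(1 - (cmod z)\<^sup>2) * A \<le> 2 * cmod (z - 1) * (A + 1)"
    using z one_minus_norm_square_le[of z] assms by (intro mult_mono) auto
  also have "\<dots> < 2 * \<eta> * (A + 1)" using z assms by simp
  also have "\<dots> = 3/4" using assms by (simp add: \<eta>_def field_simps)
  finally show "(1 - (cmod z)\<^sup>2) * A < 3/4" .
qed

lemma Cauchy_at_within_convergent:
  fixes g :: "complex \<Rightarrow> complex"
  assumes "\<And>e. 0 < e \<Longrightarrow> \<exists>\<eta>>0. \<forall>z\<in>\<Omega>. \<forall>w\<in>\<Omega>. cmod (z - 1) < \<eta> \<longrightarrow> cmod (w - 1) < \<eta> \<longrightarrow> cmod (g z - g w) < e"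
  shows "\<exists>L. (g \<longlongrightarrow> L) (at 1 within \<Omega>)"
proof -
  have "cauchy_filter (filtermap g (at 1 within \<Omega>))"
    unfolding cauchy_filter_metric_filtermap
  proof (intro allI impI)
    fix e :: real assume "0 < e"
    then obtain \<eta> where \<eta>: "0 < \<eta>" "\<forall>z\<in>\<Omega>. \<forall>w\<in>\<Omega>. cmod (z - 1) < \<eta> \<longrightarrow> cmod (w - 1) < \<eta> \<longrightarrow> cmod (g z - g w) < e"
      using assms by blast
    then show "\<exists>P. eventually P (at 1 within \<Omega>) \<and> (\<forall>x y. P x \<and> P y \<longrightarrow> dist (g x) (g y) < e)"
      by (intro exI[of _ "\<lambda>z. z \<in> \<Omega> \<and> cmod (z - 1) < \<eta>"]) (auto simp: eventually_at dist_norm)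
  qed
  then have "convergent_filter (filtermap g (at 1 within \<Omega>))"
    by (rule cauchy_filter_convergent)
  then show ?thesis by (auto simp: convergent_filter_iff filterlim_def)
qed

text \<open>Closes the self-referential estimates below, in which the unknown \<open>K\<close>
  reappears on the right under a root.\<close>

lemma le_square_of_le_sqrt:
  fixes K :: real
  assumes "0 \<le> K" "K \<le> sqrt K * A"
  shows "K \<le> A\<^sup>2"
proof (cases "K = 0")
  case False
  have "sqrt K * sqrt K \<le> sqrt K * A" using assms by simp
  moreover have "0 < sqrt K" using False assms by simp
  ultimately have "sqrt K \<le> A" by (rule mult_left_le_imp_le)
  then have "(sqrt K)\<^sup>2 \<le> A\<^sup>2" using assms by (intro power_mono) auto
  then show ?thesis using assms by simp
qed simp

section \<open>Local estimates in the disk and near the boundary point\<close>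

context blaschke_limit
begin

lemma J_compact_bound:
  assumes "r < 1"
  obtains M where "\<And>z. cmod z \<le> r \<Longrightarrow> J p z \<le> M"
proof
  fix z assume z: "cmod z \<le> r"
  show "J p z \<le> (1 / (1 - r)) ^ p * J p 0"
  proof (rule J_le)
    fix v assume v: "cmod v \<le> 1"
    have "1 - r \<le> cmod (1 - cnj v * z)" using norm_one_minus_cnj_mult_ge[OF v, of z] z by simp
    then show "cmod (1 - cnj v * 0) \<le> 1 / (1 - r) * cmod (1 - cnj v * z)"
      using assms by (simp add: field_simps)
  qed (use z assms in auto)
qed

text \<open>\<open>K m z\<close> is a derivative of \<open>kd b m z\<close>, whose values are
  bounded by a constant times \<open>sqrt (K m z)\<close>. Cauchy's inequality on a disk of radius
  \<open>(1 - r) / 2\<close> bounds \<open>K m z\<close> by a multiple of its own root.\<close>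

lemma K_compact_bound:
  assumes r: "r < 1"
  obtains M where "\<And>z. cmod z \<le> r \<Longrightarrow> K m z \<le> M"
proof
  define \<rho> where "\<rho> = (1 - r) / 2"
  define A where "A = fact m * sqrt (1 / (1 - (r + \<rho>)\<^sup>2)) / \<rho> ^ m"
  have \<rho>: "0 < \<rho>" "r + \<rho> < 1" using r by (auto simp: \<rho>_def field_simps)
  fix z assume z: "cmod z \<le> r"
  have z1: "z \<in> ball 0 1" using z r by simp
  have r0: "0 \<le> r" using z norm_ge_zero[of z] by linarith
  have sub: "cball z \<rho> \<subseteq> ball 0 1"
  proof
    fix x assume "x \<in> cball z \<rho>"
    then show "x \<in> ball 0 1"
      using norm_triangle_sub[of x z] z \<rho> by (auto simp: dist_norm norm_minus_commute)
  qed
  have hol: "kd b m z holomorphic_on ball 0 1" using b_holomorphic z1 by (rule kd_holomorphic)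
  have "cmod ((deriv ^^ m) (kd b m z) z) \<le> fact m * (sqrt (K m z) * sqrt (1 / (1 - (r + \<rho>)\<^sup>2))) / \<rho> ^ m"
  proof (rule Cauchy_inequality)
    show "kd b m z holomorphic_on ball z \<rho>"
      using hol by (rule holomorphic_on_subset) (use sub ball_subset_cball in blast)
    show "continuous_on (cball z \<rho>) (kd b m z)"
      using holomorphic_on_imp_continuous_on[OF hol] sub by (rule continuous_on_subset)
    show "0 < \<rho>" by fact
    fix x assume x: "cmod (z - x) = \<rho>"
    have xr: "cmod x \<le> r + \<rho>" using norm_triangle_sub[of x z] x z by (simp add: norm_minus_commute)
    have x1: "x \<in> ball 0 1" using xr \<rho> by simp
    have "(cmod (kd b m z x))\<^sup>2 \<le> K m z * ((1 - (cmod (b x))\<^sup>2) / (1 - (cmod x)\<^sup>2))"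
      by (rule hb_dom_point[OF hb_dom_kd[OF z1] x1])
    also have "\<dots> \<le> K m z * (1 / (1 - (r + \<rho>)\<^sup>2))"
    proof (intro mult_left_mono K_nonneg z1 order_trans[OF kb_diag_le[OF x1]] divide_left_mono)
      show "1 - (r + \<rho>)\<^sup>2 \<le> 1 - (cmod x)\<^sup>2" using xr by (simp add: power_mono)
      show "0 < (1 - (cmod x)\<^sup>2) * (1 - (r + \<rho>)\<^sup>2)"
        using x1 \<rho> r0 by (intro mult_pos_pos) (auto simp: abs_square_less_1)
    qed auto
    finally show "cmod (kd b m z x) \<le> sqrt (K m z) * sqrt (1 / (1 - (r + \<rho>)\<^sup>2))"
      unfolding real_sqrt_mult[symmetric] by (rule real_le_rsqrt)
  qed
  then have "K m z \<le> sqrt (K m z) * A"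
    using K_nonneg[OF z1, of m] by (simp add: higher_deriv_kd_diag[OF z1] A_def mult_ac)
  then show "K m z \<le> A\<^sup>2" by (rule le_square_of_le_sqrt[OF K_nonneg[OF z1]])
qed

text \<open>Close to 1 the smallness condition of \<open>K_bound\<close> holds automatically. Each
  order comes with its own neighbourhood, and finitely many of them are intersected.\<close>

lemma K_bound_near_1:
  "\<exists>\<eta>>0. \<exists>C. \<forall>z\<in>ball 0 1. cmod (z - 1) < \<eta> \<longrightarrow> J (2*m+2) z \<le> M \<longrightarrow> (\<forall>j\<le>m. K j z \<le> C)"
proof -
  have step: "\<exists>\<eta>>0. \<exists>C. \<forall>z\<in>ball 0 1. cmod (z - 1) < \<eta> \<longrightarrow> J (2*m+2) z \<le> M \<longrightarrow> K j z \<le> C" if j: "j \<le> m" for j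
  proof -
    let ?M = "2 ^ (2 * m) * \<bar>M\<bar>"
    obtain C where C: "\<And>z. z \<in> ball 0 1 \<Longrightarrow> J (2*j+2) z \<le> ?M \<Longrightarrow> (1 - (cmod z)\<^sup>2) * (2 ^ (2*j) * (?M + 1)) \<le> 3/4 \<Longrightarrow> K j z \<le> C"
      using K_bound[of j ?M] by blast
    obtain \<eta> where \<eta>: "0 < \<eta>" "\<And>z. z \<in> ball 0 1 \<Longrightarrow> cmod (z - 1) < \<eta> \<Longrightarrow> (1 - (cmod z)\<^sup>2) * (2 ^ (2*j) * (?M + 1)) < 3/4"
      by (rule small_near_1[of "2 ^ (2*j) * (?M + 1)"]) auto
    have "K j z \<le> C" if z: "z \<in> ball 0 1" "cmod (z - 1) < \<eta>" and J: "J (2*m+2) z \<le> M" for z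
    proof (rule C[OF z(1)])
      have "J (2*j+2) z \<le> 2 ^ ((2*m+2) - (2*j+2)) * J (2*m+2) z"
        using j by (intro J_exponent_le z) auto
      also have "\<dots> \<le> ?M"
        using J J_nonneg[OF z(1), of "2*m+2"] by (intro mult_mono power_increasing) auto
      finally show "J (2*j+2) z \<le> ?M" .
      show "(1 - (cmod z)\<^sup>2) * (2 ^ (2*j) * (?M + 1)) \<le> 3/4" using \<eta>(2)[OF z] by simp
    qed
    then show ?thesis using \<eta>(1) by blast
  qed
  have "\<exists>\<eta>>0. \<exists>C. \<forall>z\<in>ball 0 1. cmod (z - 1) < \<eta> \<longrightarrow> J (2*m+2) z \<le> M \<longrightarrow> (\<forall>j\<le>k. K j z \<le> C)"
    if "k \<le> m" for k
    using that
  proof (induction k)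
    case 0
    then show ?case using step[of 0] by auto
  next
    case (Suc k)
    have "\<exists>\<eta>>0. \<exists>C. \<forall>z\<in>ball 0 1. cmod (z - 1) < \<eta> \<longrightarrow> J (2*m+2) z \<le> M \<longrightarrow> (\<forall>j\<le>k. K j z \<le> C)"
      by (rule Suc.IH[OF Suc_leD[OF Suc.prems]])
    then obtain \<eta>1 C1 where \<eta>1: "0 < \<eta>1"
      and 1: "\<forall>z\<in>ball 0 1. cmod (z - 1) < \<eta>1 \<longrightarrow> J (2*m+2) z \<le> M \<longrightarrow> (\<forall>j\<le>k. K j z \<le> C1)"
      by blast
    obtain \<eta>2 C2 where \<eta>2: "0 < \<eta>2"
      and 2: "\<forall>z\<in>ball 0 1. cmod (z - 1) < \<eta>2 \<longrightarrow> J (2*m+2) z \<le> M \<longrightarrow> K (Suc k) z \<le> C2"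
      using step[OF Suc.prems] by blast
    show ?case
    proof (rule exI[of _ "min \<eta>1 \<eta>2"], rule conjI, simp add: \<eta>1 \<eta>2,
        rule exI[of _ "max C1 C2"], intro ballI impI allI)
      fix z j assume z: "z \<in> ball 0 1" "cmod (z - 1) < min \<eta>1 \<eta>2" "J (2*m+2) z \<le> M" "j \<le> Suc k"
      show "K j z \<le> max C1 C2"
      proof (cases "j = Suc k")
        case True
        then show ?thesis using 2[rule_format, of z] z by (simp add: le_max_iff_disj)
    next
        case False
        then show ?thesis using 1[rule_format, of z j] z by (simp add: le_max_iff_disj)
      qed
    qed
  qed
  then show ?thesis by blast
qed

text \<open>\<open>K 0 z\<close> is \<open>(1 - |b z|^2) / (1 - |z|^2)\<close>, so a bound for it
  forces \<open>|b z| > 1/2\<close> near 1, as the estimate of the sums demands.\<close>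

lemma J_bound_near_1:
  "\<exists>\<eta>>0. \<exists>C. \<forall>z\<in>ball 0 1. cmod (z - 1) < \<eta> \<longrightarrow> (\<forall>j\<le>m. K j z \<le> M) \<longrightarrow> J (2*m+2) z \<le> C"
proof -
  obtain C where C: "\<And>z. z \<in> ball 0 1 \<Longrightarrow> 1/2 < cmod (b z) \<Longrightarrow> \<forall>j\<le>m. K j z \<le> M \<Longrightarrow> J (2*m+2) z \<le> C"
    using J_bound[of m M] by blast
  obtain \<eta> where \<eta>: "0 < \<eta>" "\<And>z. z \<in> ball 0 1 \<Longrightarrow> cmod (z - 1) < \<eta> \<Longrightarrow> (1 - (cmod z)\<^sup>2) * \<bar>M\<bar> < 3/4"
    by (rule small_near_1[of "\<bar>M\<bar>"]) auto
  have "J (2*m+2) z \<le> C" if z: "z \<in> ball 0 1" "cmod (z - 1) < \<eta>" and K: "\<forall>j\<le>m. K j z \<le> M" for z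
  proof (rule C[OF z(1) _ K])
    have zz: "0 < 1 - (cmod z)\<^sup>2" using z by (simp add: abs_square_less_1)
    have "(1 - (cmod (b z))\<^sup>2) / (1 - (cmod z)\<^sup>2) \<le> \<bar>M\<bar>"
      using K[rule_format, of 0] unfolding K_0[OF z(1)] by linarith
    then have "1 - (cmod (b z))\<^sup>2 \<le> (1 - (cmod z)\<^sup>2) * \<bar>M\<bar>" using zz by (simp add: field_simps)
    also have "\<dots> < 3/4" by (rule \<eta>(2)[OF z])
    finally have "(1/2)\<^sup>2 < (cmod (b z))\<^sup>2" by (simp add: power2_eq_square)
    then show "1/2 < cmod (b z)" using power2_less_imp_less norm_ge_zero by blast
  qed
  then show ?thesis using \<eta>(1) by blast
qed

lemma deriv_b_bound_near_1:
  "\<exists>\<eta>>0. \<exists>C. \<forall>z\<in>ball 0 1. cmod (z - 1) < \<eta> \<longrightarrow> J (2*m+2) z \<le> M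
     \<longrightarrow> (\<forall>j\<le>2*m+1. cmod ((deriv ^^ j) b z) \<le> C)"
proof -
  obtain C where C: "\<forall>z\<in>ball 0 1. \<forall>j\<le>2*m+1. J (2*m+2) z \<le> \<bar>M\<bar> \<longrightarrow> (1 - (cmod z)\<^sup>2) * (2 ^ (2*m) * (\<bar>M\<bar> + 1)) \<le> 3/4
     \<longrightarrow> cmod ((deriv ^^ j) b z) \<le> C"
    using deriv_b_bound[of m "\<bar>M\<bar>"] by blast
  obtain \<eta> where \<eta>: "0 < \<eta>" "\<And>z. z \<in> ball 0 1 \<Longrightarrow> cmod (z - 1) < \<eta> \<Longrightarrow> (1 - (cmod z)\<^sup>2) * (2 ^ (2*m) * (\<bar>M\<bar> + 1)) < 3/4"
    by (rule small_near_1[of "2 ^ (2*m) * (\<bar>M\<bar> + 1)"]) auto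
  have "cmod ((deriv ^^ j) b z) \<le> C" if "z \<in> ball 0 1" "cmod (z - 1) < \<eta>" "J (2*m+2) z \<le> M" "j \<le> 2*m+1" for z j
    using C that \<eta>(2)[OF that(1,2)] by (meson abs_ge_self less_imp_le order_trans)
  then show ?thesis using \<eta>(1) by blast
qed

text \<open>At parameter \<open>t\<close> the two points differ by at most
  \<open>t * |w - z|\<close>, while the denominators at the point of the triangle are at least
  \<open>t * (1 - r)\<close>; the ratio is bounded independently of \<open>t\<close>.\<close>

lemma J_triangle:
  assumes z: "z \<in> ball 0 1" and w: "w \<in> ball 0 1"
  obtains \<kappa> where "0 \<le> \<kappa>" "\<And>t s p. 0 < t \<Longrightarrow> t \<le> 1 \<Longrightarrow> 0 \<le> s \<Longrightarrow> s \<le> 1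
    \<Longrightarrow> J p (triangle_at_1 z w t s) \<le> \<kappa> ^ p * J p (ray_to_1 z t)"
proof
  define r where "r = max (cmod z) (cmod w)"
  define \<kappa> where "\<kappa> = 1 + cmod (w - z) / (1 - r)"
  have r: "r < 1" using z w by (auto simp: r_def)
  show \<kappa>: "0 \<le> \<kappa>" using r by (simp add: \<kappa>_def)
  fix t s :: real and p assume t: "0 < t" "t \<le> 1" and s: "0 \<le> s" "s \<le> 1"
  let ?v = "triangle_at_1 z w t s"
  show "J p ?v \<le> \<kappa> ^ p * J p (ray_to_1 z t)"
  proof (rule J_le[OF triangle_at_1_in_ball[OF z w t s] ray_to_1_in_ball[OF z t] \<kappa>])
    fix x assume x: "cmod x \<le> 1"
    have "t * (1 - r) \<le> 1 - cmod ?v" unfolding r_def using z w t s by (intro norm_triangle_at_1) auto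
    also have "\<dots> \<le> cmod (1 - cnj x * ?v)" by (rule norm_one_minus_cnj_mult_ge[OF x])
    finally have le: "t * (1 - r) \<le> cmod (1 - cnj x * ?v)" .
    have "?v - ray_to_1 z t = of_real (t * s) * (w - z)"
      by (simp add: triangle_at_1_def ray_to_1_def algebra_simps)
    then have "cmod (?v - ray_to_1 z t) = t * s * cmod (w - z)" using t s by (simp add: norm_mult)
    also have "\<dots> \<le> t * 1 * cmod (w - z)" using t s by (intro mult_mono) auto
    finally have d: "cmod (?v - ray_to_1 z t) \<le> t * cmod (w - z)" by simp
    have "1 - cnj x * ray_to_1 z t = (1 - cnj x * ?v) + cnj x * (?v - ray_to_1 z t)" by (simp add: algebra_simps)
    then have "cmod (1 - cnj x * ray_to_1 z t) \<le> cmod (1 - cnj x * ?v) + cmod (cnj x * (?v - ray_to_1 z t))"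
      by (metis norm_triangle_ineq)
    also have "cmod (cnj x * (?v - ray_to_1 z t)) \<le> 1 * (t * cmod (w - z))"
      unfolding norm_mult using x d by (intro mult_mono) auto
    also have "1 * (t * cmod (w - z)) = (t * (1 - r)) * (cmod (w - z) / (1 - r))" using r by simp
    also have "\<dots> \<le> cmod (1 - cnj x * ?v) * (cmod (w - z) / (1 - r))"
      using le r by (intro mult_right_mono) auto
    finally show "cmod (1 - cnj x * ray_to_1 z t) \<le> \<kappa> * cmod (1 - cnj x * ?v)"
      by (simp add: \<kappa>_def algebra_simps)
  qed
qed

text \<open>\<open>K j x\<close> is the value at \<open>x\<close> of the \<open>j\<close>-th
  derivative of \<open>kd b j x\<close>. Its value at \<open>z\<close> is at most
  \<open>sqrt (K j z * K j x)\<close> by Cauchy-Schwarz and the increment carries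
  \<open>sqrt (K j x)\<close> as well, so one root cancels.\<close>

lemma K_le_of_increment:
  assumes z: "z \<in> ball 0 1" and x: "x \<in> ball 0 1" and C: "0 \<le> C" and L: "0 \<le> L"
    and incr: "cmod ((deriv ^^ j) (kd b j x) x - (deriv ^^ j) (kd b j x) z) \<le> sqrt (C * K j x) * L"
  shows "K j x \<le> (sqrt C * L + sqrt (K j z))\<^sup>2"
proof (rule le_square_of_le_sqrt[OF K_nonneg[OF x]])
  have "(cmod (kernel_deriv b j j z x))\<^sup>2 \<le> K j z * K j x"
    by (rule kernel_deriv_Cauchy_Schwarz[OF z x])
  then have "cmod ((deriv ^^ j) (kd b j x) z) \<le> sqrt (K j z * K j x)"
    unfolding kernel_deriv_def by (rule real_le_rsqrt)
  moreover have "cmod ((deriv ^^ j) (kd b j x) x) = K j x"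
    using K_nonneg[OF x, of j] by (simp add: higher_deriv_kd_diag[OF x])
  ultimately have "K j x \<le> sqrt (K j z * K j x) + sqrt (C * K j x) * L"
    using incr norm_triangle_sub[of "(deriv ^^ j) (kd b j x) x" "(deriv ^^ j) (kd b j x) z"] by linarith
  then show "K j x \<le> sqrt (K j x) * (sqrt C * L + sqrt (K j z))"
    by (simp add: real_sqrt_mult algebra_simps)
qed

text \<open>The one extra derivative is charged to \<open>z\<close>, where the next order is
  controlled; only a root of \<open>K j x\<close> is left at \<open>x\<close>.\<close>

lemma deriv_higher_deriv_kd_le:
  assumes z: "z \<in> ball 0 1" and x: "x \<in> ball 0 1" and C: "K (Suc j) z \<le> C"
  shows "cmod (deriv ((deriv ^^ j) (kd b j x)) z) \<le> sqrt (C * K j x)"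
proof (rule real_le_rsqrt)
  have "(cmod (kernel_deriv b (Suc j) j z x))\<^sup>2 \<le> K (Suc j) z * K j x"
    by (rule kernel_deriv_Cauchy_Schwarz[OF z x])
  also have "\<dots> \<le> C * K j x" using C K_nonneg[OF x] by (intro mult_right_mono) auto
  finally show "(cmod (deriv ((deriv ^^ j) (kd b j x)) z))\<^sup>2 \<le> C * K j x"
    by (simp add: kernel_deriv_def)
qed

end

section \<open>Boundedness and convergence in an approach region\<close>

lemma finite_uniform_bound:
  fixes F :: "nat \<Rightarrow> 'a \<Rightarrow> real"
  assumes "\<And>j. j \<le> m \<Longrightarrow> \<exists>C. \<forall>x\<in>X. F j x \<le> C"
  shows "\<exists>C. \<forall>j\<le>m. \<forall>x\<in>X. F j x \<le> C"
  using assms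
proof (induction m)
  case 0
  then show ?case by simp
next
  case (Suc m)
  obtain C where C: "\<forall>j\<le>m. \<forall>x\<in>X. F j x \<le> C" using Suc by (meson le_SucI)
  obtain D where D: "\<forall>x\<in>X. F (Suc m) x \<le> D" using Suc.prems by blast
  have "F j x \<le> max C D" if "j \<le> Suc m" "x \<in> X" for j x
    using C D that by (cases "j = Suc m") (simp_all add: le_max_iff_disj)
  then show ?case by blast
qed

text \<open>The closure of the region meets the circle only at 1, so without a ball around 1 it is a
  compact subset of the open disk, on which the modulus attains its maximum.\<close>

lemma approach_region_bounded_away:
  assumes "approach_region \<Omega>" "0 < \<eta>"
  shows "\<exists>r<1. \<forall>z\<in>\<Omega>. \<eta> \<le> cmod (z - 1) \<longrightarrow> cmod z \<le> r"
proof -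
  have op: "open \<Omega>" and sub: "\<Omega> \<subseteq> ball 0 1" and fr: "frontier \<Omega> \<inter> sphere 0 1 = {1}"
    using assms by (auto simp: approach_region_def)
  define X where "X = closure \<Omega> - ball 1 \<eta>"
  have cl: "closure \<Omega> \<subseteq> cball 0 1"
    using sub by (intro closure_minimal) auto
  have X1: "cmod z < 1" if z: "z \<in> X" for z
  proof (rule ccontr)
    assume "\<not> cmod z < 1"
    then have z1: "z \<in> sphere 0 1" using z cl by (auto simp: X_def)
    then have "z \<notin> \<Omega>" using sub by auto
    then have "z \<in> frontier \<Omega>" using z op by (auto simp: X_def frontier_def interior_open)
    then have "z = 1" using fr z1 by blast
    then show False using z assms(2) by (simp add: X_def)
  qed
  have "compact X"
    unfolding X_def using bounded_subset[OF bounded_cball cl]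
    by (intro compact_diff) (auto simp: compact_eq_bounded_closed)
  show ?thesis
  proof (cases "X = {}")
    case True
    have "\<forall>z\<in>\<Omega>. \<eta> \<le> cmod (z - 1) \<longrightarrow> cmod z \<le> 0"
      using True closure_subset[of \<Omega>] by (auto simp: X_def dist_norm norm_minus_commute)
    then show ?thesis by (intro exI[of _ 0]) simp
  next
    case False
    then obtain x where x: "x \<in> X" "\<forall>z\<in>X. cmod z \<le> cmod x"
      using continuous_attains_sup[OF \<open>compact X\<close> False continuous_on_norm_id] by auto
    have "z \<in> X" if "z \<in> \<Omega>" "\<eta> \<le> cmod (z - 1)" for z
      using that closure_subset[of \<Omega>] by (auto simp: X_def dist_norm norm_minus_commute)
    then show ?thesis using x X1[OF x(1)] by (intro exI[of _ "cmod x"]) auto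
  qed
qed

section \<open>Control of lower orders inside the approach region\<close>

locale approach_limit = blaschke_limit +
  fixes \<Omega> :: "complex set" and \<delta> :: real
  assumes \<Omega>_subset: "\<Omega> \<subseteq> ball 0 1"
    and \<Omega>_limit: "0 < \<eta> \<Longrightarrow> \<exists>z\<in>\<Omega>. cmod (z - 1) < \<eta>"
    and \<Omega>_away: "0 < \<eta> \<Longrightarrow> \<exists>r<1. \<forall>z\<in>\<Omega>. \<eta> \<le> cmod (z - 1) \<longrightarrow> cmod z \<le> r"
    and \<delta>_pos: "0 < \<delta>"
    and \<Omega>_star: "z \<in> \<Omega> \<Longrightarrow> cmod (z - 1) < \<delta> \<Longrightarrow> closed_segment 1 z - {1} \<subseteq> \<Omega>"
begin

lemma \<Omega>_in_ball: "z \<in> \<Omega> \<Longrightarrow> z \<in> ball 0 1"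
  using \<Omega>_subset by blast

lemma one_notin_\<Omega>: "1 \<notin> \<Omega>"
  using \<Omega>_subset by auto

lemma ray_in_\<Omega>:
  assumes z: "z \<in> \<Omega>" "cmod (z - 1) < \<delta>" and t: "0 < t" "t \<le> 1"
  shows "ray_to_1 z t \<in> \<Omega>" "cmod (ray_to_1 z t - 1) < \<delta>"
proof -
  have "ray_to_1 z t = (1 - t) *\<^sub>R 1 + t *\<^sub>R z"
    by (simp add: ray_to_1_def scaleR_conv_of_real algebra_simps)
  then have "ray_to_1 z t \<in> closed_segment 1 z"
    unfolding in_segment using t by (intro exI[of _ t]) auto
  moreover have "ray_to_1 z t \<noteq> 1"
    using t z one_notin_\<Omega> by (auto simp: ray_to_1_def)
  ultimately show "ray_to_1 z t \<in> \<Omega>" using \<Omega>_star[OF z] by blast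
  have "t * cmod (z - 1) \<le> 1 * cmod (z - 1)" using t by (intro mult_right_mono) auto
  then show "cmod (ray_to_1 z t - 1) < \<delta>" using t z by (simp add: norm_ray_to_1_minus_1)
qed

lemma bounded_from_near_1:
  fixes F :: "complex \<Rightarrow> real"
  assumes "0 < \<eta>" "\<And>z. z \<in> \<Omega> \<Longrightarrow> cmod (z - 1) < \<eta> \<Longrightarrow> F z \<le> M"
    and far: "\<And>r. r < 1 \<Longrightarrow> \<exists>M. \<forall>z. cmod z \<le> r \<longrightarrow> F z \<le> M"
  shows "\<exists>M. \<forall>z\<in>\<Omega>. F z \<le> M"
proof -
  obtain r where r: "r < 1" "\<forall>z\<in>\<Omega>. \<eta> \<le> cmod (z - 1) \<longrightarrow> cmod z \<le> r"
    using \<Omega>_away[OF assms(1)] by blast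
  obtain M' where M': "\<forall>z. cmod z \<le> r \<longrightarrow> F z \<le> M'" using far[OF r(1)] by blast
  have "F z \<le> max M M'" if "z \<in> \<Omega>" for z
    using that r(2) M' assms(2)[of z] by (cases "cmod (z - 1) < \<eta>") (auto simp: le_max_iff_disj)
  then show ?thesis by blast
qed

lemma norm_minus_1_le_2: "z \<in> ball 0 1 \<Longrightarrow> cmod (z - 1) \<le> 2"
  using norm_triangle_ineq4[of z 1] by simp

lemma higher_deriv_kd_holomorphic:
  "x \<in> ball 0 1 \<Longrightarrow> (deriv ^^ j) (kd b j x) holomorphic_on ball 0 1"
  by (intro holomorphic_higher_deriv kd_holomorphic b_holomorphic) auto

text \<open>Downward induction: a bound of order \<open>j + 1\<close> on the ray bounds the
  increments of order \<open>j\<close>. The constant depends on the ray, through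
  \<open>K j z\<close>; this is enough to enter the triangle.\<close>

lemma K_ray_bound:
  assumes M: "\<And>z. z \<in> \<Omega> \<Longrightarrow> K m z \<le> M" and z: "z \<in> \<Omega>" "cmod (z - 1) < \<delta>" and "j \<le> m"
  shows "\<exists>C. \<forall>t\<in>{0<..1}. K j (ray_to_1 z t) \<le> C"
  using assms(4)
proof (induction j rule: inc_induct)
  case base
  have "\<forall>t\<in>{0<..1}. K m (ray_to_1 z t) \<le> M" using M ray_in_\<Omega>(1)[OF z] by simp
  then show ?case by blast
next
  case (step j)
  then obtain C where "\<forall>t\<in>{0<..1}. K (Suc j) (ray_to_1 z t) \<le> C" by blast
  then have C: "K (Suc j) (ray_to_1 z t) \<le> C" if "0 < t" "t \<le> 1" for t using that by simp
  have zb: "z \<in> ball 0 1" using z \<Omega>_in_ball by blast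
  have rb: "ray_to_1 z t \<in> ball 0 1" if "0 < t" "t \<le> 1" for t using ray_to_1_in_ball[OF zb that] .
  have C0: "0 \<le> C" using order_trans[OF K_nonneg[OF rb] C, of 1] by simp
  have "K j (ray_to_1 z t) \<le> (sqrt C * 2 + sqrt (K j z))\<^sup>2" if t: "0 < t" "t \<le> 1" for t
  proof (rule K_le_of_increment[OF zb rb[OF t] C0])
    let ?x = "ray_to_1 z t"
    have "cmod ((deriv ^^ j) (kd b j ?x) ?x - (deriv ^^ j) (kd b j ?x) z) \<le> sqrt (C * K j ?x) * cmod (z - 1)"
      using deriv_higher_deriv_kd_le[OF rb rb[OF t] C]
      by (intro norm_diff_le_along_ray higher_deriv_kd_holomorphic rb t zb) auto
    also have "\<dots> \<le> sqrt (C * K j ?x) * 2"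
      using norm_minus_1_le_2[OF zb] C0 K_nonneg[OF rb[OF t]] by (intro mult_left_mono) auto
    finally show "cmod ((deriv ^^ j) (kd b j ?x) ?x - (deriv ^^ j) (kd b j ?x) z) \<le> sqrt (C * K j ?x) * 2" .
  qed auto
  then show ?case by (intro exI[of _ "(sqrt C * 2 + sqrt (K j z))\<^sup>2"]) simp
qed

text \<open>The triangle may leave the region, where nothing is assumed about \<open>K\<close>. The
  detour is through the sums: bounds for \<open>K\<close> on the ray bound \<open>J\<close> there,
  the Stolz angle carries \<open>J\<close> over to the triangle, and \<open>J\<close> bounds
  \<open>K\<close> again.\<close>

lemma K_triangle_bound:
  assumes M: "\<And>z. z \<in> \<Omega> \<Longrightarrow> K m z \<le> M" and z: "z \<in> \<Omega>" "cmod (z - 1) < \<delta>" and w: "w \<in> ball 0 1"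
  shows "\<exists>t0>0. \<exists>C. \<forall>t s. 0 < t \<longrightarrow> t \<le> t0 \<longrightarrow> t \<le> 1 \<longrightarrow> 0 \<le> s \<longrightarrow> s \<le> 1
     \<longrightarrow> (\<forall>j\<le>m. K j (triangle_at_1 z w t s) \<le> C)"
proof -
  have zb: "z \<in> ball 0 1" using z \<Omega>_in_ball by blast
  have rb: "ray_to_1 z t \<in> ball 0 1" if "0 < t" "t \<le> 1" for t using ray_to_1_in_ball[OF zb that] .
  have "\<exists>C. \<forall>j\<le>m. \<forall>t\<in>{0<..1}. K j (ray_to_1 z t) \<le> C"
    by (rule finite_uniform_bound) (rule K_ray_bound[OF M z])
  then obtain C0 where C0: "\<forall>j\<le>m. \<forall>t\<in>{0<..1}. K j (ray_to_1 z t) \<le> C0" by blast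
  obtain \<eta>1 C1 where \<eta>1: "0 < \<eta>1"
    and C1: "\<forall>z\<in>ball 0 1. cmod (z - 1) < \<eta>1 \<longrightarrow> (\<forall>j\<le>m. K j z \<le> C0) \<longrightarrow> J (2*m+2) z \<le> C1"
    using J_bound_near_1[of m C0] by blast
  obtain \<kappa> where \<kappa>: "0 \<le> \<kappa>" "\<And>t s p. 0 < t \<Longrightarrow> t \<le> 1 \<Longrightarrow> 0 \<le> s \<Longrightarrow> s \<le> 1
    \<Longrightarrow> J p (triangle_at_1 z w t s) \<le> \<kappa> ^ p * J p (ray_to_1 z t)"
    by (rule J_triangle[OF zb w]) blast
  obtain \<eta>2 C2 where \<eta>2: "0 < \<eta>2"
    and C2: "\<forall>z\<in>ball 0 1. cmod (z - 1) < \<eta>2 \<longrightarrow> J (2*m+2) z \<le> \<kappa> ^ (2*m+2) * C1 \<longrightarrow> (\<forall>j\<le>m. K j z \<le> C2)"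
    using K_bound_near_1[of m "\<kappa> ^ (2*m+2) * C1"] by blast
  have "K j (triangle_at_1 z w t s) \<le> C2"
    \<comment> \<open>A point at parameter \<open>t\<close> is within \<open>2 * t\<close> of 1, so
      a quarter of each radius stays strictly inside both neighbourhoods.\<close>
    if t: "0 < t" "t \<le> min (\<eta>1/4) (\<eta>2/4)" "t \<le> 1" and s: "0 \<le> s" "s \<le> 1" and j: "j \<le> m" for t s j
  proof (rule C2[rule_format, OF triangle_at_1_in_ball[OF zb w t(1,3) s] _ _ j])
    have "cmod (triangle_at_1 z w t s - 1) \<le> 2 * t"
      using zb w t s by (intro norm_triangle_at_1_minus_1) auto
    also have "\<dots> < \<eta>2" using t \<eta>2 by auto
    finally show "cmod (triangle_at_1 z w t s - 1) < \<eta>2" .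
    have "cmod (ray_to_1 z t - 1) \<le> 2 * t"
      using norm_triangle_at_1_minus_1[OF zb zb t(1), of 0] by (simp add: triangle_at_1_0)
    also have "\<dots> < \<eta>1" using t \<eta>1 by auto
    finally have "J (2*m+2) (ray_to_1 z t) \<le> C1"
      using C1[rule_format, OF rb[OF t(1,3)]] C0 t by auto
    then have "\<kappa> ^ (2*m+2) * J (2*m+2) (ray_to_1 z t) \<le> \<kappa> ^ (2*m+2) * C1"
      using \<kappa>(1) by (intro mult_left_mono) auto
    then show "J (2*m+2) (triangle_at_1 z w t s) \<le> \<kappa> ^ (2*m+2) * C1"
      using \<kappa>(2)[OF t(1,3) s] order_trans by blast
  qed
  then show ?thesis
    using \<eta>1 \<eta>2
    by (rule_tac exI[of _ "min (\<eta>1/4) (\<eta>2/4)"], rule_tac conjI, simp, rule_tac exI[of _ C2], blast)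
qed

text \<open>Downward induction with a fixed base point \<open>z\<close>, joined to \<open>x\<close>
  through 1. The bound \<open>C'\<close> in the triangle depends on \<open>x\<close> but disappears
  from the increment; the 4 bounds \<open>|z - 1| + |x - 1|\<close>.\<close>

lemma K_lower_orders_bound:
  assumes M: "\<And>z. z \<in> \<Omega> \<Longrightarrow> K m z \<le> M" and "j \<le> m"
  shows "\<exists>C. \<forall>z\<in>{z \<in> \<Omega>. cmod (z - 1) < \<delta>}. K j z \<le> C"
  using assms(2)
proof (induction j rule: inc_induct)
  case base
  then show ?case using M by auto
next
  case (step j)
  then obtain C where "\<forall>z\<in>{z \<in> \<Omega>. cmod (z - 1) < \<delta>}. K (Suc j) z \<le> C" by blast
  then have C: "K (Suc j) z \<le> C" if "z \<in> \<Omega>" "cmod (z - 1) < \<delta>" for z using that by simp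
  obtain z where z: "z \<in> \<Omega>" "cmod (z - 1) < \<delta>" using \<Omega>_limit[OF \<delta>_pos] by blast
  have zb: "z \<in> ball 0 1" using z \<Omega>_in_ball by blast
  have C0: "0 \<le> C" using order_trans[OF K_nonneg[OF zb] C[OF z]] .
  have "K j x \<le> (sqrt C * 4 + sqrt (K j z))\<^sup>2" if x: "x \<in> \<Omega>" "cmod (x - 1) < \<delta>" for x
  proof -
    have xb: "x \<in> ball 0 1" using x \<Omega>_in_ball by blast
    obtain t0 C' where t0: "0 < t0" and C': "\<forall>t s. 0 < t \<longrightarrow> t \<le> t0 \<longrightarrow> t \<le> 1 \<longrightarrow> 0 \<le> s \<longrightarrow> s \<le> 1
       \<longrightarrow> (\<forall>j\<le>m. K j (triangle_at_1 z x t s) \<le> C')"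
      using K_triangle_bound[OF M z xb] by blast
    show ?thesis
    proof (rule K_le_of_increment[OF zb xb C0])
      have "cmod ((deriv ^^ j) (kd b j x) z - (deriv ^^ j) (kd b j x) x)
          \<le> sqrt (C * K j x) * (cmod (z - 1) + cmod (x - 1))"
      proof (rule norm_diff_le_through_1[OF higher_deriv_kd_holomorphic[OF xb] zb xb _ _ t0])
        fix t :: real assume t: "0 < t" "t \<le> 1"
        show "cmod (deriv ((deriv ^^ j) (kd b j x)) (ray_to_1 z t)) \<le> sqrt (C * K j x)"
          using ray_in_\<Omega>[OF z t] by (intro deriv_higher_deriv_kd_le xb C \<Omega>_in_ball)
        show "cmod (deriv ((deriv ^^ j) (kd b j x)) (ray_to_1 x t)) \<le> sqrt (C * K j x)"
          using ray_in_\<Omega>[OF x t] by (intro deriv_higher_deriv_kd_le xb C \<Omega>_in_ball)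
      next
        fix t s :: real assume "0 < t" "t \<le> t0" "t \<le> 1" "0 \<le> s" "s \<le> 1"
        then show "cmod (deriv ((deriv ^^ j) (kd b j x)) (triangle_at_1 z x t s)) \<le> sqrt (C' * K j x)"
          using C' step.hyps by (intro deriv_higher_deriv_kd_le triangle_at_1_in_ball xb zb) auto
      qed
      also have "\<dots> \<le> sqrt (C * K j x) * 4"
        using norm_minus_1_le_2[OF zb] norm_minus_1_le_2[OF xb] C0 K_nonneg[OF xb]
        by (intro mult_left_mono) auto
      finally show "cmod ((deriv ^^ j) (kd b j x) x - (deriv ^^ j) (kd b j x) z) \<le> sqrt (C * K j x) * 4"
        by (simp only: norm_minus_commute)
    qed auto
  qed
  then show ?case by (intro exI[of _ "(sqrt C * 4 + sqrt (K j z))\<^sup>2"]) simp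
qed

lemma J_bounded_if_K_bounded:
  assumes M: "\<And>z. z \<in> \<Omega> \<Longrightarrow> K m z \<le> M"
  shows "\<exists>C. \<forall>z\<in>\<Omega>. J (2*m+2) z \<le> C"
proof -
  have "\<exists>C. \<forall>j\<le>m. \<forall>z\<in>{z \<in> \<Omega>. cmod (z - 1) < \<delta>}. K j z \<le> C"
    by (rule finite_uniform_bound) (rule K_lower_orders_bound[OF M])
  then obtain C where C: "\<forall>j\<le>m. \<forall>z\<in>{z \<in> \<Omega>. cmod (z - 1) < \<delta>}. K j z \<le> C" by blast
  obtain \<eta> C1 where \<eta>: "0 < \<eta>"
    and C1: "\<forall>z\<in>ball 0 1. cmod (z - 1) < \<eta> \<longrightarrow> (\<forall>j\<le>m. K j z \<le> C) \<longrightarrow> J (2*m+2) z \<le> C1"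
    using J_bound_near_1[of m C] by blast
  show ?thesis
  proof (rule bounded_from_near_1[of "min \<delta> \<eta>" _ C1])
    show "0 < min \<delta> \<eta>" using \<eta> \<delta>_pos by simp
    show "J (2*m+2) z \<le> C1" if "z \<in> \<Omega>" "cmod (z - 1) < min \<delta> \<eta>" for z
      using C1[rule_format, OF \<Omega>_in_ball] C that by auto
    show "\<exists>M. \<forall>z. cmod z \<le> r \<longrightarrow> J (2*m+2) z \<le> M" if r: "r < 1" for r
    proof -
      obtain M where "\<And>z. cmod z \<le> r \<Longrightarrow> J (2*m+2) z \<le> M" by (rule J_compact_bound[OF r]) blast
      then show ?thesis by blast
    qed
  qed
qed

lemma K_bounded_if_J_bounded:
  assumes M: "\<And>z. z \<in> \<Omega> \<Longrightarrow> J (2*m+2) z \<le> M"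
  shows "\<exists>C. \<forall>z\<in>\<Omega>. K m z \<le> C"
proof -
  obtain \<eta> C1 where \<eta>: "0 < \<eta>"
    and C1: "\<forall>z\<in>ball 0 1. cmod (z - 1) < \<eta> \<longrightarrow> J (2*m+2) z \<le> M \<longrightarrow> (\<forall>j\<le>m. K j z \<le> C1)"
    using K_bound_near_1[of m M] by blast
  show ?thesis
  proof (rule bounded_from_near_1[OF \<eta>, of _ C1])
    show "K m z \<le> C1" if "z \<in> \<Omega>" "cmod (z - 1) < \<eta>" for z
      using C1[rule_format, OF \<Omega>_in_ball] M that by auto
    show "\<exists>M. \<forall>z. cmod z \<le> r \<longrightarrow> K m z \<le> M" if r: "r < 1" for r
    proof -
      obtain M where "\<And>z. cmod z \<le> r \<Longrightarrow> K m z \<le> M" by (rule K_compact_bound[OF r]) blast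
      then show ?thesis by blast
    qed
  qed
qed

text \<open>Boundedness of the sums of order \<open>2 * m + 2\<close> controls \<open>2 * m + 1\<close> derivatives of \<open>b\<close>, so
  those of order at most \<open>m\<close> are Lipschitz along rays.\<close>
lemma higher_deriv_b_convergent:
  assumes M: "\<And>z. z \<in> \<Omega> \<Longrightarrow> J (2*m+2) z \<le> M" and j: "j \<le> m"
  shows "\<exists>L. ((deriv ^^ j) b \<longlongrightarrow> L) (at 1 within \<Omega>)"
proof -
  obtain \<eta> C where \<eta>: "0 < \<eta>"
    and C: "\<forall>z\<in>ball 0 1. cmod (z - 1) < \<eta> \<longrightarrow> J (2*m+2) z \<le> M \<longrightarrow> (\<forall>j\<le>2*m+1. cmod ((deriv ^^ j) b z) \<le> C)"
    using deriv_b_bound_near_1[of m M] by blast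
  let ?g = "(deriv ^^ j) b"
  have g: "?g holomorphic_on ball 0 1" by (intro holomorphic_higher_deriv b_holomorphic) auto
  have dg: "cmod (deriv ?g z) \<le> C" if "z \<in> \<Omega>" "cmod (z - 1) < \<eta>" for z
    using C[rule_format, OF \<Omega>_in_ball[OF that(1)] that(2) M[OF that(1)], of "Suc j"] j by simp
  obtain z0 where z0: "z0 \<in> \<Omega>" "cmod (z0 - 1) < \<eta>" using \<Omega>_limit[OF \<eta>] by blast
  have C0: "0 \<le> C" by (rule order_trans[OF norm_ge_zero dg[OF z0]])
  have lip: "cmod (?g z - ?g w) \<le> C * (cmod (z - 1) + cmod (w - 1))"
    if z: "z \<in> \<Omega>" "cmod (z - 1) < min \<delta> \<eta>" and w: "w \<in> \<Omega>" "cmod (w - 1) < min \<delta> \<eta>" for z w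
  proof -
    have zb: "z \<in> ball 0 1" and wb: "w \<in> ball 0 1" using z w \<Omega>_in_ball by auto
    \<comment> \<open>The constants of the triangle depend on \<open>z\<close> and \<open>w\<close>.
      They only have to exist, as the Lipschitz bound retains nothing but \<open>C\<close>.\<close>
    obtain \<kappa> where \<kappa>: "0 \<le> \<kappa>" "\<And>t s p. 0 < t \<Longrightarrow> t \<le> 1 \<Longrightarrow> 0 \<le> s \<Longrightarrow> s \<le> 1
      \<Longrightarrow> J p (triangle_at_1 z w t s) \<le> \<kappa> ^ p * J p (ray_to_1 z t)"
      by (rule J_triangle[OF zb wb]) blast
    obtain \<eta>' C' where \<eta>': "0 < \<eta>'"
      and C': "\<forall>z\<in>ball 0 1. cmod (z - 1) < \<eta>' \<longrightarrow> J (2*m+2) z \<le> \<kappa> ^ (2*m+2) * M \<longrightarrow> (\<forall>j\<le>2*m+1. cmod ((deriv ^^ j) b z) \<le> C')"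
      using deriv_b_bound_near_1[of m "\<kappa> ^ (2*m+2) * M"] by blast
    have ray: "cmod (deriv ?g (ray_to_1 x t)) \<le> C" if x: "x \<in> \<Omega>" "cmod (x - 1) < min \<delta> \<eta>" and t: "0 < t" "t \<le> 1" for x t
    proof (rule dg)
      show "ray_to_1 x t \<in> \<Omega>" using x t by (intro ray_in_\<Omega>) auto
      have "t * cmod (x - 1) \<le> 1 * cmod (x - 1)" using t by (intro mult_right_mono) auto
      then show "cmod (ray_to_1 x t - 1) < \<eta>" using t x by (simp add: norm_ray_to_1_minus_1)
    qed
    show ?thesis
    proof (rule norm_diff_le_through_1[OF g zb wb, where ?t0.0 = "\<eta>' / 4"])
      show "cmod (deriv ?g (ray_to_1 z t)) \<le> C" if "0 < t" "t \<le> 1" for t using ray[OF z that] .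
      show "cmod (deriv ?g (ray_to_1 w t)) \<le> C" if "0 < t" "t \<le> 1" for t using ray[OF w that] .
      show "0 < \<eta>' / 4" using \<eta>' by simp
      fix t s :: real assume t: "0 < t" "t \<le> \<eta>' / 4" "t \<le> 1" and s: "0 \<le> s" "s \<le> 1"
      have vb: "triangle_at_1 z w t s \<in> ball 0 1" using zb wb t s by (intro triangle_at_1_in_ball) auto
      have "cmod (triangle_at_1 z w t s - 1) \<le> 2 * t"
        using zb wb t s by (intro norm_triangle_at_1_minus_1) auto
      then have near: "cmod (triangle_at_1 z w t s - 1) < \<eta>'" using t \<eta>' by simp
      have "J (2*m+2) (triangle_at_1 z w t s) \<le> \<kappa> ^ (2*m+2) * J (2*m+2) (ray_to_1 z t)"
        using t s by (intro \<kappa>(2)) auto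
      also have "\<dots> \<le> \<kappa> ^ (2*m+2) * M"
        using \<kappa>(1) z t by (intro mult_left_mono M ray_in_\<Omega>) auto
      finally show "cmod (deriv ?g (triangle_at_1 z w t s)) \<le> C'"
        using C'[rule_format, OF vb near, of "Suc j"] j by simp
    qed
  qed
  show ?thesis
  proof (rule Cauchy_at_within_convergent)
    fix e :: real assume e: "0 < e"
    define \<eta>3 where "\<eta>3 = min (min \<delta> \<eta>) (e / (2 * (C + 1)))"
    have "cmod (?g z - ?g w) < e" if "z \<in> \<Omega>" "w \<in> \<Omega>" "cmod (z - 1) < \<eta>3" "cmod (w - 1) < \<eta>3" for z w
    proof -
      have "cmod (?g z - ?g w) \<le> C * (cmod (z - 1) + cmod (w - 1))"
        using that by (intro lip) (auto simp: \<eta>3_def)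
      also have "\<dots> \<le> C * (e / (2 * (C + 1)) + e / (2 * (C + 1)))"
        using that C0 by (intro mult_left_mono add_mono) (auto simp: \<eta>3_def)
      also have "\<dots> = C * e / (C + 1)"
        using field_sum_of_halves[of "e / (C + 1)"] by (simp add: mult.commute)
      also have "\<dots> < e" using C0 e by (simp add: field_simps)
      finally show ?thesis .
    qed
    moreover have "0 < \<eta>3" using \<delta>_pos \<eta> e C0 by (simp add: \<eta>3_def)
    ultimately show "\<exists>\<eta>>0. \<forall>z\<in>\<Omega>. \<forall>w\<in>\<Omega>. cmod (z - 1) < \<eta> \<longrightarrow> cmod (w - 1) < \<eta> \<longrightarrow> cmod (?g z - ?g w) < e"
      by blast
  qed
qed

section \<open>Convergence of kernel combinations and of general functions\<close>

lemma eventually_in_\<Omega>: "eventually (\<lambda>z. z \<in> \<Omega>) (at 1 within \<Omega>)"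
  by (simp add: eventually_at_filter)

text \<open>The derivatives of the Szego kernel are continuous at 1 since \<open>|w| < 1\<close>, so
  only the derivatives of \<open>b\<close> of order at most \<open>m\<close> have to
  converge.\<close>

lemma kernel_deriv_convergent:
  assumes M: "\<And>z. z \<in> \<Omega> \<Longrightarrow> J (2*m+2) z \<le> M" and w: "w \<in> ball 0 1"
  shows "\<exists>L. ((\<lambda>z. kernel_deriv b m 0 z w) \<longlongrightarrow> L) (at 1 within \<Omega>)"
proof -
  define A where "A q z = fact q * cnj w ^ q / (1 - cnj w * z) ^ Suc q" for q z
  have A: "(deriv ^^ q) (szego_deriv 0 w) z = A q z" if z: "z \<in> ball 0 1" for q z
  proof -
    have "szego_deriv 0 w = (\<lambda>z. 1 / (1 - cnj w * z))" by (simp add: szego_deriv_def fun_eq_iff)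
    then show ?thesis
      using one_minus_cnj_mult_nonzero[of w z] w z by (simp add: A_def higher_deriv_inverse_one_minus)
  qed
  have A_lim: "(A q \<longlongrightarrow> A q 1) (at 1 within \<Omega>)" for q
  proof -
    have "1 - cnj w * 1 \<noteq> 0" using one_minus_cnj_mult_nonzero[of "1" "cnj w"] w by simp
    then have "(1 - cnj w * 1) ^ Suc q \<noteq> 0" by (simp only: power_not_zero not_False_eq_True)
    then show ?thesis
      unfolding A_def[abs_def]
      by (intro tendsto_divide tendsto_power tendsto_diff tendsto_mult tendsto_const tendsto_ident_at)
  qed
  have "\<forall>p. \<exists>L. p \<le> m \<longrightarrow> ((deriv ^^ p) b \<longlongrightarrow> L) (at 1 within \<Omega>)"
    using higher_deriv_b_convergent[OF M] by blast
  from choice[OF this] obtain L where L: "\<And>p. p \<le> m \<Longrightarrow> ((deriv ^^ p) b \<longlongrightarrow> L p) (at 1 within \<Omega>)" by blast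
  have "((\<lambda>z. A m z - cnj (b w) * (\<Sum>p = 0..m. of_nat (m choose p) * (deriv ^^ p) b z * A (m - p) z)) \<longlongrightarrow>
     A m 1 - cnj (b w) * (\<Sum>p = 0..m. of_nat (m choose p) * L p * A (m - p) 1)) (at 1 within \<Omega>)"
    by (intro tendsto_diff tendsto_mult tendsto_sum tendsto_const A_lim L) auto
  moreover have "eventually (\<lambda>z. A m z - cnj (b w) * (\<Sum>p = 0..m. of_nat (m choose p) * (deriv ^^ p) b z * A (m - p) z)
     = kernel_deriv b m 0 z w) (at 1 within \<Omega>)"
    using eventually_in_\<Omega>
  proof eventually_elim
    case (elim z)
    then have z: "z \<in> ball 0 1" by (rule \<Omega>_in_ball)
    show ?case
      unfolding kernel_deriv_eq[OF b_holomorphic w z] by (simp add: A[OF z])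
  qed
  ultimately show ?thesis by (intro exI) (rule Lim_transform_eventually)
qed

lemma higher_deriv_kernel_comb_convergent:
  assumes M: "\<And>z. z \<in> \<Omega> \<Longrightarrow> J (2*m+2) z \<le> M" and S: "S \<subseteq> ball 0 1"
  shows "\<exists>L. ((deriv ^^ m) (kernel_comb b S d) \<longlongrightarrow> L) (at 1 within \<Omega>)"
proof -
  have "\<forall>w. \<exists>L. w \<in> ball 0 1 \<longrightarrow> ((\<lambda>z. kernel_deriv b m 0 z w) \<longlongrightarrow> L) (at 1 within \<Omega>)"
    using kernel_deriv_convergent[OF M] by blast
  from choice[OF this] obtain L where L: "\<And>w. w \<in> ball 0 1 \<Longrightarrow> ((\<lambda>z. kernel_deriv b m 0 z w) \<longlongrightarrow> L w) (at 1 within \<Omega>)" by blast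
  have "((\<lambda>z. \<Sum>w\<in>S. cnj (d w) * kernel_deriv b m 0 z w) \<longlongrightarrow> (\<Sum>w\<in>S. cnj (d w) * L w)) (at 1 within \<Omega>)"
    using S by (intro tendsto_sum tendsto_mult tendsto_const L) auto
  moreover have "eventually (\<lambda>z. (\<Sum>w\<in>S. cnj (d w) * kernel_deriv b m 0 z w) = (deriv ^^ m) (kernel_comb b S d) z) (at 1 within \<Omega>)"
    using eventually_in_\<Omega> by eventually_elim (simp add: higher_deriv_kernel_comb[OF S \<Omega>_in_ball])
  ultimately show ?thesis by (intro exI) (rule Lim_transform_eventually)
qed

text \<open>On the region the bound for \<open>K\<close> makes the derivative functionals
  equicontinuous on H(b). Convergence thus extends from the dense combinations of kernels to every
  \<open>f\<close>.\<close>

lemma higher_deriv_convergent: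
  assumes M: "\<And>z. z \<in> \<Omega> \<Longrightarrow> K m z \<le> M" and f: "in_Hb b f"
  shows "\<exists>L. ((deriv ^^ m) f \<longlongrightarrow> L) (at 1 within \<Omega>)"
proof (rule Cauchy_at_within_convergent)
  fix e :: real assume e: "0 < e"
  obtain MJ where MJ: "\<forall>z\<in>\<Omega>. J (2*m+2) z \<le> MJ" using J_bounded_if_K_bounded[OF M] by blast
  obtain C where hol: "f holomorphic_on ball 0 1" and dom: "hb_dom b C f"
    using f unfolding in_Hb_def by blast
  define D where "D = \<bar>M\<bar> + 1"
  have D: "0 < D" "M \<le> D" by (simp_all add: D_def)
  \<comment> \<open>Chosen so that \<open>\<epsilon> * D\<close> is the square of
    \<open>e/4\<close>, the admissible error in the derivative at each of the two points.\<close>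
  define \<epsilon> where "\<epsilon> = (e/4)\<^sup>2 / D"
  have \<epsilon>: "0 < \<epsilon>" unfolding \<epsilon>_def using e D(1) by (intro divide_pos_pos zero_less_power) auto
  obtain S d where S: "S \<subseteq> ball 0 1" and g: "hb_dom b \<epsilon> (\<lambda>z. f z - kernel_comb b S d z)"
    using kernel_comb_dense[OF dom \<epsilon>] by blast
  let ?k = "(deriv ^^ m) (kernel_comb b S d)"
  have hk: "kernel_comb b S d holomorphic_on ball 0 1" by (rule kernel_comb_holomorphic[OF b_holomorphic S])
  have err: "cmod ((deriv ^^ m) f z - ?k z) \<le> e/4" if z: "z \<in> \<Omega>" for z
  proof -
    have zb: "z \<in> ball 0 1" using z by (rule \<Omega>_in_ball)
    have "(cmod ((deriv ^^ m) (\<lambda>z. f z - kernel_comb b S d z) z))\<^sup>2 \<le> \<epsilon> * K m z"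
      by (rule hb_dom_higher_deriv[OF holomorphic_on_diff[OF hol hk] g zb])
    also have "\<dots> \<le> \<epsilon> * D"
    proof (rule mult_left_mono)
      show "K m z \<le> D" using M[OF z] D(2) by (rule order_trans)
    qed (use \<epsilon> in simp)
    also have "\<dots> = (e/4)\<^sup>2" using D(1) by (simp add: \<epsilon>_def)
    finally have "cmod ((deriv ^^ m) (\<lambda>z. f z - kernel_comb b S d z) z) \<le> e/4"
      by (rule power2_le_imp_le) (use e in simp)
    then show ?thesis unfolding higher_deriv_diff[OF hol hk open_ball zb] .
  qed
  obtain L where "(?k \<longlongrightarrow> L) (at 1 within \<Omega>)"
    using higher_deriv_kernel_comb_convergent[of m MJ S d] MJ S by blast
  then have "eventually (\<lambda>z. dist (?k z) L < e/4) (at 1 within \<Omega>)" by (rule tendstoD) (use e in simp)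
  then obtain \<eta> where \<eta>: "0 < \<eta>" "\<forall>z\<in>\<Omega>. z \<noteq> 1 \<and> dist z 1 < \<eta> \<longrightarrow> dist (?k z) L < e/4"
    unfolding eventually_at by blast
  have "cmod ((deriv ^^ m) f z - (deriv ^^ m) f w) < e"
    if "z \<in> \<Omega>" "w \<in> \<Omega>" "cmod (z - 1) < \<eta>" "cmod (w - 1) < \<eta>" for z w
  proof -
    have ne: "z \<noteq> 1" "w \<noteq> 1" using that one_notin_\<Omega> by auto
    have k: "dist (?k z) L < e/4" "dist (?k w) L < e/4"
      using \<eta>(2)[rule_format, of z] \<eta>(2)[rule_format, of w] that ne by (simp_all add: dist_norm)
    have "dist (?k z) (?k w) < e/4 + e/4" using dist_triangle2[of "?k z" "?k w" L] k by linarith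
    moreover have "dist ((deriv ^^ m) f z) ((deriv ^^ m) f w)
       \<le> dist ((deriv ^^ m) f z) (?k z) + (dist (?k z) (?k w) + dist (?k w) ((deriv ^^ m) f w))"
      using dist_triangle[of "(deriv ^^ m) f z" "(deriv ^^ m) f w" "?k z"]
        dist_triangle[of "?k z" "(deriv ^^ m) f w" "?k w"] by linarith
    moreover have "dist ((deriv ^^ m) f z) (?k z) \<le> e/4" "dist (?k w) ((deriv ^^ m) f w) \<le> e/4"
      using err[OF that(1)] err[OF that(2)] by (simp_all only: dist_norm norm_minus_commute)
    ultimately show ?thesis by (simp add: dist_norm)
  qed
  then show "\<exists>\<eta>>0. \<forall>z\<in>\<Omega>. \<forall>w\<in>\<Omega>. cmod (z - 1) < \<eta> \<longrightarrow> cmod (w - 1) < \<eta> \<longrightarrow>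
      cmod ((deriv ^^ m) f z - (deriv ^^ m) f w) < e"
    using \<eta>(1) by blast
qed

end

section \<open>Gliding hump: unbounded norms produce a divergent derivative\<close>

lemma sum_third_powers_le: "(\<Sum>l<i. (1/3::real) ^ (k + l)) \<le> 3/2 * (1/3) ^ k"
proof -
  have "(\<Sum>l<i. (1/3::real) ^ (k + l)) = (1/3) ^ k * (\<Sum>l<i. (1/3) ^ l)"
    by (simp add: power_add sum_distrib_left)
  also have "(\<Sum>l<i. (1/3::real) ^ l) = (1 - (1/3) ^ i) / (1 - 1/3)"
    by (subst sum_gp_strict) simp
  also have "(1/3::real) ^ k * ((1 - (1/3) ^ i) / (1 - 1/3)) \<le> (1/3) ^ k * (3/2)"
    by (intro mult_left_mono) auto
  finally show ?thesis by simp
qed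

text \<open>The sign agrees with that of the real part, so the added real number cannot be
  cancelled.\<close>

lemma norm_add_signed_ge:
  fixes \<alpha> :: complex and r :: real
  assumes "0 \<le> r"
  shows "r \<le> cmod (\<alpha> + (if 0 \<le> Re \<alpha> then 1 else - 1) * of_real r)"
proof -
  have "r \<le> \<bar>Re (\<alpha> + (if 0 \<le> Re \<alpha> then 1 else - 1) * of_real r)\<bar>"
    using assms by auto
  then show ?thesis using abs_Re_le_cmod order_trans by blast
qed

context approach_limit
begin

context
  fixes m :: nat and zz :: "nat \<Rightarrow> complex"
  assumes zz: "zz k \<in> ball 0 1" and K_large: "(4 ^ k)\<^sup>2 < K m (zz k)"
begin

definition N :: "nat \<Rightarrow> real" where "N k = sqrt (K m (zz k))"

definition normalized_kd :: "nat \<Rightarrow> complex \<Rightarrow> complex" where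
  "normalized_kd k x = inverse (of_real (N k)) * kd b m (zz k) x"

text \<open>The sign at stage \<open>k\<close> prevents cancellation with the previous partial sum
  at \<open>zz k\<close>. With ratio 1/3 the tail after term \<open>k\<close> has norm at most
  \<open>3/2 * (1/3)^(k+1)\<close>, which is half of the weight \<open>(1/3)^k\<close>; the growth
  \<open>4^k\<close> of the norms then beats the weights.\<close>

fun hump :: "nat \<Rightarrow> complex \<Rightarrow> complex" where
  "hump 0 = (\<lambda>x. 0)"
| "hump (Suc k) = (\<lambda>x. hump k x
    + ((if 0 \<le> Re ((deriv ^^ m) (hump k) (zz k)) then 1 else - 1) * of_real ((1/3) ^ k)) * normalized_kd k x)"

definition hump_term :: "nat \<Rightarrow> complex \<Rightarrow> complex" where
  "hump_term k x = ((if 0 \<le> Re ((deriv ^^ m) (hump k) (zz k)) then 1 else - 1) * of_real ((1/3) ^ k)) * normalized_kd k x"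

lemma N_gt: "4 ^ k < N k"
  unfolding N_def using K_large[of k] by (rule real_less_rsqrt)

lemma N_pos: "0 < N k"
  using N_gt[of k] less_trans[of 0 "4 ^ k" "N k"] by simp

lemma N_square: "(N k)\<^sup>2 = K m (zz k)"
  using K_nonneg[OF zz] by (simp add: N_def)

lemma normalized_kd_holomorphic: "normalized_kd k holomorphic_on ball 0 1"
  unfolding normalized_kd_def[abs_def]
  by (intro holomorphic_on_mult holomorphic_on_const kd_holomorphic b_holomorphic zz)

lemma hump_term_holomorphic: "hump_term k holomorphic_on ball 0 1"
  unfolding hump_term_def[abs_def]
  by (intro holomorphic_on_mult holomorphic_on_const normalized_kd_holomorphic)

lemma hump_Suc: "hump (Suc k) x = hump k x + hump_term k x"
  by (simp add: hump_term_def)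

lemma hump_eq_sum: "hump k x = (\<Sum>l<k. hump_term l x)"
proof (induction k)
  case (Suc k)
  then show ?case unfolding hump_Suc by simp
qed simp

lemma hump_holomorphic: "hump k holomorphic_on ball 0 1"
  unfolding hump_eq_sum[abs_def] by (intro holomorphic_on_sum hump_term_holomorphic)

lemma hb_dom_normalized_kd: "hb_dom b 1 (normalized_kd k)"
proof -
  have "(cmod (inverse (of_real (N k))))\<^sup>2 * K m (zz k) = 1"
    using N_pos[of k] unfolding N_square[symmetric] by (simp add: norm_inverse power_inverse)
  then show ?thesis
    using hb_dom_scale[OF hb_dom_kd[OF zz[of k], of m], of "inverse (of_real (N k))"]
    by (simp add: normalized_kd_def[abs_def])
qed

lemma hb_dom_hump_term: "hb_dom b (((1/3) ^ k)\<^sup>2) (hump_term k)"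
proof -
  let ?s = "(if 0 \<le> Re ((deriv ^^ m) (hump k) (zz k)) then 1 else - 1) * complex_of_real ((1/3) ^ k)"
  have "(cmod ?s)\<^sup>2 * 1 = ((1/3) ^ k)\<^sup>2"
    by (simp add: norm_mult norm_power norm_divide)
  then show ?thesis
    using hb_dom_scale[OF hb_dom_normalized_kd[of k], of ?s] by (simp only: hump_term_def[abs_def])
qed

lemma hump_diff: "hump (k + i) x - hump k x = (\<Sum>l<i. hump_term (k + l) x)"
proof (induction i)
  case (Suc i)
  have "hump (k + Suc i) x = hump (k + i) x + hump_term (k + i) x"
    using hump_Suc[of "k + i"] by (simp del: hump.simps)
  then show ?case using Suc by (simp del: hump.simps)
qed simp

lemma hb_dom_hump_diff: "hb_dom b ((3/2 * (1/3) ^ k)\<^sup>2) (\<lambda>x. hump (k + i) x - hump k x)"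
proof -
  have "hb_dom b ((\<Sum>l<i. (1/3) ^ (k + l))\<^sup>2) (\<lambda>x. \<Sum>l<i. hump_term (k + l) x)"
  proof (induction i)
    case 0
    show ?case by (simp add: hb_dom_iff)
  next
    case (Suc i)
    have "hb_dom b (((\<Sum>l<i. (1/3) ^ (k + l)) + (1/3) ^ (k + i))\<^sup>2) (\<lambda>x. (\<Sum>l<i. hump_term (k + l) x) + hump_term (k + i) x)"
      by (rule hb_dom_add[OF Suc hb_dom_hump_term]) (auto intro: sum_nonneg)
    then show ?case by simp
  qed
  moreover have "(\<Sum>l<i. (1/3::real) ^ (k + l))\<^sup>2 \<le> (3/2 * (1/3) ^ k)\<^sup>2"
    by (intro power_mono sum_third_powers_le sum_nonneg) auto
  ultimately show ?thesis unfolding hump_diff by (rule hb_dom_mono)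
qed

definition hump_sum :: "complex \<Rightarrow> complex" where "hump_sum x = (\<Sum>k. hump_term k x)"

lemma norm_hump_term_le:
  assumes x: "cmod x \<le> r" and r: "r < 1"
  shows "cmod (hump_term k x) \<le> (1/3) ^ k * sqrt (1 / (1 - r\<^sup>2))"
proof -
  have xb: "x \<in> ball 0 1" using x r by simp
  have r0: "0 \<le> r" using x norm_ge_zero[of x] by linarith
  have "(cmod (hump_term k x))\<^sup>2 \<le> ((1/3) ^ k)\<^sup>2 * ((1 - (cmod (b x))\<^sup>2) / (1 - (cmod x)\<^sup>2))"
    by (rule hb_dom_point[OF hb_dom_hump_term xb])
  also have "\<dots> \<le> ((1/3) ^ k)\<^sup>2 * (1 / (1 - r\<^sup>2))"
  proof (intro mult_left_mono order_trans[OF kb_diag_le[OF xb]] divide_left_mono)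
    show "1 - r\<^sup>2 \<le> 1 - (cmod x)\<^sup>2" using x by (simp add: power_mono)
    show "0 < (1 - (cmod x)\<^sup>2) * (1 - r\<^sup>2)"
      using xb r r0 by (intro mult_pos_pos) (auto simp: abs_square_less_1)
  qed auto
  finally have "cmod (hump_term k x) \<le> sqrt (((1/3) ^ k)\<^sup>2 * (1 / (1 - r\<^sup>2)))" by (rule real_le_rsqrt)
  then show ?thesis unfolding real_sqrt_mult by simp
qed

lemma uniform_limit_hump:
  assumes r: "r < 1" and A: "\<And>x. x \<in> A \<Longrightarrow> cmod x \<le> r"
  shows "uniform_limit A hump hump_sum sequentially"
proof -
  have "uniform_limit A (\<lambda>n x. \<Sum>k<n. hump_term k x) (\<lambda>x. \<Sum>k. hump_term k x) sequentially"
  proof (rule Weierstrass_m_test)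
    show "norm (hump_term k x) \<le> (1/3) ^ k * sqrt (1 / (1 - r\<^sup>2))" if "x \<in> A" for k x
      using norm_hump_term_le[OF A[OF that] r] .
    show "summable (\<lambda>k. (1/3::real) ^ k * sqrt (1 / (1 - r\<^sup>2)))"
      by (intro summable_mult2 summable_geometric) simp
  qed
  then show ?thesis by (simp only: hump_eq_sum[abs_def] hump_sum_def[abs_def])
qed

lemma hump_sum_holomorphic: "hump_sum holomorphic_on ball 0 1"
proof (rule holomorphic_uniform_sequence[OF open_ball hump_holomorphic])
  fix x :: complex assume x: "x \<in> ball 0 1"
  define d where "d = (1 - cmod x) / 2"
  have d: "0 < d" "cmod x + d < 1" using x by (auto simp: d_def field_simps)
  have le: "cmod y \<le> cmod x + d" if "y \<in> cball x d" for y
    using that norm_triangle_sub[of y x] by (simp add: dist_norm norm_minus_commute)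
  have "cball x d \<subseteq> ball 0 1" using le d by fastforce
  then show "\<exists>d>0. cball x d \<subseteq> ball 0 1 \<and> uniform_limit (cball x d) hump hump_sum sequentially"
    using d uniform_limit_hump[OF d(2) le] by blast
qed

lemma hump_tendsto:
  assumes "x \<in> ball 0 1"
  shows "(\<lambda>k. hump k x) \<longlonglongrightarrow> hump_sum x"
  using tendsto_uniform_limitI[OF uniform_limit_hump[of "cmod x" "{x}"]] assms by simp

lemma hb_dom_hump_sum_diff: "hb_dom b ((3/2 * (1/3) ^ k)\<^sup>2) (\<lambda>x. hump_sum x - hump k x)"
proof (rule hb_dom_limit[where F = "\<lambda>i x. hump (k + i) x - hump k x"])
  show "hb_dom b ((3/2 * (1/3) ^ k)\<^sup>2) (\<lambda>x. hump (k + i) x - hump k x)" for i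
    by (rule hb_dom_hump_diff)
  show "(\<lambda>i. hump (k + i) x - hump k x) \<longlonglongrightarrow> hump_sum x - hump k x" if "x \<in> ball 0 1" for x
    using LIMSEQ_ignore_initial_segment[OF hump_tendsto[OF that], of k]
    by (intro tendsto_diff tendsto_const) (simp add: add.commute)
qed

lemma in_Hb_hump_sum: "in_Hb b hump_sum"
proof -
  have "hb_dom b ((3/2 * (1/3) ^ 0)\<^sup>2) (\<lambda>x. hump_sum x - hump 0 x)" by (rule hb_dom_hump_sum_diff)
  then have "hb_dom b ((3/2 * (1/3) ^ 0)\<^sup>2) hump_sum" by simp
  then show ?thesis unfolding in_Hb_def using hump_sum_holomorphic by blast
qed

lemma higher_deriv_hump_ge: "(1/3) ^ k * N k \<le> cmod ((deriv ^^ m) (hump (Suc k)) (zz k))"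
proof -
  let ?\<alpha> = "(deriv ^^ m) (hump k) (zz k)"
  let ?s = "(if 0 \<le> Re ?\<alpha> then 1 else - 1) * complex_of_real ((1/3) ^ k)"
  have "(deriv ^^ m) (normalized_kd k) (zz k) = inverse (of_real (N k)) * of_real (K m (zz k))"
    unfolding normalized_kd_def[abs_def] higher_deriv_kd_diag[OF zz, symmetric]
    by (rule higher_deriv_cmult[OF kd_holomorphic[OF b_holomorphic zz] zz open_ball])
  also have "\<dots> = of_real (N k)"
    using N_pos[of k] unfolding N_square[symmetric] by (simp add: power2_eq_square)
  finally have g: "(deriv ^^ m) (normalized_kd k) (zz k) = of_real (N k)" .
  have "(deriv ^^ m) (hump (Suc k)) (zz k) = ?\<alpha> + (deriv ^^ m) (\<lambda>x. ?s * normalized_kd k x) (zz k)"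
    unfolding hump.simps
    by (rule higher_deriv_add[OF hump_holomorphic
          holomorphic_on_mult[OF holomorphic_on_const normalized_kd_holomorphic] open_ball zz])
  also have "(deriv ^^ m) (\<lambda>x. ?s * normalized_kd k x) (zz k) = ?s * of_real (N k)"
    unfolding g[symmetric] by (rule higher_deriv_cmult[OF normalized_kd_holomorphic zz open_ball])
  also have "?s * of_real (N k) = (if 0 \<le> Re ?\<alpha> then 1 else - 1) * of_real ((1/3) ^ k * N k)"
    by simp
  finally have eq: "(deriv ^^ m) (hump (Suc k)) (zz k)
      = ?\<alpha> + (if 0 \<le> Re ?\<alpha> then 1 else - 1) * of_real ((1/3) ^ k * N k)" .
  show ?thesis
    unfolding eq by (rule norm_add_signed_ge) (use N_pos[of k] in simp)
qed

text \<open>At \<open>zz k\<close> the partial sum contributes at least \<open>N k / 3^k\<close> and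
  the tail at most half of that, while \<open>N k > 4^k\<close>.\<close>

lemma higher_deriv_hump_sum_ge: "(4/3) ^ k / 2 \<le> cmod ((deriv ^^ m) hump_sum (zz k))"
proof -
  have "(cmod ((deriv ^^ m) (\<lambda>x. hump_sum x - hump (Suc k) x) (zz k)))\<^sup>2 \<le> (3/2 * (1/3) ^ Suc k)\<^sup>2 * K m (zz k)"
    by (rule hb_dom_higher_deriv[OF holomorphic_on_diff[OF hump_sum_holomorphic hump_holomorphic] hb_dom_hump_sum_diff zz])
  also have "\<dots> = ((1/3) ^ k * N k / 2)\<^sup>2"
    unfolding N_square[symmetric] by (simp add: power_mult_distrib[symmetric])
  finally have "cmod ((deriv ^^ m) (\<lambda>x. hump_sum x - hump (Suc k) x) (zz k)) \<le> (1/3) ^ k * N k / 2"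
    by (rule power2_le_imp_le) (use N_pos[of k] in simp)
  then have "cmod ((deriv ^^ m) hump_sum (zz k) - (deriv ^^ m) (hump (Suc k)) (zz k)) \<le> (1/3) ^ k * N k / 2"
    unfolding higher_deriv_diff[OF hump_sum_holomorphic hump_holomorphic open_ball zz] .
  then have "(1/3) ^ k * N k / 2 \<le> cmod ((deriv ^^ m) hump_sum (zz k))"
    using higher_deriv_hump_ge[of k]
      norm_triangle_sub[of "(deriv ^^ m) (hump (Suc k)) (zz k)" "(deriv ^^ m) hump_sum (zz k)"]
    unfolding norm_minus_commute[of "(deriv ^^ m) (hump (Suc k)) (zz k)"] by linarith
  moreover have "(4/3) ^ k \<le> (1/3) ^ k * N k"
  proof -
    have "(1/3) ^ k * 4 ^ k \<le> (1/3) ^ k * N k" using N_gt[of k] by (intro mult_left_mono) auto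
    then show ?thesis by (simp add: power_mult_distrib[symmetric])
  qed
  ultimately show ?thesis by linarith
qed

end

text \<open>Uniform boundedness principle, by a gliding hump.\<close>
lemma K_bounded_if_convergent:
  assumes conv: "\<And>f. in_Hb b f \<Longrightarrow> \<exists>L. ((deriv ^^ m) f \<longlongrightarrow> L) (at 1 within \<Omega>)"
  shows "\<exists>M. \<forall>z\<in>\<Omega>. K m z \<le> M"
proof (rule ccontr)
  assume "\<not> ?thesis"
  then have "\<forall>k. \<exists>z. z \<in> \<Omega> \<and> (4 ^ k)\<^sup>2 < K m z" by (meson not_le)
  from choice[OF this] obtain zz where zz\<Omega>: "\<And>k. zz k \<in> \<Omega>" and large: "\<And>k. (4 ^ k)\<^sup>2 < K m (zz k)" by blast
  have zzb: "zz k \<in> ball 0 1" for k using zz\<Omega> by (rule \<Omega>_in_ball)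
  define f where "f = hump_sum m zz"
  have f: "in_Hb b f" unfolding f_def by (rule in_Hb_hump_sum[OF zzb large])
  have ge: "(4/3) ^ k / 2 \<le> cmod ((deriv ^^ m) f (zz k))" for k
    unfolding f_def by (rule higher_deriv_hump_sum_ge[OF zzb large])
  obtain L where "((deriv ^^ m) f \<longlongrightarrow> L) (at 1 within \<Omega>)" using conv[OF f] by blast
  then have "eventually (\<lambda>z. dist ((deriv ^^ m) f z) L < 1) (at 1 within \<Omega>)" by (rule tendstoD) simp
  then obtain \<eta> where \<eta>: "0 < \<eta>" and near: "\<forall>z\<in>\<Omega>. z \<noteq> 1 \<and> dist z 1 < \<eta> \<longrightarrow> dist ((deriv ^^ m) f z) L < 1"
    unfolding eventually_at by blast
  \<comment> \<open>The points \<open>zz k\<close> have not been shown to approach 1, so the bound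
    that the limit yields near 1 is supplemented by continuity on compact disks.\<close>
  have "\<exists>B. \<forall>z\<in>\<Omega>. cmod ((deriv ^^ m) f z) \<le> B"
  proof (rule bounded_from_near_1[OF \<eta>, of _ "cmod L + 1"])
    fix z assume z: "z \<in> \<Omega>" "cmod (z - 1) < \<eta>"
    then have "z \<noteq> 1" using one_notin_\<Omega> by blast
    then have "dist ((deriv ^^ m) f z) L < 1" using near z by (simp add: dist_norm)
    then show "cmod ((deriv ^^ m) f z) \<le> cmod L + 1"
      using norm_triangle_sub[of "(deriv ^^ m) f z" L] by (simp add: dist_norm)
  next
    fix r :: real assume r: "r < 1"
    have "f holomorphic_on ball 0 1" using f by (simp add: in_Hb_def)
    then have "continuous_on (ball 0 1) ((deriv ^^ m) f)"
      by (intro holomorphic_on_imp_continuous_on holomorphic_higher_deriv) auto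
    then have "continuous_on (cball 0 r) ((deriv ^^ m) f)"
      by (rule continuous_on_subset) (use r in auto)
    then have "bounded ((deriv ^^ m) f ` cball 0 r)"
      by (intro compact_imp_bounded compact_continuous_image) auto
    then obtain B where "\<forall>z\<in>cball 0 r. cmod ((deriv ^^ m) f z) \<le> B"
      unfolding bounded_iff by auto
    then show "\<exists>M. \<forall>z. cmod z \<le> r \<longrightarrow> cmod ((deriv ^^ m) f z) \<le> M"
      by (intro exI[of _ B]) simp
  qed
  then obtain B where B: "\<forall>z\<in>\<Omega>. cmod ((deriv ^^ m) f z) \<le> B" by blast
  obtain k where "2 * B < (4/3) ^ k" using real_arch_pow[of "4/3" "2 * B"] by auto
  moreover have "(4/3) ^ k / 2 \<le> B" using ge[of k] B zz\<Omega>[of k] by (meson order_trans)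
  ultimately show False by simp
qed

section \<open>The equivalences\<close>

lemma bdd_above_hb_norm_iff:
  "bdd_above ((\<lambda>z. hb_norm b (kd b m z)) ` \<Omega>) \<longleftrightarrow> (\<exists>M. \<forall>z\<in>\<Omega>. K m z \<le> M)"
proof
  assume "bdd_above ((\<lambda>z. hb_norm b (kd b m z)) ` \<Omega>)"
  then obtain M where "\<forall>x\<in>(\<lambda>z. hb_norm b (kd b m z)) ` \<Omega>. x \<le> M"
    unfolding bdd_above_def by blast
  then have M: "hb_norm b (kd b m z) \<le> M" if "z \<in> \<Omega>" for z using that by blast
  have "K m z \<le> M\<^sup>2" if z: "z \<in> \<Omega>" for z
    using M[OF z] unfolding hb_norm_kd[OF \<Omega>_in_ball[OF z]] by (rule sqrt_le_D)
  then show "\<exists>M. \<forall>z\<in>\<Omega>. K m z \<le> M" by blast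
next
  assume "\<exists>M. \<forall>z\<in>\<Omega>. K m z \<le> M"
  then obtain M where M: "\<forall>z\<in>\<Omega>. K m z \<le> M" by blast
  show "bdd_above ((\<lambda>z. hb_norm b (kd b m z)) ` \<Omega>)"
  proof (rule bdd_aboveI2)
    show "hb_norm b (kd b m z) \<le> sqrt M" if "z \<in> \<Omega>" for z
      using M that by (simp add: hb_norm_kd[OF \<Omega>_in_ball])
  qed
qed

lemma K_bounded_iff_convergent:
  "(\<exists>M. \<forall>z\<in>\<Omega>. K m z \<le> M) \<longleftrightarrow> (\<forall>f. in_Hb b f \<longrightarrow> (\<exists>L. ((deriv ^^ m) f \<longlongrightarrow> L) (at 1 within \<Omega>)))"
proof
  assume "\<exists>M. \<forall>z\<in>\<Omega>. K m z \<le> M"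
  then obtain M where M: "\<And>z. z \<in> \<Omega> \<Longrightarrow> K m z \<le> M" by blast
  show "\<forall>f. in_Hb b f \<longrightarrow> (\<exists>L. ((deriv ^^ m) f \<longlongrightarrow> L) (at 1 within \<Omega>))"
    using higher_deriv_convergent[OF M] by simp
next
  assume "\<forall>f. in_Hb b f \<longrightarrow> (\<exists>L. ((deriv ^^ m) f \<longlongrightarrow> L) (at 1 within \<Omega>))"
  then show "\<exists>M. \<forall>z\<in>\<Omega>. K m z \<le> M"
    by (intro K_bounded_if_convergent) simp
qed

lemma K_bounded_iff_J_bounded:
  "(\<exists>M. \<forall>z\<in>\<Omega>. K m z \<le> M) \<longleftrightarrow> (\<exists>M. \<forall>z\<in>\<Omega>. J (2*m+2) z \<le> M)"
  using J_bounded_if_K_bounded K_bounded_if_J_bounded by blast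

end

theorem theoremA:
  fixes b :: "complex \<Rightarrow> complex" and \<nu> :: "complex measure"
    and \<Omega> :: "complex set" and m :: nat
  assumes "b holomorphic_on ball 0 1" and "b ` ball 0 1 \<subseteq> ball 0 1"
    and "\<exists>z \<in> ball 0 1. b z \<noteq> 0"
    and "singular_factor_measure b \<nu>"
    and "approach_region \<Omega>"
  shows "(bdd_above ((\<lambda>z. hb_norm b (kd b m z)) ` \<Omega>)
          \<longleftrightarrow> (\<forall>f. in_Hb b f \<longrightarrow> (\<exists>L. ((deriv ^^ m) f \<longlongrightarrow> L) (at 1 within \<Omega>))))
       \<and> (bdd_above ((\<lambda>z. hb_norm b (kd b m z)) ` \<Omega>)
          \<longleftrightarrow> (\<exists>C::real. \<forall>z\<in>\<Omega>.
                (\<integral>\<^sup>+ a. ennreal (of_nat (nat (zorder b a)) * (1 - (cmod a)^2)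
                        / (cmod (1 - cnj a * z)) ^ (2*m+2)) \<partial>count_space (zeros_D b))
              + (\<integral>\<^sup>+ \<zeta>. ennreal (1 / (cmod (1 - cnj \<zeta> * z)) ^ (2*m+2)) \<partial>\<nu>)
              + (\<integral>\<^sup>+ \<zeta>. ennreal (- ln (bdry_abs b \<zeta>) / (cmod (1 - cnj \<zeta> * z)) ^ (2*m+2)) \<partial>mT)
              \<le> ennreal C))"
proof (rule blaschke_approximation[OF assms(1-4)])
  fix a :: "nat \<Rightarrow> nat \<Rightarrow> complex" and n \<gamma> J
  assume a: "\<And>N i. cmod (a N i) \<le> 1" "cmod \<gamma> = 1"
    "\<And>z j. z \<in> ball 0 1 \<Longrightarrow>
       (\<lambda>N::nat. \<gamma> * (deriv ^^ j) (blaschke_prod (a N) (n N)) z) \<longlonglongrightarrow> (deriv ^^ j) b z"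
    "\<And>z p. z \<in> ball 0 1 \<Longrightarrow> (\<lambda>N. blaschke_sum (a N) (n N) p z) \<longlonglongrightarrow> J p z"
    and J1: "\<And>z p. z \<in> ball 0 1 \<Longrightarrow> zero_boundary_sum b \<nu> p z \<le> ennreal (J p z)"
    and J2: "\<And>z p. z \<in> ball 0 1 \<Longrightarrow> ennreal (J p z) \<le> 2 * zero_boundary_sum b \<nu> p z"
  have sub: "\<Omega> \<subseteq> ball 0 1" and fr: "frontier \<Omega> \<inter> sphere 0 1 = {1}"
    using assms(5) by (auto simp: approach_region_def)
  obtain \<delta> where \<delta>: "0 < \<delta>" "\<forall>z\<in>\<Omega>. cmod (z - 1) < \<delta> \<longrightarrow> closed_segment 1 z - {1} \<subseteq> \<Omega>"
    using assms(5) unfolding approach_region_def by blast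
  interpret approach_limit b a n \<gamma> J \<Omega> \<delta>
  proof
    fix \<eta> :: real assume \<eta>: "0 < \<eta>"
    have "1 \<in> closure \<Omega>" using fr by (auto simp: frontier_def)
    then show "\<exists>z\<in>\<Omega>. cmod (z - 1) < \<eta>"
      using \<eta> unfolding closure_approachable by (simp add: dist_norm)
    show "\<exists>r<1. \<forall>z\<in>\<Omega>. \<eta> \<le> cmod (z - 1) \<longrightarrow> cmod z \<le> r"
      by (rule approach_region_bounded_away[OF assms(5) \<eta>])
  next
    show "closed_segment 1 z - {1} \<subseteq> \<Omega>" if "z \<in> \<Omega>" "cmod (z - 1) < \<delta>" for z
      using \<delta>(2) that by blast
  qed (assumption | rule assms(1,2) a sub \<delta>(1))+
  have "(\<exists>M. \<forall>z\<in>\<Omega>. J (2*m+2) z \<le> M) \<longleftrightarrow> (\<exists>C::real. \<forall>z\<in>\<Omega>. zero_boundary_sum b \<nu> (2*m+2) z \<le> ennreal C)"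
  proof
    assume "\<exists>M. \<forall>z\<in>\<Omega>. J (2*m+2) z \<le> M"
    then obtain M where M: "\<forall>z\<in>\<Omega>. J (2*m+2) z \<le> M" by blast
    have "zero_boundary_sum b \<nu> (2*m+2) z \<le> ennreal M" if z: "z \<in> \<Omega>" for z
      using J1[OF \<Omega>_in_ball[OF z]] ennreal_leI[OF M[rule_format, OF z]] by (rule order_trans)
    then show "\<exists>C::real. \<forall>z\<in>\<Omega>. zero_boundary_sum b \<nu> (2*m+2) z \<le> ennreal C" by blast
  next
    assume "\<exists>C::real. \<forall>z\<in>\<Omega>. zero_boundary_sum b \<nu> (2*m+2) z \<le> ennreal C"
    then obtain C where C: "\<forall>z\<in>\<Omega>. zero_boundary_sum b \<nu> (2*m+2) z \<le> ennreal C" by blast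
    \<comment> \<open>The factor 2 is the one between \<open>J\<close> and the sum of zeros and
      measures; the absolute value covers a negative \<open>C\<close>, for which
      \<open>ennreal C\<close> is 0.\<close>
    have "J (2*m+2) z \<le> 2 * \<bar>C\<bar>" if z: "z \<in> \<Omega>" for z
    proof -
      have "ennreal (J (2*m+2) z) \<le> 2 * zero_boundary_sum b \<nu> (2*m+2) z"
        by (rule J2[OF \<Omega>_in_ball[OF z]])
      also have "\<dots> \<le> 2 * ennreal \<bar>C\<bar>"
        using C z by (intro mult_left_mono) (auto intro: order_trans ennreal_leI)
      also have "\<dots> = ennreal (2 * \<bar>C\<bar>)" by (simp add: ennreal_mult)
      finally show ?thesis by (simp add: ennreal_le_iff)
    qed
    then show "\<exists>M. \<forall>z\<in>\<Omega>. J (2*m+2) z \<le> M" by blast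
  qed
  then have "(\<exists>M. \<forall>z\<in>\<Omega>. K m z \<le> M) \<longleftrightarrow> (\<exists>C::real. \<forall>z\<in>\<Omega>. zero_boundary_sum b \<nu> (2*m+2) z \<le> ennreal C)"
    unfolding K_bounded_iff_J_bounded .
  with K_bounded_iff_convergent[of m] show ?thesis
    unfolding bdd_above_hb_norm_iff zero_boundary_sum_def by (rule conjI)
qed

end
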